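(* Let $(\mathbf{m},\mathbf{d})$ be an MD pair where $\mathbf{m}=(m_0,m_1,\dots,m_\ell)$ with $\ell\ge2$ and $n=m_0+\cdots+m_\ell$. Suppose that $\mathrm{PF}(\mathbf{m},\mathbf{d})$ is $n$-dimensional and simple. Then its $h$-polynomial is $$h(t)=\begin{cases}\displaystyle\left(\sum_{j=0}^{m_\ell}\binom{n}{j}t^j\right)+t\sum_{i=1}^{\ell-1}\binom{n}{i+m_\ell}A(T(i,m_\ell),t) & \text{if } m_0=0,\\[3mm] \displaystyle g(t)+\left(\sum_{j=0}^{m_\ell}\binom{n}{j}t^j\right)+t\sum_{i=1}^{\ell-2}\binom{n}{i+m_\ell}A(T(i,m_\ell),t) & \text{otherwise,}\end{cases}$$ where $$g(t)=\left[\sum_{i=0}^{z}\binom{n}{i}\left(\sum_{j=i+1}^{n-i}t^j\right)\right]+\sum_{i=1}^{\ell-2}\binom{n}{i+m_\ell}\left(\sum_{j=2}^{n-i-m_\ell}t^j\right)A(T(i,m_\ell),t)$$ and $z=\min(m_\ell,\,n-m_\ell-1)$.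
   Context: Parking function polytope. For nonzero $\mathbf{u}=(u_1,\dots,u_n)$ with $0\le u_1\le\cdots\le u_n$, a vector $\mathbf{a}\in\mathbb{R}^n_{\ge0}$ with nondecreasing rearrangement $b_1\le\cdots\le b_n$ is a $\mathbf{u}$-parking function if $b_i\le u_i$ for all $i$; $\mathrm{PF}(\mathbf{u})$ is the convex hull of all $\mathbf{u}$-parking functions. MD pair. Let $d_1<\cdots<d_\ell$ ($\ell\ge1$) be the distinct positive numbers appearing in $\mathbf{u}$, $m_0$ the number of zeros in $\mathbf{u}$, and $m_i$ the number of entries equal to $d_i$. Then $\mathbf{m}=(m_0,m_1,\dots,m_\ell)$ is the multiplicity vector of $\mathbf{u}$, $\mathbf{d}=(d_1,\dots,d_\ell)$ its data vector, and $(\mathbf{m},\mathbf{d})$ its MD pair; $\mathbf{u}$ is recovered from $(\mathbf{m},\mathbf{d})$, and $\mathrm{PF}(\mathbf{m},\mathbf{d}):=\mathrm{PF}(\mathbf{u})$. A $d$-dimensional polytope is simple if every vertex is incident to exactly $d$ edges. For a simple $d$-dimensional polytope $P$ with $f_i(P)$ faces of dimension $i$ and $f_P(t)=\sum_{i=0}^d f_i(P)t^i$, the $h$-polynomial $h_P$ is defined by $f_P(t)=h_P(t+1)$. For positive integers $p,q$, $T(p,q)$ is the poset on $\{1,\dots,p+q\}$ with covering relations $j\lessdot j+1$ for $1\le j\le p-1$ and $p\lessdot k$ for all $k\in\{p+1,\dots,p+q\}$. For a poset $Q$ on $\{1,\dots,N\}$ whose Hasse diagram is a tree, $\mathfrak{S}_N(Q)=\{\sigma(Q)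 : \sigma\in\mathfrak{S}_N\}$ is the set of (distinct) posets on $\{1,\dots,N\}$ obtained from $Q$ by permuting labels, and the generalized Eulerian polynomial is $A(Q,t)=\sum_{T\in\mathfrak{S}_N(Q)}t^{\mathrm{asc}(T)}$, where $\mathrm{asc}(T)$ is the number of pairs $(i,j)$ such that $j$ covers $i$ in $T$ and $j>i$ as integers. Empty sums are $0$. *)

theory Defs
  imports
    "HOL-Analysis.Analysis"
    "HOL-Combinatorics.Permutations"
    "HOL-Computational_Algebra.Polynomial"
    "HOL-Library.Multiset"
begin

section \<open>Parking function polytopes\<close>

definition admissible :: "real list \<Rightarrow> bool" where
  "admissible u \<longleftrightarrow> sorted u \<and> (\<forall>x\<in>set u. 0 \<le> x) \<and> (\<exists>x\<in>set u. x \<noteq> 0)"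

definition rearrangement :: "real^'n \<Rightarrow> real list" where
  "rearrangement a = sorted_list_of_multiset (image_mset (($) a) (mset_set UNIV))"

text \<open>\<open>list_all2\<close> also demands that the length of \<open>u\<close> is the dimension of the ambient space.\<close>

definition parking_function :: "real list \<Rightarrow> real^'n \<Rightarrow> bool" where
  "parking_function u a \<longleftrightarrow> (\<forall>i. 0 \<le> a $ i) \<and> list_all2 (\<le>) (rearrangement a) u"

definition PF :: "real list \<Rightarrow> (real^'n) set" where
  "PF u = convex hull {a. parking_function u a}"


section \<open>MD pairs\<close>

definition data_vector :: "real list \<Rightarrow> real list" where
  "data_vector u = sorted_list_of_set {x \<in> set u. 0 < x}"

definition multiplicity_vector :: "real list \<Rightarrow> nat list" where
  "multiplicity_vector u = count_list u 0 # map (count_list u) (data_vector u)"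

definition MD_pair :: "nat list \<Rightarrow> real list \<Rightarrow> bool" where
  "MD_pair m d \<longleftrightarrow> (\<exists>u. admissible u \<and> m = multiplicity_vector u \<and> d = data_vector u)"

text \<open>The vector \<open>u\<close> recovered from its MD pair; see \<open>MD_vector_eq\<close> below. Since \<open>d\<close>
  carries no entry for the zeros of \<open>u\<close>, entry \<open>i\<close> of \<open>tl m\<close> belongs to entry \<open>i\<close> of \<open>d\<close>.\<close>

definition MD_vector :: "nat list \<Rightarrow> real list \<Rightarrow> real list" where
  "MD_vector m d = replicate (hd m) 0 @ concat (map2 replicate (tl m) d)"

definition PF_MD :: "nat list \<Rightarrow> real list \<Rightarrow> (real^'n) set" where
  "PF_MD m d = PF (MD_vector m d)"

lemma sorted_concat_replicate:
  fixes ds :: "'a::linorder list"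
  shows "sorted ds \<Longrightarrow> sorted (concat (map (\<lambda>x. replicate (c x) x) ds))"
  by (induction ds) (auto simp: sorted_append sorted_replicate)

lemma count_concat_replicate:
  "distinct ds \<Longrightarrow>
     count (mset (concat (map (\<lambda>x. replicate (c x) x) ds))) y = (if y \<in> set ds then c y else 0)"
  by (induction ds) auto

lemma MD_vector_eq:
  assumes "admissible u"
  shows "MD_vector (multiplicity_vector u) (data_vector u) = u"
proof -
  let ?d = "data_vector u"
  let ?v = "concat (map (\<lambda>x. replicate (count_list u x) x) (0 # ?d))"
  have set_d: "set ?d = {x \<in> set u. 0 < x}" and d: "distinct ?d" "sorted ?d"
    by (simp_all add: data_vector_def)
  have "map2 replicate (map f xs) xs = map (\<lambda>x. replicate (f x) x) xs" for f and xs :: "real list"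
    by (induction xs) auto
  then have v: "MD_vector (multiplicity_vector u) ?d = ?v"
    by (simp add: MD_vector_def multiplicity_vector_def)
  have "sorted (0 # ?d)" "distinct (0 # ?d)"
    using d set_d by auto
  then have "sorted ?v" and cnt: "count (mset ?v) y = (if y \<in> set (0 # ?d) then count_list u y else 0)" for y
    by (simp_all only: sorted_concat_replicate count_concat_replicate)
  have "mset ?v = mset u"
  proof (rule multiset_eqI)
    fix y
    have "y \<notin> set (0 # ?d) \<Longrightarrow> y \<notin> set u"
      using assms set_d by (force simp: admissible_def)
    then show "count (mset ?v) y = count (mset u) y"
      unfolding cnt by (auto simp: count_mset)
  qed
  with \<open>sorted ?v\<close> have "sort u = ?v"
    by (intro properties_for_sort)
  with assms v show ?thesis
    by (simp add: admissible_def sort_key_id_if_sorted)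
qed


section \<open>Simple polytopes and their h-polynomials\<close>

definition simple_polytope :: "'a::euclidean_space set \<Rightarrow> bool" where
  "simple_polytope P \<longleftrightarrow> polytope P \<and>
     (\<forall>v. v extreme_point_of P \<longrightarrow> int (card {e. e edge_of P \<and> v \<in> e}) = aff_dim P)"

definition num_faces :: "'a::euclidean_space set \<Rightarrow> nat \<Rightarrow> nat" where
  "num_faces P i = card {F. F face_of P \<and> aff_dim F = int i}"

definition f_polynomial :: "'a::euclidean_space set \<Rightarrow> int poly" where
  "f_polynomial P = (\<Sum>i\<le>nat (aff_dim P). monom (int (num_faces P i)) i)"

definition h_polynomial :: "'a::euclidean_space set \<Rightarrow> int poly" where
  "h_polynomial P = (THE h. f_polynomial P = pcompose h [:1, 1:])"

lemma pcompose_shift_unique: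
  fixes f h :: "int poly"
  shows "f = pcompose h [:1, 1:] \<longleftrightarrow> h = pcompose f [:-1, 1:]"
proof -
  have "pcompose (pcompose p [:1, 1:]) [:-1, 1:] = p"
    and "pcompose (pcompose p [:-1, 1:]) [:1, 1:] = p" for p :: "int poly"
    by (simp_all add: pcompose_assoc [symmetric] pcompose_pCons)
  then show ?thesis by metis
qed

lemma h_polynomial_eq: "h_polynomial P = pcompose (f_polynomial P) [:-1, 1:]"
  by (simp add: h_polynomial_def pcompose_shift_unique)

lemma f_polynomial_eq: "f_polynomial P = pcompose (h_polynomial P) [:1, 1:]"
  by (simp add: pcompose_shift_unique h_polynomial_eq)


section \<open>Generalized Eulerian polynomials\<close>

text \<open>A poset on \<open>{1..N}\<close> is its reflexive order relation, so that distinct posets are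
  distinct sets of pairs.\<close>

definition covers :: "nat rel \<Rightarrow> nat rel" where
  "covers r = {(i, j). (i, j) \<in> r \<and> i \<noteq> j \<and>
     \<not> (\<exists>k. k \<noteq> i \<and> k \<noteq> j \<and> (i, k) \<in> r \<and> (k, j) \<in> r)}"

definition asc :: "nat rel \<Rightarrow> nat" where
  "asc r = card {(i, j). (i, j) \<in> covers r \<and> i < j}"

definition relabelings :: "nat \<Rightarrow> nat rel \<Rightarrow> nat rel set" where
  "relabelings N r = {map_prod \<sigma> \<sigma> ` r |\<sigma>. \<sigma> permutes {1..N}}"

definition eulerian_poly :: "nat \<Rightarrow> nat rel \<Rightarrow> int poly" where
  "eulerian_poly N r = (\<Sum>T\<in>relabelings N r. monom 1 (asc T))"

definition T_covers :: "nat \<Rightarrow> nat \<Rightarrow> nat rel" where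
  "T_covers p q = {(j, j + 1) |j. 1 \<le> j \<and> j < p} \<union> {(p, k) |k. k \<in> {p+1..p+q}}"

definition T_poset :: "nat \<Rightarrow> nat \<Rightarrow> nat rel" where
  "T_poset p q = (T_covers p q)\<^sup>* \<inter> {1..p+q} \<times> {1..p+q}"

lemma T_poset_iff:
  assumes "1 \<le> p"
  shows "(i, j) \<in> T_poset p q \<longleftrightarrow> 1 \<le> i \<and> j \<le> p + q \<and> (i = j \<or> i < j \<and> i \<le> p)"
proof
  assume "(i, j) \<in> T_poset p q"
  then have *: "(i, j) \<in> (T_covers p q)\<^sup>*" and "1 \<le> i" "j \<le> p + q"
    by (auto simp: T_poset_def)
  from * have "i = j \<or> i < j \<and> i \<le> p"
    by (induction rule: converse_rtrancl_induct) (auto simp: T_covers_def)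
  with \<open>1 \<le> i\<close> \<open>j \<le> p + q\<close> show "1 \<le> i \<and> j \<le> p + q \<and> (i = j \<or> i < j \<and> i \<le> p)"
    by blast
next
  have chain: "(i, j) \<in> (T_covers p q)\<^sup>*" if "i \<le> j" "1 \<le> i" "j \<le> p" for i j
    using that
  proof (induction j rule: dec_induct)
    case (step j)
    then have "(j, Suc j) \<in> T_covers p q" by (auto simp: T_covers_def)
    with step show ?case by (meson Suc_leD rtrancl.rtrancl_into_rtrancl)
  qed simp
  assume r: "1 \<le> i \<and> j \<le> p + q \<and> (i = j \<or> i < j \<and> i \<le> p)"
  have "(i, j) \<in> (T_covers p q)\<^sup>*"
  proof (cases "i = j \<or> j \<le> p")
    case True
    with r chain show ?thesis by auto
  next
    case False
    with r have "(i, p) \<in> (T_covers p q)\<^sup>*" "(p, j) \<in> T_covers p q"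
      using chain by (auto simp: T_covers_def)
    then show ?thesis by (rule rtrancl.rtrancl_into_rtrancl)
  qed
  with r show "(i, j) \<in> T_poset p q"
    by (auto simp: T_poset_def)
qed

lemma partial_order_on_T_poset:
  assumes "1 \<le> p"
  shows "partial_order_on {1..p+q} (T_poset p q)"
  unfolding partial_order_on_def preorder_on_def refl_on_def trans_def antisym_def
  by (auto simp: T_poset_iff [OF assms])

lemma covers_T_poset:
  assumes "1 \<le> p"
  shows "covers (T_poset p q) = T_covers p q"
proof (rule set_eqI, clarify)
  fix i j
  have between: "k \<noteq> i \<and> k \<noteq> j \<and> (i, k) \<in> T_poset p q \<and> (k, j) \<in> T_poset p q
      \<longleftrightarrow> i < k \<and> k < j \<and> k \<le> p" if "1 \<le> i" "j \<le> p + q" "i \<le> p" for k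
    using that by (auto simp: T_poset_iff [OF assms])
  have "(i, j) \<in> covers (T_poset p q) \<longleftrightarrow> (1 \<le> i \<and> j \<le> p + q \<and> i < j \<and> i \<le> p) \<and>
      \<not> (\<exists>k. k \<noteq> i \<and> k \<noteq> j \<and> (i, k) \<in> T_poset p q \<and> (k, j) \<in> T_poset p q)"
    by (simp add: covers_def T_poset_iff [OF assms, of i j]) (meson less_imp_neq)
  also have "\<dots> \<longleftrightarrow> 1 \<le> i \<and> j \<le> p + q \<and> i < j \<and> i \<le> p \<and>
      \<not> (\<exists>k. i < k \<and> k < j \<and> k \<le> p)"
    by (simp only: conj_assoc between cong: conj_cong)
  also have "\<dots> \<longleftrightarrow> 1 \<le> i \<and> j \<le> p + q \<and> i < j \<and> i \<le> p \<and> (i = p \<or> j = i + 1)"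
    by (metis Suc_eq_plus1 Suc_leI le_neq_implies_less lessI less_Suc_eq not_less_eq less_le_not_le)
  also have "\<dots> \<longleftrightarrow> (i, j) \<in> T_covers p q"
    using assms by (auto simp: T_covers_def)
  finally show "(i, j) \<in> covers (T_poset p q) \<longleftrightarrow> (i, j) \<in> T_covers p q" .
qed

end

(* PF(u) is the polymatroid of all x >= 0 with x(S) <= f(|S|) for every set S of coordinates, where
   f(k) is the sum of the k largest entries of u. Counting edges at the vertex (u_1, ..., u_n) shows
   that simplicity forces m_1 = ... = m_(l-1) = 1. With q = m_l and r = l - 2, the only facets are then
   x_i >= 0, x_i <= d_l, and x(S) <= f(|S|) for q < |S| <= q + r or S everything. A set of
   facets has a common point iff it is given by disjoint sets N (zeros) and A (maximal
   coordinates, |A| <= q) and a chain C of sets containing A, where N misses every proper member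
   of C and |N| <= m_0 if C contains the full set. The normals of these facets are then
   independent, so every such triple contributes one face of codimension |N| + |A| + |C|.

   With s = t - 1, let w(U) be the sum of s^(|U| - |A| - |C|) over all (A, C) with union U. Removing
   the largest set of C gives a recurrence, so w(U) depends only on |U|; splitting a list at its first
   maximal increasing run gives the same recurrence for A(T(|U| - q, q), t). The h-polynomial
   follows by binomial identities; for m_0 > 0 they are checked after multiplication by t - 1. *)

theory Submission imports Defs begin

section \<open>Faces of a system of inequalities\<close>

text \<open>The edge count uses only that PF(u) satisfies the polymatroid inequalities; the converse
  inclusion is proved later, for the shape of u that simplicity has forced, because there the tight
  sets are known. At (u_1, ..., u_n) every coordinate owns one edge, and a repeated positive value
  below the top one yields an edge too many; the top value escapes since there is no larger value to
  swap with. The set A stands apart from the chain because f is linear up to q: up to q coordinates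
  may be maximal together, in no order. The bound |N| <= m_0 arises because f is constant from q + r
  + 1 on, so the total f(n) needs at least q + r + 1 nonzero coordinates. Independence does more
  than give codimensions: it allows any of the tight inequalities to be released separately, so that
  every triple is the exact tight set of some point. The obstacle for m_0 > 0 is a binomial sum over
  |N| truncated at m_0. The factor t - 1 makes it a piece of the expansion of a power of t. For m_0
  = 0 it has one term, which the recurrence for w(n) absorbs; this is the origin of the summand i =
  l - 1.\<close>

lemma face_of_tight_inequalities:
  assumes "Q \<subseteq> {x. \<forall>h\<in>D. a h \<bullet> x \<le> b h}" "convex Q"
  shows "{x\<in>Q. \<forall>h\<in>D. a h \<bullet> x = b h} face_of (Q :: 'e::euclidean_space set)"
proof -
  \<comment> \<open>The outer \<open>Q \<inter>\<close> covers empty D, where the intersection over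
    D is the whole space.\<close>
  have "{x\<in>Q. \<forall>h\<in>D. a h \<bullet> x = b h} = Q \<inter> (\<Inter>h\<in>D. Q \<inter> {x. a h \<bullet> x = b h})"
    by auto
  moreover have "Q \<inter> (\<Inter>h\<in>D. Q \<inter> {x. a h \<bullet> x = b h}) face_of Q"
  proof (cases "D = {}")
    case True
    then show ?thesis using assms(2) by (simp add: face_of_refl)
  next
    case False
    have "(\<Inter>h\<in>D. Q \<inter> {x. a h \<bullet> x = b h}) face_of Q"
    proof (rule face_of_Inter)
      fix T assume "T \<in> (\<lambda>h. Q \<inter> {x. a h \<bullet> x = b h}) ` D"
      then show "T face_of Q"
        using assms by (auto intro!: face_of_Int_supporting_hyperplane_le)
    qed (use False in auto)
    then show ?thesis using assms(2) face_of_Int face_of_refl by blast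
  qed
  ultimately show ?thesis by metis
qed

locale halfspace_system =
  fixes H :: "'h set" and a :: "'h \<Rightarrow> 'e::euclidean_space" and b :: "'h \<Rightarrow> real"
  assumes fin: "finite H"
begin

definition poly where "poly = {x. \<forall>h\<in>H. a h \<bullet> x \<le> b h}"

definition tight where "tight x = {h\<in>H. a h \<bullet> x = b h}"

definition slab where "slab D = {x\<in>poly. \<forall>h\<in>D. a h \<bullet> x = b h}"

lemma poly_Inter: "poly = (\<Inter>h\<in>H. {x. a h \<bullet> x \<le> b h})"
  by (auto simp: poly_def)

lemma convex_poly: "convex poly"
  unfolding poly_Inter by (intro convex_INT convex_halfspace_le)

lemma closed_poly: "closed poly"
  unfolding poly_Inter by (intro closed_INT ballI closed_halfspace_le)

lemma slab_face: "D \<subseteq> H \<Longrightarrow> slab D face_of poly"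
  unfolding slab_def by (rule face_of_tight_inequalities) (auto simp: convex_poly, auto simp: poly_def)

text \<open>Finitely many slack inequalities stay strict under a short move, and the sign of
  \<open>a h \<bullet> w\<close> controls the tight ones. The same move serves to prolong segments
  inside a slab and to release chosen constraints.\<close>

lemma small_step:
  assumes "x \<in> poly" and w: "\<And>h. h \<in> tight x \<Longrightarrow> a h \<bullet> w \<le> 0"
  shows "\<exists>e>0. x + e *\<^sub>R w \<in> poly \<and> (\<forall>h\<in>H - tight x. a h \<bullet> (x + e *\<^sub>R w) < b h)"
proof -
  have "\<forall>h\<in>H - tight x. \<forall>\<^sub>F e in at_right 0. a h \<bullet> (x + e *\<^sub>R w) < b h"
  proof
    fix h assume "h \<in> H - tight x"
    then have "a h \<bullet> (x + 0 *\<^sub>R w) < b h"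
      using assms(1) by (auto simp: tight_def poly_def order.strict_iff_order)
    moreover have "((\<lambda>e. a h \<bullet> (x + e *\<^sub>R w)) \<longlongrightarrow> a h \<bullet> (x + 0 *\<^sub>R w)) (at_right 0)"
      by (intro tendsto_intros)
    ultimately show "\<forall>\<^sub>F e in at_right 0. a h \<bullet> (x + e *\<^sub>R w) < b h"
      using order_tendstoD(2) by blast
  qed
  then have "\<forall>\<^sub>F e in at_right 0. \<forall>h\<in>H - tight x. a h \<bullet> (x + e *\<^sub>R w) < b h"
    using fin by (simp add: eventually_ball_finite)
  moreover have "\<forall>\<^sub>F e::real in at_right 0. 0 < e"
    by (rule eventually_at_right_less)
  ultimately have "\<forall>\<^sub>F e in at_right 0. 0 < e \<and> (\<forall>h\<in>H - tight x. a h \<bullet> (x + e *\<^sub>R w) < b h)"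
    by eventually_elim auto
  then obtain e where e: "0 < e" "\<forall>h\<in>H - tight x. a h \<bullet> (x + e *\<^sub>R w) < b h"
    using eventually_happens'[OF trivial_limit_at_right_real] by blast
  have "a h \<bullet> (x + e *\<^sub>R w) \<le> b h" if "h \<in> H" for h
  proof (cases "h \<in> tight x")
    case True
    then have "e * (a h \<bullet> w) \<le> 0" using w e(1) by (simp add: mult_le_0_iff)
    then show ?thesis using True by (simp add: tight_def inner_add_right)
  qed (use e that in \<open>force\<close>)
  then show ?thesis using e by (auto simp: poly_def)
qed

lemma rel_interior_slab:
  assumes "x \<in> poly"
  shows "x \<in> rel_interior (slab (tight x))"
proof -
  let ?S = "slab (tight x)"
  have conv: "convex ?S"
    using slab_face[of "tight x"] convex_poly by (auto simp: tight_def intro: face_of_imp_convex)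
  have xS: "x \<in> ?S" using assms by (auto simp: slab_def tight_def)
  show ?thesis
  proof (subst convex_rel_interior_iff[OF conv], blast intro: xS, intro ballI)
    fix y assume y: "y \<in> ?S"
    \<comment> \<open>The tight normals vanish on x - y, so the segment from y to x can be prolonged
      beyond x inside the slab.\<close>
    have "\<And>h. h \<in> tight x \<Longrightarrow> a h \<bullet> (x - y) \<le> 0"
      using y by (auto simp: slab_def tight_def inner_diff_right)
    from small_step[OF assms this] obtain e where e: "e > 0" "x + e *\<^sub>R (x - y) \<in> poly"
      by blast
    have "x + e *\<^sub>R (x - y) \<in> ?S"
      using e y by (auto simp: slab_def tight_def inner_diff_right inner_add_right)
    moreover have "x + e *\<^sub>R (x - y) = (1 - (1 + e)) *\<^sub>R y + (1 + e) *\<^sub>R x"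
      by (simp add: algebra_simps)
    ultimately show "\<exists>e>1. (1 - e) *\<^sub>R y + e *\<^sub>R x \<in> ?S"
      using e(1) by (metis less_add_same_cancel1)
  qed
qed

text \<open>Two faces whose relative interiors share a point contain each other; x is such a point
  for F and for the slab of its tight set.\<close>

lemma face_eq_slab:
  assumes "F face_of poly" "x \<in> rel_interior F"
  shows "F = slab (tight x)"
proof
  have x: "x \<in> F" "x \<in> poly"
    using assms rel_interior_subset face_of_imp_subset by blast+
  have sub: "tight x \<subseteq> H" by (auto simp: tight_def)
  have "x \<in> slab (tight x)" using x by (auto simp: slab_def tight_def)
  then show "F \<subseteq> slab (tight x)"
    using subset_of_face_of[OF slab_face[OF sub] face_of_imp_subset[OF assms(1)]] assms(2)
    by blast
  show "slab (tight x) \<subseteq> F"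
    using subset_of_face_of[OF assms(1) face_of_imp_subset[OF slab_face[OF sub]]]
      rel_interior_slab[OF x(2)] x(1) by blast
qed

text \<open>Near x the slab is the translate \<open>?W\<close> of the orthogonal complement of the
  tight normals: it lies in \<open>?W\<close> and contains the part of \<open>?W\<close> in the open
  set \<open>?U\<close>, which has full dimension in \<open>?W\<close>.\<close>

lemma aff_dim_slab:
  assumes "x \<in> poly" "inj_on a (tight x)" "independent (a ` tight x)"
  shows "aff_dim (slab (tight x)) = int DIM('e) - int (card (tight x))"
proof -
  let ?V = "{v. \<forall>h\<in>tight x. a h \<bullet> v = 0}"
  let ?U = "\<Inter>h\<in>H - tight x. {y. a h \<bullet> y < b h}"
  let ?W = "(+) x ` ?V"
  have V: "?V = {y \<in> UNIV. \<forall>x\<in>span (a ` tight x). orthogonal x y}"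
  proof -
    have "\<forall>z\<in>span (a ` tight x). orthogonal z y" if "\<forall>h\<in>tight x. a h \<bullet> y = 0" for y
    proof
      fix z assume "z \<in> span (a ` tight x)"
      then have "orthogonal y z"
      proof (rule orthogonal_to_span)
        show "orthogonal y v" if "v \<in> a ` tight x" for v
          using that \<open>\<forall>h\<in>tight x. a h \<bullet> y = 0\<close> by (auto simp: orthogonal_def inner_commute)
      qed
      then show "orthogonal z y" by (simp add: orthogonal_commute)
    qed
    then show ?thesis
      by (auto simp: orthogonal_def intro: span_base)
  qed
  have sV: "subspace ?V" by (auto simp: subspace_def inner_add_right)
  have "dim ?V + dim (span (a ` tight x)) = DIM('e)"
    unfolding V using dim_subspace_orthogonal_to_vectors[of "span (a ` tight x)" "UNIV :: 'e set"]
    by (simp add: dim_UNIV)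
  moreover have "dim (span (a ` tight x)) = card (tight x)"
    using assms by (metis card_image dim_eq_card_independent dim_span)
  ultimately have dV: "int (dim ?V) = int DIM('e) - int (card (tight x))" by linarith
  have adW: "aff_dim ?W = int (dim ?V)"
    using sV by (simp only: aff_dim_translation_eq aff_dim_subspace)
  have "open ?U" using fin by (intro open_INT) (auto simp: open_halfspace_lt)
  moreover have "convex ?W" using sV by (simp add: convex_translation subspace_imp_convex)
  moreover have "x \<in> ?W \<inter> ?U"
    using assms(1) by (force simp: tight_def poly_def)
  then have "?W \<inter> ?U \<noteq> {}" by blast
  ultimately have "aff_dim (?W \<inter> ?U) = aff_dim ?W"
    using aff_dim_convex_Int_open by blast
  moreover have "?W \<inter> ?U \<subseteq> slab (tight x)"
  proof
    fix y assume y: "y \<in> ?W \<inter> ?U"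
    then have 1: "\<forall>h\<in>tight x. a h \<bullet> y = b h"
      by (auto simp: inner_add_right tight_def)
    moreover have "a h \<bullet> y \<le> b h" if "h \<in> H" for h
      using 1 y that by (cases "h \<in> tight x") force+
    ultimately show "y \<in> slab (tight x)" by (auto simp: slab_def poly_def)
  qed
  moreover have "slab (tight x) \<subseteq> ?W"
  proof
    fix y assume "y \<in> slab (tight x)"
    then have "y - x \<in> ?V" by (auto simp: slab_def tight_def inner_diff_right)
    then show "y \<in> ?W" by (metis (no_types, lifting) add_diff_cancel_left' diff_add_cancel add.commute imageI)
  qed
  ultimately show ?thesis
    using aff_dim_subset[of "?W \<inter> ?U" "slab (tight x)"] aff_dim_subset[of "slab (tight x)" ?W] adW dV
    by linarith
qed

text \<open>By independence a linear functional may take the value 0 on the normals in D and -1 on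
  the other tight normals. The vector \<open>w\<close> representing it is a direction that keeps D
  tight and makes the rest slack.\<close>

lemma exists_point_tight_eq:
  assumes x: "x \<in> poly" and "inj_on a (tight x)" "independent (a ` tight x)" and D: "D \<subseteq> tight x"
  shows "\<exists>y\<in>poly. tight y = D"
proof -
  define c where "c v = (if v \<in> a ` D then 0 else - 1 :: real)" for v
  obtain f where f: "linear f" "\<And>v. v \<in> a ` tight x \<Longrightarrow> f v = c v"
    using linear_independent_extend[OF assms(3)] by metis
  define w where "w = adjoint f 1"
  have w: "a h \<bullet> w = (if h \<in> D then 0 else - 1)" if "h \<in> tight x" for h
  proof -
    have "a h \<bullet> w = f (a h)" unfolding w_def by (simp add: adjoint_works[OF f(1)])
    moreover have "a h \<in> a ` D \<longleftrightarrow> h \<in> D" using assms(2) D that by (auto dest: inj_onD)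
    ultimately show ?thesis using f(2) that by (auto simp: c_def)
  qed
  then obtain e where e: "e > 0" "x + e *\<^sub>R w \<in> poly"
      "\<forall>h\<in>H - tight x. a h \<bullet> (x + e *\<^sub>R w) < b h"
    using small_step[OF x, of w] by fastforce
  have "tight (x + e *\<^sub>R w) = D"
  proof (rule set_eqI)
    fix h
    show "h \<in> tight (x + e *\<^sub>R w) \<longleftrightarrow> h \<in> D"
    proof (cases "h \<in> tight x")
      case True
      then show ?thesis using w[OF True] e(1) by (auto simp: tight_def inner_add_right)
    next
      case False
      then have "h \<notin> D" using D by blast
      moreover have "h \<notin> tight (x + e *\<^sub>R w)"
      proof
        assume h: "h \<in> tight (x + e *\<^sub>R w)"
        then have "h \<in> H - tight x" using False by (simp add: tight_def)
        with e(3) have "a h \<bullet> (x + e *\<^sub>R w) < b h" by blast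
        with h show False by (simp add: tight_def)
      qed
      ultimately show ?thesis by simp
    qed
  qed
  with e(2) show ?thesis by blast
qed

text \<open>V is a guess for the family of all tight sets, possibly too large. A point of
  \<open>slab D\<close> has a tight set that contains D and belongs to V, hence is independent, so
  the surplus can be released. Thus every member of V is a tight set and labels its own
  face.\<close>

lemma bij_betw_slab:
  assumes tV: "\<And>x. x \<in> poly \<Longrightarrow> tight x \<in> V"
    and ind: "\<And>D. D \<in> V \<Longrightarrow> inj_on a D \<and> independent (a ` D)"
    and ne: "\<And>D. D \<in> V \<Longrightarrow> D \<subseteq> H \<and> slab D \<noteq> {}"
  shows "bij_betw slab {D\<in>V. int DIM('e) - int (card D) = int i} {F. F face_of poly \<and> aff_dim F = int i}"
proof -
  have ex: "\<exists>x\<in>poly. tight x = D" if "D \<in> V" for D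
  proof -
    obtain x where "x \<in> slab D" using ne \<open>D \<in> V\<close> by blast
    then have "x \<in> poly" "D \<subseteq> tight x" using ne[OF \<open>D \<in> V\<close>] by (auto simp: slab_def tight_def)
    then show ?thesis using ind[OF tV] by (intro exists_point_tight_eq) auto
  qed
  have dim: "aff_dim (slab D) = int DIM('e) - int (card D)" if "D \<in> V" for D
    using ex[OF that] aff_dim_slab ind that by metis
  show ?thesis
    unfolding bij_betw_def
  proof
    show "inj_on slab {D\<in>V. int DIM('e) - int (card D) = int i}"
    proof (rule inj_onI)
      fix D E assume D: "D \<in> {D\<in>V. int DIM('e) - int (card D) = int i}"
        and E: "E \<in> {D\<in>V. int DIM('e) - int (card D) = int i}" and eq: "slab D = slab E"
      obtain x y where x: "x \<in> poly" "tight x = D" and y: "y \<in> poly" "tight y = E"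
        using ex D E by blast
      then have "x \<in> slab E" "y \<in> slab D" using eq by (auto simp: slab_def tight_def)
      then show "D = E" using x y ne D E by (auto simp: slab_def tight_def)
    qed
    show "slab ` {D\<in>V. int DIM('e) - int (card D) = int i} = {F. F face_of poly \<and> aff_dim F = int i}"
    proof (intro equalityI subsetI)
      fix F assume "F \<in> slab ` {D\<in>V. int DIM('e) - int (card D) = int i}"
      then show "F \<in> {F. F face_of poly \<and> aff_dim F = int i}"
        using dim ne slab_face by auto
    next
      fix F assume F: "F \<in> {F. F face_of poly \<and> aff_dim F = int i}"
      then have "convex F" "F \<noteq> {}" using face_of_imp_convex convex_poly by fastforce+
      then obtain x where x: "x \<in> rel_interior F" using rel_interior_eq_empty by blast
      then have xp: "x \<in> poly" using F rel_interior_subset face_of_imp_subset by blast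
      have "F = slab (tight x)" using F x by (simp add: face_eq_slab)
      then show "F \<in> slab ` {D\<in>V. int DIM('e) - int (card D) = int i}"
        using F dim[OF tV[OF xp]] tV[OF xp] by auto
    qed
  qed
qed

lemma f_polynomial_eq_sum:
  assumes tV: "\<And>x. x \<in> poly \<Longrightarrow> tight x \<in> V"
    and ind: "\<And>D. D \<in> V \<Longrightarrow> inj_on a D \<and> independent (a ` D)"
    and ne: "\<And>D. D \<in> V \<Longrightarrow> D \<subseteq> H \<and> slab D \<noteq> {}"
    and dim: "aff_dim poly = int DIM('e)"
  shows "f_polynomial poly = (\<Sum>D\<in>V. monom 1 (DIM('e) - card D))"
proof -
  let ?n = "DIM('e)"
  have fV: "finite V" using ne fin by (meson PowI finite_Pow_iff finite_subset subsetI)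
  have le: "card D \<le> ?n" if "D \<in> V" for D
    using ind[OF that] by (metis card_image independent_bound)
  have nf: "num_faces poly i = card {D\<in>V. ?n - card D = i}" if "i \<le> ?n" for i
  proof -
    have "num_faces poly i = card {D\<in>V. int ?n - int (card D) = int i}"
      unfolding num_faces_def using bij_betw_slab[OF tV ind ne, THEN bij_betw_same_card] by simp
    also have "{D\<in>V. int ?n - int (card D) = int i} = {D\<in>V. ?n - card D = i}"
      using le by force
    finally show ?thesis .
  qed
  have "f_polynomial poly = (\<Sum>i\<le>?n. monom (int (card {D\<in>V. ?n - card D = i})) i)"
    unfolding f_polynomial_def using dim nf by (intro sum.cong) auto
  also have "\<dots> = (\<Sum>i\<le>?n. \<Sum>D\<in>{D\<in>V. ?n - card D = i}. monom 1 (?n - card D))"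
  proof (rule sum.cong)
    fix i
    have "(\<Sum>D\<in>{D\<in>V. ?n - card D = i}. monom 1 (?n - card D)) = (\<Sum>D\<in>{D\<in>V. ?n - card D = i}. monom (1::int) i)"
      by (rule sum.cong) auto
    then show "monom (int (card {D\<in>V. ?n - card D = i})) i = (\<Sum>D\<in>{D\<in>V. ?n - card D = i}. monom 1 (?n - card D))"
      by (simp add: of_nat_poly smult_monom mult.commute)
  qed simp
  also have "\<dots> = (\<Sum>D\<in>V. monom 1 (?n - card D))"
    using fV by (intro sum.group) auto
  finally show ?thesis .
qed

end

section \<open>Parking functions and partial sums\<close>

text \<open>Ranks count from the largest entry, starting at 0. The padding by 0 makes the function
  antimonotone on all naturals, so no length conditions arise later.\<close>

definition desc :: "real list \<Rightarrow> nat \<Rightarrow> real" where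
  "desc u k = (if k < length u then rev u ! k else 0)"

definition top_sum :: "real list \<Rightarrow> nat \<Rightarrow> real" where
  "top_sum u c = (\<Sum>k<c. desc u k)"

lemma desc_nonneg: "\<forall>x\<in>set u. 0 \<le> x \<Longrightarrow> 0 \<le> desc u k"
  using nth_mem[of k "rev u"] by (simp add: desc_def)

lemma antimono_desc:
  assumes "sorted u" "\<forall>x\<in>set u. 0 \<le> x"
  shows "antimono (desc u)"
proof
  fix j k :: nat assume "j \<le> k"
  show "desc u k \<le> desc u j"
  proof (cases "k < length u")
    case True
    then show ?thesis
      using \<open>j \<le> k\<close> sorted_nth_mono[OF assms(1)] by (simp add: desc_def rev_nth)
  next
    case False
    then show ?thesis using desc_nonneg[OF assms(2), of j] by (simp add: desc_def)
  qed
qed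

lemma sum_le_sum_initial:
  fixes g :: "nat \<Rightarrow> real"
  assumes "antimono g" "finite K"
  shows "sum g K \<le> sum g {..<card K}"
  using assms(2)
proof (induction "card K" arbitrary: K)
  case (Suc c)
  then have "K \<noteq> {}" by auto
  define M where "M = Max K"
  have M: "M \<in> K" "K \<subseteq> {..M}" using \<open>K \<noteq> {}\<close> Suc.prems by (auto simp: M_def)
  then have "card K \<le> M + 1" by (metis Suc_eq_plus1 card_atMost card_mono finite_atMost)
  then have "g M \<le> g c" using Suc.hyps(2) by (intro antimonoD[OF assms(1)]) auto
  moreover have "sum g (K - {M}) \<le> sum g {..<c}"
  proof -
    have "card (K - {M}) = c" using M(1) Suc.prems Suc.hyps(2) by simp
    then show ?thesis using Suc.hyps(1)[of "K - {M}"] Suc.prems by simp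
  qed
  moreover have "sum g K = g M + sum g (K - {M})"
    by (rule sum.remove[OF Suc.prems M(1)])
  moreover have "sum g {..<card K} = g c + sum g {..<c}"
    by (simp add: Suc.hyps(2)[symmetric])
  ultimately show ?case by linarith
qed simp

text \<open>One tool for three purposes: sorting coordinates by value, turning the members of a
  chain into initial segments, and supplying some enumeration of the coordinates.\<close>

lemma ranking_exists:
  fixes \<kappa> :: "'n::finite \<Rightarrow> 'b::linorder"
  shows "\<exists>\<pi>. bij_betw \<pi> UNIV {..<CARD('n)} \<and> (\<forall>i j. \<kappa> i < \<kappa> j \<longrightarrow> \<pi> i < \<pi> j)"
proof -
  obtain es0 :: "'n list" where es0: "set es0 = UNIV" "distinct es0"
    using finite_distinct_list[of "UNIV :: 'n set"] by auto
  define es where "es = sort_key \<kappa> es0"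
  have es: "set es = UNIV" "distinct es" "sorted (map \<kappa> es)"
    using es0 by (simp_all add: es_def)
  then have len: "length es = CARD('n)" by (metis distinct_card)
  have bij: "bij_betw ((!) es) {..<CARD('n)} UNIV"
    using bij_betw_nth[OF es(2)] es(1) len by auto
  define \<pi> where "\<pi> = inv_into {..<CARD('n)} ((!) es)"
  have \<pi>: "bij_betw \<pi> UNIV {..<CARD('n)}" unfolding \<pi>_def by (rule bij_betw_inv_into[OF bij])
  have e: "es ! \<pi> i = i" "\<pi> i < CARD('n)" for i
    using bij \<pi> unfolding \<pi>_def by (auto simp: bij_betw_inv_into_right dest: bij_betwE)
  have "\<pi> i < \<pi> j" if "\<kappa> i < \<kappa> j" for i j
  proof (rule ccontr)
    assume "\<not> \<pi> i < \<pi> j"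
    then have "map \<kappa> es ! \<pi> j \<le> map \<kappa> es ! \<pi> i"
      using e(2)[of i] len by (intro sorted_nth_mono[OF es(3)]) auto
    then show False using that e len by simp
  qed
  with \<pi> show ?thesis by blast
qed

lemma rearrangement_eq:
  fixes a :: "real^'n"
  assumes \<pi>: "bij_betw \<pi> UNIV {..<CARD('n)}" and a: "\<And>i. a $ i = h (\<pi> i)"
    and h: "\<And>j k. j \<le> k \<Longrightarrow> k < CARD('n) \<Longrightarrow> h k \<le> h j"
  shows "rearrangement a = map (\<lambda>k. h (CARD('n) - 1 - k)) [0..<CARD('n)]" (is "_ = ?xs")
proof -
  let ?n = "CARD('n)"
  have "sorted ?xs"
    by (auto simp: sorted_iff_nth_mono intro!: h)
  moreover have "mset ?xs = image_mset (($) a) (mset_set UNIV)"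
  proof -
    have "bij_betw (\<lambda>k. ?n - 1 - k) {..<?n} {..<?n}"
      by (rule bij_betwI[where g = "\<lambda>k. ?n - 1 - k"]) auto
    then have "bij_betw ((\<lambda>k. ?n - 1 - k) \<circ> \<pi>) UNIV {..<?n}"
      using \<pi> bij_betw_trans by blast
    then have "mset_set {..<?n} = image_mset (\<lambda>i. ?n - 1 - \<pi> i) (mset_set UNIV)"
      by (subst image_mset_mset_set) (auto simp: bij_betw_def comp_def)
    then have "image_mset (\<lambda>k. h (?n - 1 - k)) (mset_set {..<?n}) =
        image_mset (\<lambda>i. h (?n - 1 - (?n - 1 - \<pi> i))) (mset_set UNIV)"
      by (simp add: image_mset.compositionality comp_def)
    also have "\<dots> = image_mset (($) a) (mset_set UNIV)"
    proof (rule image_mset_cong)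
      fix i
      have "\<pi> i < ?n" using \<pi> by (auto dest: bij_betwE)
      then show "h (?n - 1 - (?n - 1 - \<pi> i)) = a $ i" by (simp add: a)
    qed
    finally show ?thesis by (simp add: atLeast0LessThan)
  qed
  ultimately show ?thesis
    unfolding rearrangement_def by (metis sorted_list_of_multiset_mset sorted_sort_id)
qed

text \<open>The greedy points of the polymatroid. In \<open>PF_eq_poly\<close> every extreme point
  turns out to be one of them.\<close>

definition vtx :: "real list \<Rightarrow> ('n \<Rightarrow> nat) \<Rightarrow> nat \<Rightarrow> real^'n" where
  "vtx u \<pi> p = (\<chi> i. if \<pi> i < p then desc u (\<pi> i) else 0)"

lemma vtx_in_PF:
  fixes \<pi> :: "'n::finite \<Rightarrow> nat"
  assumes "sorted u" "\<forall>x\<in>set u. 0 \<le> x" "length u = CARD('n)" and \<pi>: "bij_betw \<pi> UNIV {..<CARD('n)}"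
  shows "vtx u \<pi> p \<in> PF u"
proof -
  let ?n = "CARD('n)"
  let ?h = "\<lambda>k. if k < p then desc u k else 0"
  have "rearrangement (vtx u \<pi> p) = map (\<lambda>k. ?h (?n - 1 - k)) [0..<?n]"
    using \<pi> by (rule rearrangement_eq)
      (auto simp: vtx_def desc_nonneg[OF assms(2)] intro: antimonoD[OF antimono_desc[OF assms(1,2)]])
  moreover have "list_all2 (\<le>) (map (\<lambda>k. ?h (?n - 1 - k)) [0..<?n]) u"
    using assms(2,3) by (auto simp: list_all2_conv_all_nth desc_def rev_nth)
  ultimately have "parking_function u (vtx u \<pi> p)"
    by (simp add: parking_function_def vtx_def desc_nonneg[OF assms(2)])
  then show ?thesis unfolding PF_def by (simp add: hull_inc)
qed

lemma parking_function_le_desc: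
  fixes a :: "real^'n"
  assumes "parking_function u a"
  shows "\<exists>\<pi>. bij_betw \<pi> UNIV {..<CARD('n)} \<and> (\<forall>i. a $ i \<le> desc u (\<pi> i))"
proof -
  let ?n = "CARD('n)"
  \<comment> \<open>The sign makes the largest coordinate get rank 0, in agreement with
    \<open>desc\<close>.\<close>
  obtain \<pi> where \<pi>: "bij_betw \<pi> UNIV {..<?n}" and mono: "\<And>i j. - (a $ i) < - (a $ j) \<Longrightarrow> \<pi> i < \<pi> j"
    using ranking_exists[of "\<lambda>i. - (a $ i)"] by blast
  define h where "h k = a $ inv_into UNIV \<pi> k" for k
  have r: "\<pi> (inv_into UNIV \<pi> k) = k" if "k < ?n" for k
    using \<pi> that by (simp add: bij_betw_inv_into_right)
  have "rearrangement a = map (\<lambda>k. h (?n - 1 - k)) [0..<?n]"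
    using \<pi>
  proof (rule rearrangement_eq)
    show "a $ i = h (\<pi> i)" for i
      unfolding h_def using \<pi> by (simp add: bij_betw_def inv_into_f_f)
    show "h k \<le> h j" if "j \<le> k" "k < ?n" for j k
      using mono[of "inv_into UNIV \<pi> k" "inv_into UNIV \<pi> j"] r that unfolding h_def by force
  qed
  moreover have "list_all2 (\<le>) (rearrangement a) u"
    using assms by (simp add: parking_function_def)
  ultimately have len: "length u = ?n" and le: "\<And>k. k < ?n \<Longrightarrow> h (?n - 1 - k) \<le> u ! k"
    by (auto simp: list_all2_conv_all_nth)
  have "a $ i \<le> desc u (\<pi> i)" for i
  proof -
    have lt: "\<pi> i < ?n" using \<pi> by (auto dest: bij_betwE)
    have "a $ i = h (\<pi> i)" unfolding h_def using \<pi> by (simp add: bij_betw_def inv_into_f_f)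
    also have "\<dots> \<le> u ! (?n - 1 - \<pi> i)" using le[of "?n - 1 - \<pi> i"] lt by simp
    also have "\<dots> = desc u (\<pi> i)" using lt len by (simp add: desc_def rev_nth)
    finally show ?thesis .
  qed
  with \<pi> show ?thesis by blast
qed

text \<open>The half of the polymatroid description that holds for every u: the inequalities cut out
  a convex set, and a parking function obeys them because distinct ranks contribute at most the top
  ranks.\<close>

lemma PF_bounds:
  fixes x :: "real^'n"
  assumes "sorted u" "\<forall>x\<in>set u. 0 \<le> x" "x \<in> PF u"
  shows "0 \<le> x $ i" and "(\<Sum>i\<in>S. x $ i) \<le> top_sum u (card S)"
proof -
  let ?K = "{x::real^'n. (\<forall>i. 0 \<le> x $ i) \<and> (\<forall>S. (\<Sum>i\<in>S. x $ i) \<le> top_sum u (card S))}"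
  have "PF u \<subseteq> ?K"
    unfolding PF_def
  proof (rule hull_minimal)
    show "{a. parking_function u a} \<subseteq> ?K"
    proof
      fix a :: "real^'n" assume "a \<in> {a. parking_function u a}"
      then have a: "parking_function u a" by simp
      then obtain \<pi> where \<pi>: "bij_betw \<pi> UNIV {..<CARD('n)}" "\<And>i. a $ i \<le> desc u (\<pi> i)"
        using parking_function_le_desc by blast
      have "(\<Sum>i\<in>S. a $ i) \<le> top_sum u (card S)" for S
      proof -
        have inj: "inj_on \<pi> S" using \<pi>(1) by (auto simp: bij_betw_def intro: inj_on_subset)
        have "(\<Sum>i\<in>S. a $ i) \<le> (\<Sum>i\<in>S. desc u (\<pi> i))" using \<pi>(2) by (rule sum_mono)
        also have "\<dots> = sum (desc u) (\<pi> ` S)" by (simp add: sum.reindex[OF inj])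
        also have "\<dots> \<le> top_sum u (card (\<pi> ` S))"
          unfolding top_sum_def by (intro sum_le_sum_initial antimono_desc assms) auto
        also have "card (\<pi> ` S) = card S" by (rule card_image[OF inj])
        finally show ?thesis .
      qed
      then show "a \<in> ?K" using a by (simp add: parking_function_def)
    qed
    have "?K = (\<Inter>i. {x. 0 \<le> x $ i}) \<inter> (\<Inter>S. {x. (\<Sum>i\<in>S. x $ i) \<le> top_sum u (card S)})"
      by auto
    moreover have "convex {x :: real^'n. 0 \<le> x $ i}" for i
      by (auto simp: convex_def)
    moreover have "convex {x :: real^'n. (\<Sum>i\<in>S. x $ i) \<le> top_sum u (card S)}" for S
      by (auto simp: convex_def sum.distrib simp flip: sum_distrib_left intro: convex_bound_le)
    ultimately show "convex ?K" by (simp add: convex_INT convex_Int)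
  qed
  then show "0 \<le> x $ i" "(\<Sum>i\<in>S. x $ i) \<le> top_sum u (card S)" using assms(3) by auto
qed

section \<open>Edges at a vertex of a polymatroid\<close>

definition indvec :: "'n set \<Rightarrow> real^'n" where
  "indvec S = (\<chi> i. if i \<in> S then 1 else 0)"

lemma inner_indvec: "indvec S \<bullet> x = (\<Sum>i\<in>S. x $ i)"
proof -
  have "indvec S \<bullet> x = (\<Sum>i\<in>UNIV. if i \<in> S then x $ i else 0)"
    unfolding inner_vec_def by (intro sum.cong) (auto simp: indvec_def)
  then show ?thesis by (simp add: sum.If_cases)
qed

text \<open>\<open>v\<close> is a vertex of \<open>P\<close> at which the polymatroid constraints of all its upper sets are tight.\<close>

locale polymatroid_vertex =
  fixes v :: "real^'n" and P :: "(real^'n) set"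
  assumes convex: "convex P" and v_in: "v \<in> P"
    and nonneg: "x \<in> P \<Longrightarrow> 0 \<le> x $ i"
    and bound: "x \<in> P \<Longrightarrow> \<forall>i\<in>S. \<forall>j\<in>-S. v $ j \<le> v $ i \<Longrightarrow> card T = card S \<Longrightarrow>
      (\<Sum>i\<in>T. x $ i) \<le> (\<Sum>i\<in>S. v $ i)"
begin

text \<open>Ties across the boundary are allowed, so coordinates of equal value may be added to an
  upper set, or removed from it, in any order.\<close>

definition upper where "upper S \<longleftrightarrow> (\<forall>i\<in>S. \<forall>j\<in>-S. v $ j \<le> v $ i)"

lemma upper_bound: "x \<in> P \<Longrightarrow> upper S \<Longrightarrow> (\<Sum>i\<in>S. x $ i) \<le> (\<Sum>i\<in>S. v $ i)"
  using bound unfolding upper_def by blast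

lemma tight_set_face:
  assumes "\<And>S. S \<in> D \<Longrightarrow> upper S"
  shows "{x\<in>P. (\<forall>S\<in>D. (\<Sum>i\<in>S. x $ i) = (\<Sum>i\<in>S. v $ i)) \<and> (\<forall>k\<in>Z. x $ k = 0)} face_of P"
proof -
  define a where "a = case_sum (\<lambda>k::'n. - axis k 1) (indvec :: 'n set \<Rightarrow> real^'n)"
  define b where "b = case_sum (\<lambda>k::'n. 0) (\<lambda>S. (\<Sum>i\<in>S. v $ i))"
  have "{x\<in>P. \<forall>h\<in>Z <+> D. a h \<bullet> x = b h} face_of P"
  proof (rule face_of_tight_inequalities)
    show "P \<subseteq> {x. \<forall>h\<in>Z <+> D. a h \<bullet> x \<le> b h}"
      using upper_bound nonneg assms
      by (auto simp: a_def b_def inner_indvec inner_axis' simp del: sum.cong)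
  qed (rule convex)
  also have "{x\<in>P. \<forall>h\<in>Z <+> D. a h \<bullet> x = b h} =
      {x\<in>P. (\<forall>S\<in>D. (\<Sum>i\<in>S. x $ i) = (\<Sum>i\<in>S. v $ i)) \<and> (\<forall>k\<in>Z. x $ k = 0)}"
    by (simp add: a_def b_def inner_indvec inner_axis' Plus_def ball_Un conj_commute)
  finally show ?thesis .
qed

lemma tight_coordinate:
  assumes "(\<Sum>i\<in>S. x $ i) = (\<Sum>i\<in>S. v $ i)" "(\<Sum>i\<in>insert c S. x $ i) = (\<Sum>i\<in>insert c S. v $ i)" "c \<notin> S"
  shows "x $ c = v $ c"
  using assms by simp

lemma segment_edge:
  assumes "\<And>S. S \<in> D \<Longrightarrow> upper S" and w: "w \<in> P" "w \<noteq> v"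
    and "\<And>S. S \<in> D \<Longrightarrow> (\<Sum>i\<in>S. w $ i) = (\<Sum>i\<in>S. v $ i)"
    and "\<And>k. k \<in> Z \<Longrightarrow> v $ k = 0 \<and> w $ k = 0"
    and seg: "\<And>x. x \<in> P \<Longrightarrow> (\<And>S. S \<in> D \<Longrightarrow> (\<Sum>i\<in>S. x $ i) = (\<Sum>i\<in>S. v $ i)) \<Longrightarrow>
        (\<And>k. k \<in> Z \<Longrightarrow> x $ k = 0) \<Longrightarrow> x \<in> closed_segment v w"
  shows "closed_segment v w edge_of P"
proof -
  let ?F = "{x\<in>P. (\<forall>S\<in>D. (\<Sum>i\<in>S. x $ i) = (\<Sum>i\<in>S. v $ i)) \<and> (\<forall>k\<in>Z. x $ k = 0)}"
  have F: "?F face_of P" using assms(1) by (rule tight_set_face)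
  have "convex ?F" by (rule face_of_imp_convex[OF F])
  moreover have "v \<in> ?F" "w \<in> ?F" using assms v_in by auto
  ultimately have "closed_segment v w \<subseteq> ?F" by (intro closed_segment_subset)
  moreover have "?F \<subseteq> closed_segment v w" using seg by auto
  ultimately have "?F = closed_segment v w" by blast
  moreover have "aff_dim (closed_segment v w) = 1"
    using w(2) by (simp add: segment_convex_hull aff_dim_convex_hull aff_dim_2)
  ultimately show ?thesis using F by (simp add: edge_of_def)
qed

definition consecutive where
  "consecutive i j \<longleftrightarrow> v $ j < v $ i \<and> \<not> (\<exists>k. v $ j < v $ k \<and> v $ k < v $ i)"

definition swap where "swap i j = (\<chi> c. v $ (Transposition.transpose i j c))"

definition drop_coord where "drop_coord k = (\<chi> c. if c = k then 0 else v $ c)"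

lemma mem_segment_swap:
  assumes "\<And>c. c \<noteq> i \<Longrightarrow> c \<noteq> j \<Longrightarrow> x $ c = v $ c" "x $ i + x $ j = v $ i + v $ j"
    "x $ i \<le> v $ i" "x $ j \<le> v $ i" "v $ j < v $ i"
  shows "x \<in> closed_segment v (swap i j)"
proof -
  have ij: "i \<noteq> j" using assms(5) by auto
  define e where "e = (v $ i - x $ i) / (v $ i - v $ j)"
  have e: "0 \<le> e" "e \<le> 1" "e * (v $ i - v $ j) = v $ i - x $ i"
    using assms(2-5) by (auto simp: e_def divide_simps)
  have "x = (1 - e) *\<^sub>R v + e *\<^sub>R swap i j"
  proof (subst vec_eq_iff, intro allI)
    fix c
    consider "c = i" | "c = j" | "c \<noteq> i" "c \<noteq> j" by blast
    then show "x $ c = ((1 - e) *\<^sub>R v + e *\<^sub>R swap i j) $ c"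
    proof cases
      case 3
      then show ?thesis using assms(1) by (simp add: swap_def transpose_def algebra_simps)
    qed (use e(3) assms(2) in \<open>auto simp: swap_def Transposition.transpose_def algebra_simps\<close>)
  qed
  then show ?thesis using e unfolding closed_segment_def by blast
qed

lemma mem_segment_drop:
  assumes "\<And>c. c \<noteq> k \<Longrightarrow> x $ c = v $ c" "0 \<le> x $ k" "x $ k \<le> v $ k" "0 < v $ k"
  shows "x \<in> closed_segment v (drop_coord k)"
proof -
  define e where "e = 1 - x $ k / v $ k"
  have e: "0 \<le> e" "e \<le> 1" "(1 - e) * v $ k = x $ k"
    using assms(2-4) by (auto simp: e_def divide_simps)
  have "x = (1 - e) *\<^sub>R v + e *\<^sub>R drop_coord k"
  proof (subst vec_eq_iff, intro allI)
    fix c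
    show "x $ c = ((1 - e) *\<^sub>R v + e *\<^sub>R drop_coord k) $ c"
      using e(3) assms(1)[of c] by (cases "c = k") (auto simp: drop_coord_def algebra_simps)
  qed
  then show ?thesis using e unfolding closed_segment_def by blast
qed

text \<open>The edge is cut out by the upper sets that do not separate i from j and by the zero
  coordinates other than j. Two such sets that differ in one coordinate c fix \<open>x $ c\<close>,
  and this reaches every c other than i and j, because no value lies strictly between theirs. Only
  the sum of the coordinates i and j is fixed, which leaves a segment.\<close>

lemma swap_edge:
  assumes cons: "consecutive i j" and w: "swap i j \<in> P"
  shows "closed_segment v (swap i j) edge_of P"
proof (rule segment_edge[where D = "{S. upper S \<and> (i \<in> S \<longleftrightarrow> j \<in> S)}" and Z = "{k. v $ k = 0 \<and> k \<noteq> j}"])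
  have lt: "v $ j < v $ i" using cons by (simp add: consecutive_def)
  then have ij: "i \<noteq> j" by auto
  have v0: "0 \<le> v $ c" for c using nonneg[OF v_in] .
  show "swap i j \<noteq> v"
    using lt by (auto simp: swap_def vec_eq_iff Transposition.transpose_def dest!: spec[of _ i])
  show "(\<Sum>c\<in>S. swap i j $ c) = (\<Sum>c\<in>S. v $ c)" if "S \<in> {S. upper S \<and> (i \<in> S \<longleftrightarrow> j \<in> S)}" for S
  proof -
    have "(\<Sum>c\<in>S. swap i j $ c) = (\<Sum>c\<in>Transposition.transpose i j ` S. v $ c)"
      by (simp add: swap_def sum.reindex)
    then show ?thesis using that by simp
  qed
  show "v $ k = 0 \<and> swap i j $ k = 0" if "k \<in> {k. v $ k = 0 \<and> k \<noteq> j}" for k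
    using that lt v0[of j] by (auto simp: swap_def Transposition.transpose_def)
  fix x assume x: "x \<in> P"
    and tS: "\<And>S. S \<in> {S. upper S \<and> (i \<in> S \<longleftrightarrow> j \<in> S)} \<Longrightarrow> (\<Sum>i\<in>S. x $ i) = (\<Sum>i\<in>S. v $ i)"
    and tZ: "\<And>k. k \<in> {k. v $ k = 0 \<and> k \<noteq> j} \<Longrightarrow> x $ k = 0"
  let ?G = "{k. v $ i \<le> v $ k}"
  have tight: "(\<Sum>i\<in>S. x $ i) = (\<Sum>i\<in>S. v $ i)" if "upper S" "i \<in> S \<longleftrightarrow> j \<in> S" for S
    using tS that by blast
  have not_between: "v $ c \<le> v $ j \<or> v $ i \<le> v $ c" for c
    using cons unfolding consecutive_def by (meson not_le)
  \<comment> \<open>Removing i keeps \<open>?G\<close> upper since i has the least value in it;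
    adding j does so since the next smaller value is that of j.\<close>
  have G: "upper ?G" "upper (?G - {i})"
    by (auto simp: upper_def)
  have Gj: "v $ b \<le> v $ a" if "a \<in> insert j ?G" "b \<notin> ?G" for a b
    using that not_between[of b] lt by force
  have G': "upper (insert j ?G)"
    using Gj by (auto simp: upper_def)
  show "x \<in> closed_segment v (swap i j)"
  proof (rule mem_segment_swap)
    show "v $ j < v $ i" by (rule lt)
    show "x $ c = v $ c" if c: "c \<noteq> i" "c \<noteq> j" for c
    proof -
      consider "v $ c = 0" | "v $ c > v $ i \<or> v $ c < v $ j" | "v $ c = v $ i" | "v $ c = v $ j" "v $ c \<noteq> 0"
        using not_between[of c] by fastforce
      then show ?thesis
      proof cases
        case 1
        then show ?thesis using tZ c by auto
      next
        case 2
        then show ?thesis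
          using c lt by (intro tight_coordinate[where S = "{k. v $ c < v $ k}"] tight) (auto simp: upper_def)
      next
        case 3
        then show ?thesis
          using c lt by (intro tight_coordinate[where S = "{k. v $ c < v $ k}"] tight) (auto simp: upper_def)
      next
        case 4
        have "upper (insert c (insert j ?G))"
          using 4(1) Gj by (auto simp: upper_def)
        then show ?thesis
          using c lt 4 G' by (intro tight_coordinate[where S = "insert j ?G"] tight) auto
      qed
    qed
    have t1: "(\<Sum>c\<in>?G - {i}. x $ c) = (\<Sum>c\<in>?G - {i}. v $ c)"
      using G lt by (intro tight) auto
    have t2: "(\<Sum>c\<in>insert j ?G. x $ c) = (\<Sum>c\<in>insert j ?G. v $ c)"
      using G' by (intro tight) auto
    have sG: "(\<Sum>c\<in>?G. y $ c) = y $ i + (\<Sum>c\<in>?G - {i}. y $ c)" for y :: "real^'n"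
      by (rule sum.remove) auto
    have sGj: "(\<Sum>c\<in>insert j ?G. y $ c) = y $ j + (\<Sum>c\<in>?G. y $ c)" for y :: "real^'n"
      using lt by (subst sum.insert) auto
    show "x $ i + x $ j = v $ i + v $ j"
      using t1 t2 sG sGj by simp
    show "x $ i \<le> v $ i"
      using upper_bound[OF x G(1)] t1 sG[of x] sG[of v] by linarith
    \<comment> \<open>Exchanging i for j in \<open>?G\<close> gives a set that is not upper but has
      the same size. Here \<open>bound\<close> is used for two different sets, and it caps
      \<open>x $ j\<close>.\<close>
    have "(\<Sum>c\<in>insert j (?G - {i}). x $ c) \<le> (\<Sum>c\<in>?G. v $ c)"
    proof (rule bound[OF x])
      have "card ?G = Suc (card (?G - {i}))" by (rule card.remove) auto
      moreover have "card (insert j (?G - {i})) = Suc (card (?G - {i}))"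
        using lt by (intro card_insert_disjoint) auto
      ultimately show "card (insert j (?G - {i})) = card ?G" by simp
    qed (use G(1) in \<open>simp add: upper_def\<close>)
    moreover have "(\<Sum>c\<in>insert j (?G - {i}). x $ c) = x $ j + (\<Sum>c\<in>?G - {i}. x $ c)"
      using lt by (subst sum.insert) auto
    ultimately show "x $ j \<le> v $ i"
      using t1 sG[of v] by linarith
  qed
qed (use w in auto)

text \<open>Same method with the upper sets avoiding k: since k has the least positive value, all
  other positive coordinates can be added one by one before k.\<close>

lemma drop_edge:
  assumes pos: "0 < v $ k" and min: "\<And>c. 0 < v $ c \<Longrightarrow> v $ k \<le> v $ c" and w: "drop_coord k \<in> P"
  shows "closed_segment v (drop_coord k) edge_of P"
proof (rule segment_edge[where D = "{S. upper S \<and> k \<notin> S}" and Z = "{c. v $ c = 0}"])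
  have v0: "0 \<le> v $ c" for c using nonneg[OF v_in] .
  show "drop_coord k \<noteq> v"
    using pos by (auto simp: drop_coord_def vec_eq_iff dest!: spec[of _ k])
  show "(\<Sum>i\<in>S. drop_coord k $ i) = (\<Sum>i\<in>S. v $ i)" if "S \<in> {S. upper S \<and> k \<notin> S}" for S
    using that by (intro sum.cong) (auto simp: drop_coord_def)
  show "v $ c = 0 \<and> drop_coord k $ c = 0" if "c \<in> {c. v $ c = 0}" for c
    using that by (auto simp: drop_coord_def)
  fix x assume x: "x \<in> P"
    and tS: "\<And>S. S \<in> {S. upper S \<and> k \<notin> S} \<Longrightarrow> (\<Sum>i\<in>S. x $ i) = (\<Sum>i\<in>S. v $ i)"
    and tZ: "\<And>c. c \<in> {c. v $ c = 0} \<Longrightarrow> x $ c = 0"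
  let ?G = "{c. v $ k \<le> v $ c}"
  have tight: "(\<Sum>i\<in>S. x $ i) = (\<Sum>i\<in>S. v $ i)" if "upper S" "k \<notin> S" for S
    using tS that by blast
  show "x \<in> closed_segment v (drop_coord k)"
  proof (rule mem_segment_drop)
    show "0 < v $ k" "0 \<le> x $ k" using pos nonneg[OF x] by auto
    show "x $ c = v $ c" if "c \<noteq> k" for c
    proof (cases "v $ c = 0")
      case True
      then show ?thesis using tZ by auto
    next
      case False
      then have "v $ k \<le> v $ c" using min v0[of c] by fastforce
      then show ?thesis
        using that by (intro tight_coordinate[where S = "{b. v $ c < v $ b}"] tight) (auto simp: upper_def)
    qed
    have sG: "(\<Sum>c\<in>?G. y $ c) = y $ k + (\<Sum>c\<in>?G - {k}. y $ c)" for y :: "real^'n"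
      by (rule sum.remove) auto
    have "(\<Sum>c\<in>?G - {k}. x $ c) = (\<Sum>c\<in>?G - {k}. v $ c)"
      by (intro tight) (auto simp: upper_def)
    moreover have "upper ?G" by (auto simp: upper_def)
    ultimately show "x $ k \<le> v $ k"
      using upper_bound[OF x] sG[of x] sG[of v] by fastforce
  qed
qed (use w in auto)

text \<open>Each coordinate c owns one edge at v: a zero is swapped with a least positive coordinate
  \<open>c0\<close>, a least positive coordinate is dropped to 0, and a larger one is swapped with a
  coordinate \<open>pr c\<close> of the next smaller value. If i and j differ, the next larger value
  above theirs can also be swapped with the one of them that \<open>pr\<close> did not choose. That
  makes n + 1 edges.\<close>

lemma unique_of_simple:
  assumes simple: "simple_polytope P" and dim: "aff_dim P = int CARD('n)"
    and swap_in: "\<And>i j. v $ j < v $ i \<Longrightarrow> swap i j \<in> P"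
    and drop_in: "\<And>k. 0 < v $ k \<Longrightarrow> (\<And>c. 0 < v $ c \<Longrightarrow> v $ k \<le> v $ c) \<Longrightarrow> drop_coord k \<in> P"
    and ij: "v $ i = v $ j" "0 < v $ i" "v $ i < v $ k"
  shows "i = j"
proof (rule ccontr)
  assume "i \<noteq> j"
  have v0: "0 \<le> v $ c" for c using nonneg[OF v_in] .
  define d where "d = Min ((($) v) ` {c. 0 < v $ c})"
  have d: "0 < v $ c \<Longrightarrow> d \<le> v $ c" "\<exists>c. v $ c = d \<and> 0 < d" for c
  proof -
    have "d \<in> (($) v) ` {c. 0 < v $ c}" unfolding d_def using ij(2) by (intro Min_in) auto
    then show "\<exists>c. v $ c = d \<and> 0 < d" by auto
  qed (auto simp: d_def)
  then obtain c0 where c0: "v $ c0 = d" "0 < d" by blast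
  have ex_pred: "\<exists>p. consecutive c p \<and> 0 < v $ p" if c: "d < v $ c" for c
  proof -
    define y where "y = Max ((($) v) ` {p. v $ p < v $ c})"
    have "y \<in> (($) v) ` {p. v $ p < v $ c}" unfolding y_def using c c0 by (intro Max_in) auto
    then obtain p where p: "y = v $ p" "v $ p < v $ c" by auto
    have ge: "v $ b \<le> y" if "v $ b < v $ c" for b
      unfolding y_def using that by (intro Max_ge) auto
    then have "d \<le> v $ p" using c c0 p by metis
    then show ?thesis using p ge c0(2) by (force simp: consecutive_def)
  qed
  then obtain pr where pr: "\<And>c. d < v $ c \<Longrightarrow> consecutive c (pr c) \<and> 0 < v $ pr c" by metis
  obtain k0 where k0: "v $ i < v $ k0" "\<And>b. v $ i < v $ b \<Longrightarrow> v $ k0 \<le> v $ b"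
  proof -
    define y where "y = Min ((($) v) ` {p. v $ i < v $ p})"
    have "y \<in> (($) v) ` {p. v $ i < v $ p}" unfolding y_def using ij(3) by (intro Min_in) auto
    moreover have "y \<le> v $ b" if "v $ i < v $ b" for b
      unfolding y_def using that by (intro Min_le) auto
    ultimately show ?thesis using that by blast
  qed
  \<comment> \<open>At most one of i and j is \<open>pr k0\<close>; \<open>i'\<close> is the
    other.\<close>
  obtain i' where i': "v $ i' = v $ i" "i' \<noteq> pr k0" using ij(1) \<open>i \<noteq> j\<close> by metis
  have k0i': "consecutive k0 i'"
    using k0 i'(1) by (force simp: consecutive_def)
  define \<phi> where "\<phi> c = (if v $ c = 0 then swap c0 c else if v $ c = d then drop_coord c
    else swap c (pr c))" for c
  define N where "N = insert (swap k0 i') (range \<phi>)"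
  have cases_c: "v $ c = 0 \<or> v $ c = d \<or> d < v $ c" for c
    using d(1)[of c] v0[of c] by fastforce
  have cons0: "consecutive c0 c" if "v $ c = 0" for c
    using that c0 d(1) by (force simp: consecutive_def)
  have edge: "w \<in> P \<and> closed_segment v w edge_of P" if "w \<in> N" for w
  proof -
    have swp: "swap a b \<in> P \<and> closed_segment v (swap a b) edge_of P" if "consecutive a b" for a b
      using swap_edge[OF that] swap_in that by (auto simp: consecutive_def)
    have "\<phi> c \<in> P \<and> closed_segment v (\<phi> c) edge_of P" for c
      using cases_c[of c] swp[OF cons0, of c] swp[of c "pr c"] pr[of c] c0
        drop_edge[of c] drop_in[of c] d(1) by (auto simp: \<phi>_def)
    then show ?thesis using that swp[OF k0i'] by (auto simp: N_def)
  qed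
  \<comment> \<open>Neighbours of v are told apart by the coordinates that they lower and raise.
    Swaps with a zero and swaps with a predecessor differ in whether the raised coordinate was
    0.\<close>
  define dec where "dec w = {c. w $ c < v $ c}" for w
  define inc where "inc w = {c. v $ c < w $ c}" for w
  have swap_sets: "dec (swap a b) = {a} \<and> inc (swap a b) = {b}" if "v $ b < v $ a" for a b
    using that by (auto simp: dec_def inc_def swap_def Transposition.transpose_def split: if_splits)
  have drop_sets: "dec (drop_coord a) = {a} \<and> inc (drop_coord a) = {}" if "0 < v $ a" for a
    using that v0 by (auto simp: dec_def inc_def drop_coord_def not_less split: if_splits)
  have s1: "dec (\<phi> c) = {c0} \<and> inc (\<phi> c) = {c}" if "v $ c = 0" for c
    using swap_sets[of c c0] that c0 by (simp add: \<phi>_def)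
  have s2: "dec (\<phi> c) = {c} \<and> inc (\<phi> c) = {}" if "v $ c = d" for c
    using drop_sets[of c] that c0 by (simp add: \<phi>_def)
  have s3: "dec (\<phi> c) = {c} \<and> inc (\<phi> c) = {pr c} \<and> 0 < v $ pr c" if "d < v $ c" for c
    using swap_sets[of "pr c" c] that c0 pr[OF that] by (simp add: \<phi>_def consecutive_def)
  have "inj \<phi>"
  proof (rule injI)
    fix b c assume eq: "\<phi> b = \<phi> c"
    note s = s1[of c, folded eq] s2[of c, folded eq] s3[of c, folded eq]
    show "b = c"
      using cases_c[of b]
    proof (elim disjE)
      assume b: "v $ b = 0"
      show ?thesis using cases_c[of c] s1[OF b] s b by (elim disjE) auto
    next
      assume b: "v $ b = d"
      show ?thesis using cases_c[of c] s2[OF b] s by (elim disjE) auto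
    next
      assume b: "d < v $ b"
      show ?thesis using cases_c[of c] s3[OF b] s by (elim disjE) auto
    qed
  qed
  have "swap k0 i' \<notin> range \<phi>"
  proof
    assume "swap k0 i' \<in> range \<phi>"
    then obtain c where c: "\<phi> c = swap k0 i'" by auto
    have "dec (\<phi> c) = {k0} \<and> inc (\<phi> c) = {i'} \<and> 0 < v $ i'"
      unfolding c using swap_sets[of i' k0] k0 i' ij(2) by simp
    then show False
      using cases_c[of c] s1[of c] s2[of c] s3[of c] i'(2) by auto
  qed
  then have cardN: "card N = CARD('n) + 1"
    using \<open>inj \<phi>\<close> by (simp add: N_def card_image)
  have inj_seg: "inj_on (closed_segment v) N"
  proof (rule inj_onI)
    fix w w' assume "closed_segment v w = closed_segment v w'"
    then show "w = w'" by (auto simp: closed_segment_eq doubleton_eq_iff)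
  qed
  have ext: "v extreme_point_of P"
  proof -
    have "closed_segment v (swap k0 i') face_of P"
      using edge[of "swap k0 i'"] by (auto simp: N_def edge_of_def)
    moreover have "v extreme_point_of closed_segment v (swap k0 i')"
      by (simp add: extreme_point_of_segment)
    ultimately show ?thesis by (auto simp: extreme_point_of_face)
  qed
  let ?E = "{e. e edge_of P \<and> v \<in> e}"
  have "card ?E = CARD('n)"
    using simple ext dim by (auto simp: simple_polytope_def)
  moreover have "card N \<le> card ?E"
  proof -
    have "closed_segment v ` N \<subseteq> ?E" using edge by auto
    moreover have "finite ?E" using \<open>card ?E = CARD('n)\<close> by (metis card.infinite zero_less_card_finite less_irrefl)
    ultimately show ?thesis using card_mono card_image[OF inj_seg] by metis
  qed
  ultimately show False using cardN by simp
qed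

end

section \<open>Facets and faces of a simple parking function polytope\<close>

lemma Union_chain_mem:
  assumes "finite C" "C \<noteq> {}" "\<And>S T. S \<in> C \<Longrightarrow> T \<in> C \<Longrightarrow> S \<subseteq> T \<or> T \<subseteq> S"
  shows "\<Union>C \<in> C"
  using assms
proof (induction C rule: finite_ne_induct)
  case (insert S C)
  then have "\<Union>C \<in> C" by blast
  then show ?case using insert.prems[of S "\<Union>C"] by (auto simp: sup_absorb1 sup_absorb2)
qed simp

text \<open>Rank by the number of members of C that miss i. Since members are comparable, this
  number is strictly smaller on S than outside S, so S takes the lowest ranks.\<close>

lemma ranking_of_chain:
  fixes C :: "'n::finite set set"
  assumes chain: "\<And>S T. S \<in> C \<Longrightarrow> T \<in> C \<Longrightarrow> S \<subseteq> T \<or> T \<subseteq> S"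
  shows "\<exists>\<pi>. bij_betw \<pi> UNIV {..<CARD('n)} \<and> (\<forall>S\<in>C. \<pi> ` S = {..<card S})"
proof -
  define \<kappa> where "\<kappa> i = card {S\<in>C. i \<notin> S}" for i
  obtain \<pi> where \<pi>: "bij_betw \<pi> UNIV {..<CARD('n)}" and mono: "\<And>i j. \<kappa> i < \<kappa> j \<Longrightarrow> \<pi> i < \<pi> j"
    using ranking_exists[of \<kappa>] by blast
  have "\<pi> ` S = {..<card S}" if S: "S \<in> C" for S
  proof -
    have lt: "\<pi> i < \<pi> j" if "i \<in> S" "j \<notin> S" for i j
    proof (rule mono, unfold \<kappa>_def, rule psubset_card_mono)
      have "{T\<in>C. i \<notin> T} \<subseteq> {T\<in>C. j \<notin> T}" using chain[OF S] that by blast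
      then show "{T\<in>C. i \<notin> T} \<subset> {T\<in>C. j \<notin> T}" using S that by blast
    qed simp
    have down: "{..<\<pi> i} \<subseteq> \<pi> ` S" if "i \<in> S" for i
    proof
      fix k assume "k \<in> {..<\<pi> i}"
      moreover have "\<pi> i < CARD('n)" using \<pi> by (auto dest: bij_betwE)
      ultimately have "k \<in> range \<pi>" using \<pi> by (auto simp: bij_betw_def)
      then obtain j where "k = \<pi> j" by blast
      then show "k \<in> \<pi> ` S" using lt[OF that, of j] \<open>k \<in> {..<\<pi> i}\<close> by force
    qed
    have card: "card (\<pi> ` S) = card S"
      using \<pi> by (intro card_image) (auto simp: bij_betw_def intro: inj_on_subset)
    have "\<pi> ` S \<subseteq> {..<card S}"
    proof
      fix k assume "k \<in> \<pi> ` S"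
      then have "{..k} \<subseteq> \<pi> ` S" using down by (force simp: less_le)
      then have "card {..k} \<le> card S" using card card_mono[of "\<pi> ` S" "{..k}"] by simp
      then show "k \<in> {..<card S}" by simp
    qed
    then show ?thesis using card by (intro card_subset_eq) auto
  qed
  with \<pi> show ?thesis by blast
qed

lemma inj_indvec: "inj (indvec :: 'n::finite set \<Rightarrow> real^'n)"
proof (rule injI)
  fix S T :: "'n set" assume "indvec S = (indvec T :: real^'n)"
  then have *: "\<forall>i. (if i \<in> S then 1 else 0 :: real) = (if i \<in> T then 1 else 0)"
    by (simp add: indvec_def vec_eq_iff)
  have "i \<in> S \<longleftrightarrow> i \<in> T" for i using spec[OF *, of i] by (simp split: if_splits)
  then show "S = T" by blast
qed

text \<open>A coordinate of the largest set that lies outside Z and in no smaller member vanishes on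
  all the other vectors, so the indicator of that set is outside their span; the rest is
  induction.\<close>

lemma independent_indvec_chain:
  fixes C :: "'n::finite set set" and B :: "(real^'n) set"
  assumes B: "independent B" "\<And>b c. b \<in> B \<Longrightarrow> c \<notin> Z \<Longrightarrow> b $ c = 0"
    and chain: "\<And>S T. S \<in> C \<Longrightarrow> T \<in> C \<Longrightarrow> S \<subseteq> T \<or> T \<subseteq> S"
    and own: "\<And>S. S \<in> C \<Longrightarrow> \<exists>c\<in>S. c \<notin> Z \<and> (\<forall>T\<in>C. T \<subset> S \<longrightarrow> c \<notin> T)"
  shows "independent (B \<union> indvec ` C)"
  using chain own
proof (induction "card C" arbitrary: C)
  case 0
  then have "C = {}" by simp
  then show ?case using B by simp
next
  case (Suc k)
  then have "C \<noteq> {}" by auto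
  define S where "S = \<Union>C"
  have S: "S \<in> C" unfolding S_def using \<open>C \<noteq> {}\<close> Suc.prems(1) by (intro Union_chain_mem) auto
  have "independent (B \<union> indvec ` (C - {S}))"
  proof (rule Suc.hyps(1))
    show "k = card (C - {S})" using Suc.hyps(2) S by simp
  next
    fix T assume "T \<in> C - {S}"
    then show "\<exists>c\<in>T. c \<notin> Z \<and> (\<forall>U\<in>C - {S}. U \<subset> T \<longrightarrow> c \<notin> U)" using Suc.prems(2)[of T] by blast
  qed (use Suc.prems(1) in blast)
  moreover obtain c where c: "c \<in> S" "c \<notin> Z" "\<And>T. T \<in> C \<Longrightarrow> T \<subset> S \<Longrightarrow> c \<notin> T"
    using Suc.prems(2)[OF S] by blast
  have "indvec S \<notin> span (B \<union> indvec ` (C - {S}))"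
  proof
    assume "indvec S \<in> span (B \<union> indvec ` (C - {S}))"
    moreover have "span (B \<union> indvec ` (C - {S})) \<subseteq> {x. x $ c = 0}"
    proof (rule span_minimal)
      have "c \<notin> T" if "T \<in> C - {S}" for T
        using c(3)[of T] that by (auto simp: S_def)
      then have "\<forall>T\<in>C - {S}. indvec T $ c = (0::real)" by (simp add: indvec_def)
      then show "B \<union> indvec ` (C - {S}) \<subseteq> {x. x $ c = 0}"
        using B(2) c(2) by blast
    qed (auto simp: subspace_def)
    ultimately show False using c(1) by (auto simp: indvec_def)
  qed
  ultimately have "independent (insert (indvec S) (B \<union> indvec ` (C - {S})))"
    by (simp add: independent_insertI)
  moreover have "insert (indvec S) (B \<union> indvec ` (C - {S})) = B \<union> indvec ` C"
    using S by blast
  ultimately show ?case by simp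
qed

text \<open>The shape forced by simplicity. Ranks below q carry the top value, ranks q to q + r
  carry r + 1 distinct smaller positive values, the last m0 ranks carry 0. The guard
  \<open>q \<le> Suc k\<close> in \<open>strict\<close> includes the drop from rank q - 1.\<close>

locale parking_facets =
  fixes u :: "real list" and q r m0 :: nat and ty :: "'n::finite itself"
  assumes sorted: "sorted u" and nonneg: "\<forall>x\<in>set u. 0 \<le> x" and len: "length u = CARD('n)"
    and n: "CARD('n) = q + r + 1 + m0" and q: "1 \<le> q"
    and const: "k < q \<Longrightarrow> desc u k = desc u 0"
    and strict: "q \<le> Suc k \<Longrightarrow> k < j \<Longrightarrow> k \<le> q + r \<Longrightarrow> desc u j < desc u k"
    and zero: "q + r < k \<Longrightarrow> desc u k = 0"
begin

abbreviation "g \<equiv> desc u"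
abbreviation "f \<equiv> top_sum u"

lemma g_mono: "j \<le> k \<Longrightarrow> g k \<le> g j"
  by (rule antimonoD[OF antimono_desc[OF sorted nonneg]])

lemma g_pos: "k \<le> q + r \<Longrightarrow> 0 < g k"
  using strict[of "q + r" "Suc (q + r)"] zero[of "Suc (q + r)"] g_mono[of k "q + r"] by simp

lemma g_less_top: "q \<le> k \<Longrightarrow> g k < g 0"
  using strict[of "q - 1" k] const[of "q - 1"] q by simp

lemma f_add: "f (a + c) = f a + (\<Sum>k<c. g (a + k))"
  by (induction c) (auto simp: top_sum_def)

lemma f_Suc: "f (Suc c) = f c + g c"
  by (simp add: top_sum_def)

lemma f_le_q: "c \<le> q \<Longrightarrow> f c = real c * g 0"
proof -
  assume "c \<le> q"
  then have "f c = (\<Sum>k<c. g 0)"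
    unfolding top_sum_def by (intro sum.cong refl const) (simp only: lessThan_iff)
  then show ?thesis by simp
qed

lemma f_mono: "a \<le> c \<Longrightarrow> f a \<le> f c"
  using f_add[of a "c - a"] desc_nonneg[OF nonneg] by (simp add: sum_nonneg)

lemma f_beyond: "q + r + 1 \<le> c \<Longrightarrow> f c = f (q + r + 1)"
  using f_add[of "q + r + 1" "c - (q + r + 1)"] zero by simp

text \<open>Both sides compare blocks of t - w consecutive values of g, one starting at s and one at
  w. The last pair is strict, because rank t - 1 is at least q. With t and s the sizes of two
  crossing sets and w that of their intersection, this forbids both from being tight.\<close>

lemma f_submodular_strict:
  assumes "w < t" "t \<le> s" "q < t" "t \<le> q + r"
  shows "f (s + (t - w)) + f w < f s + f t"
proof -
  have "(\<Sum>k<t - w. g (s + k)) < (\<Sum>k<t - w. g (w + k))"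
  proof (rule sum_strict_mono_ex1)
    show "\<forall>k\<in>{..<t - w}. g (s + k) \<le> g (w + k)" using assms by (auto intro: g_mono)
    have "g (s + (t - w - 1)) < g (w + (t - w - 1))"
      using assms by (intro strict) auto
    then show "\<exists>k\<in>{..<t - w}. g (s + k) < g (w + k)"
      using assms by (intro bexI[of _ "t - w - 1"]) auto
  qed simp
  then show ?thesis using f_add[of s "t - w"] f_add[of w "t - w"] assms by simp
qed

text \<open>Sizes up to q follow from \<open>x $ i \<le> g 0\<close>, since f is linear there; from
  size q + r + 1 on f is constant, so the full set dominates. \<open>poly_bound\<close> recovers
  these inequalities.\<close>

definition facet_sets :: "'n set set" where
  "facet_sets = {S. q < card S \<and> card S \<le> q + r \<or> S = UNIV}"

definition index :: "('n + 'n + 'n set) set" where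
  "index = UNIV <+> UNIV <+> facet_sets"

definition normal :: "'n + 'n + 'n set \<Rightarrow> real^'n" where
  "normal = case_sum (\<lambda>i. - axis i 1) (case_sum (\<lambda>i. axis i 1) indvec)"

definition bnd :: "'n + 'n + 'n set \<Rightarrow> real" where
  "bnd = case_sum (\<lambda>i. 0) (case_sum (\<lambda>i. g 0) (\<lambda>S. f (card S)))"

sublocale halfspace_system index normal bnd
  by unfold_locales (simp add: index_def)

definition valid :: "'n set \<Rightarrow> 'n set \<Rightarrow> 'n set set \<Rightarrow> bool" where
  "valid N A C \<longleftrightarrow> card A \<le> q \<and> N \<inter> A = {} \<and> (\<forall>S\<in>C. S \<in> facet_sets \<and> A \<subseteq> S \<and> (S \<noteq> UNIV \<longrightarrow> S \<inter> N = {}))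
     \<and> (\<forall>S\<in>C. \<forall>T\<in>C. S \<subseteq> T \<or> T \<subseteq> S) \<and> (UNIV \<in> C \<longrightarrow> card N \<le> m0)"

lemma mem_poly_iff:
  "x \<in> poly \<longleftrightarrow> (\<forall>i. 0 \<le> x $ i \<and> x $ i \<le> g 0) \<and> (\<forall>S\<in>facet_sets. (\<Sum>i\<in>S. x $ i) \<le> f (card S))"
  unfolding poly_def by (auto simp: index_def normal_def bnd_def inner_indvec inner_axis' Plus_def ball_Un)

lemma mem_slab_iff:
  "x \<in> slab (N <+> A <+> C) \<longleftrightarrow> x \<in> poly \<and> (\<forall>i\<in>N. x $ i = 0) \<and> (\<forall>i\<in>A. x $ i = g 0) \<and>
     (\<forall>S\<in>C. (\<Sum>i\<in>S. x $ i) = f (card S))"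
  unfolding slab_def by (auto simp: normal_def bnd_def inner_indvec inner_axis' Plus_def ball_Un)

lemma tight_eq:
  "tight x = {i. x $ i = 0} <+> {i. x $ i = g 0} <+> {S\<in>facet_sets. (\<Sum>i\<in>S. x $ i) = f (card S)}"
  unfolding tight_def by (auto simp: index_def normal_def bnd_def inner_indvec inner_axis' Plus_def)

lemma poly_bound:
  assumes x: "x \<in> poly"
  shows "(\<Sum>i\<in>S. x $ i) \<le> f (card S)"
proof -
  have x0: "0 \<le> x $ i" "x $ i \<le> g 0" for i using x by (auto simp: mem_poly_iff)
  consider "card S \<le> q" | "q < card S" "card S \<le> q + r" | "q + r + 1 \<le> card S" by linarith
  then show ?thesis
  proof cases
    case 1
    have "(\<Sum>i\<in>S. x $ i) \<le> (\<Sum>i\<in>S. g 0)" using x0 by (intro sum_mono)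
    then show ?thesis using f_le_q[OF 1] by simp
  next
    case 2
    then show ?thesis using x by (auto simp: mem_poly_iff facet_sets_def)
  next
    case 3
    have "(\<Sum>i\<in>S. x $ i) \<le> (\<Sum>i\<in>UNIV. x $ i)" using x0 by (intro sum_mono2) auto
    also have "\<dots> \<le> f (CARD('n))" using x by (auto simp: mem_poly_iff facet_sets_def)
    also have "\<dots> = f (card S)" using f_beyond[OF 3] f_beyond[of "CARD('n)"] n by simp
    finally show ?thesis .
  qed
qed

lemma card_proper_facet: "S \<in> facet_sets \<Longrightarrow> S \<noteq> UNIV \<Longrightarrow> q < card S \<and> card S \<le> q + r"
  by (auto simp: facet_sets_def)

lemma card_facet: "S \<in> facet_sets \<Longrightarrow> q < card S"
  using n by (auto simp: facet_sets_def)

text \<open>Each clause is obtained by altering a tight set: if it failed, adding a maximal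
  coordinate, deleting a zero one, or uncrossing two sets would break
  \<open>poly_bound\<close>.\<close>

lemma valid_tight:
  assumes x: "x \<in> poly"
  shows "valid {i. x $ i = 0} {i. x $ i = g 0} {S\<in>facet_sets. (\<Sum>i\<in>S. x $ i) = f (card S)}"
proof -
  have g0: "0 < g 0" by (rule g_pos) simp
  have "card {i. x $ i = g 0} \<le> q"
  proof (rule ccontr)
    assume "\<not> ?thesis"
    then obtain B where B: "B \<subseteq> {i. x $ i = g 0}" "card B = Suc q"
      using obtain_subset_with_card_n[of "Suc q" "{i. x $ i = g 0}"] by auto
    then have "(\<Sum>i\<in>B. x $ i) = (\<Sum>i\<in>B. g 0)" by (intro sum.cong) auto
    then have "real (Suc q) * g 0 \<le> f (Suc q)" using poly_bound[OF x, of B] B(2) by simp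
    then show False using g_less_top[of q] by (simp add: f_Suc f_le_q algebra_simps)
  qed
  moreover have "i \<in> S" if S: "S \<in> facet_sets" "(\<Sum>i\<in>S. x $ i) = f (card S)" and i: "x $ i = g 0" for i S
  proof (rule ccontr)
    assume "i \<notin> S"
    then have "(\<Sum>i\<in>insert i S. x $ i) = g 0 + f (card S)" "card (insert i S) = Suc (card S)"
      using S i by auto
    then show False
      using poly_bound[OF x, of "insert i S"] g_less_top[of "card S"] card_facet[OF S(1)]
      by (simp add: f_Suc)
  qed
  moreover have "x $ i \<noteq> 0" if S: "S \<in> facet_sets" "(\<Sum>i\<in>S. x $ i) = f (card S)" "S \<noteq> UNIV" and i: "i \<in> S" for i S
  proof
    assume 0: "x $ i = 0"
    have "card S = Suc (card (S - {i}))"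
      using i by (intro card.remove) auto
    moreover have "(\<Sum>i\<in>S - {i}. x $ i) = f (card S)"
      using S i 0 by (simp add: sum.remove[of S i])
    ultimately show False
      using poly_bound[OF x, of "S - {i}"] g_pos[of "card (S - {i})"] card_proper_facet[OF S(1,3)]
      by (simp add: f_Suc)
  qed
  moreover have "S \<subseteq> T \<or> T \<subseteq> S"
    if S: "S \<in> facet_sets" "(\<Sum>i\<in>S. x $ i) = f (card S)" and T: "T \<in> facet_sets" "(\<Sum>i\<in>T. x $ i) = f (card T)" for S T
    using S T
  proof (induction "card T" "card S" arbitrary: S T rule: linorder_wlog)
    case (le S T)
    show ?case
    proof (rule ccontr)
      assume nc: "\<not> (S \<subseteq> T \<or> T \<subseteq> S)"
      then have "T \<noteq> UNIV" "S \<inter> T \<subset> T" by auto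
      then have T': "q < card T" "card T \<le> q + r" "card (S \<inter> T) < card T"
        using card_proper_facet le by (auto intro: psubset_card_mono)
      have "card (S \<union> T) + card (S \<inter> T) = card S + card T"
        by (rule card_Un_Int[symmetric]) auto
      then have cU: "card (S \<union> T) = card S + (card T - card (S \<inter> T))" using T' by linarith
      have "(\<Sum>i\<in>S \<union> T. x $ i) + (\<Sum>i\<in>S \<inter> T. x $ i) = f (card S) + f (card T)"
        using le by (simp add: sum.union_inter)
      moreover have "f (card (S \<union> T)) + f (card (S \<inter> T)) < f (card S) + f (card T)"
        unfolding cU using le T' by (intro f_submodular_strict) auto
      ultimately show False using poly_bound[OF x, of "S \<union> T"] poly_bound[OF x, of "S \<inter> T"] by linarith
    qed
  qed blast
  \<comment> \<open>With more than m0 zeros the total comes from at most q + r coordinates, and f(q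
    + r) is below f(n).\<close>
  moreover have "card {i. x $ i = 0} \<le> m0" if "(\<Sum>i\<in>UNIV. x $ i) = f (CARD('n))"
  proof (rule ccontr)
    let ?N = "{i. x $ i = 0}"
    assume "\<not> ?thesis"
    then have c: "card (- ?N) \<le> q + r" using n by (simp add: Compl_eq_Diff_UNIV card_Diff_subset)
    have "f (CARD('n)) = (\<Sum>i\<in>- ?N. x $ i)"
      unfolding that[symmetric] by (intro sum.mono_neutral_right) auto
    also have "\<dots> \<le> f (q + r)" using poly_bound[OF x, of "- ?N"] f_mono[OF c] by linarith
    also have "\<dots> < f (q + r + 1)" using g_pos[of "q + r"] f_Suc[of "q + r"] by simp
    also have "\<dots> = f (CARD('n))" using n f_beyond[of "CARD('n)"] by simp
    finally show False by simp
  qed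
  ultimately show ?thesis using g0 unfolding valid_def by auto
qed

text \<open>A greedy point whose ranking starts with A, runs through the chain and ends with N. Its
  form \<open>vtx\<close> matters as well: it puts the point into \<open>PF u\<close>, which
  \<open>PF_eq_poly\<close> exploits.\<close>

lemma valid_nonempty:
  assumes v: "valid N A C"
  shows "\<exists>\<pi> p. bij_betw \<pi> UNIV {..<CARD('n)} \<and> vtx u \<pi> p \<in> slab (N <+> A <+> C)"
proof -
  \<comment> \<open>Without the full set, all members lie between A and \<open>- N\<close>, so the
    whole family is a chain.\<close>
  define K where "K = insert A (insert (- N) (C - {UNIV}))"
  have "\<exists>\<pi>. bij_betw \<pi> UNIV {..<CARD('n)} \<and> (\<forall>S\<in>K. \<pi> ` S = {..<card S})"
  proof (rule ranking_of_chain)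
    fix S T assume ST: "S \<in> K" "T \<in> K"
    have c: "A \<subseteq> U \<and> U \<subseteq> - N" if "U \<in> K" for U
      using that v by (auto simp: K_def valid_def)
    show "S \<subseteq> T \<or> T \<subseteq> S"
    proof (cases "S \<in> C \<and> T \<in> C")
      case True
      then show ?thesis using v by (simp add: valid_def)
    next
      case False
      then have "S = A \<or> S = - N \<or> T = A \<or> T = - N" using ST by (auto simp: K_def)
      then show ?thesis using c[OF ST(1)] c[OF ST(2)] by blast
    qed
  qed
  then obtain \<pi> where \<pi>: "bij_betw \<pi> UNIV {..<CARD('n)}" and init: "\<And>S. S \<in> K \<Longrightarrow> \<pi> ` S = {..<card S}"
    by blast
  \<comment> \<open>Cut right after the largest chain member, which zeroes N; if the full set must
    be tight, no cut is made and N falls on the ranks with entry 0, by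
    \<open>card N \<le> m0\<close>.\<close>
  define p where "p = (if UNIV \<in> C then CARD('n) else card (A \<union> \<Union>C))"
  have inj: "inj_on \<pi> S" for S using \<pi> by (auto simp: bij_betw_def intro: inj_on_subset)
  let ?x = "vtx u \<pi> p :: real^'n"
  have PF: "?x \<in> PF u" using sorted nonneg len \<pi> by (rule vtx_in_PF)
  have initU: "\<pi> ` S = {..<card S}" if "S \<in> insert A C" for S
  proof (cases "S = UNIV")
    case True
    then show ?thesis using \<pi> by (simp add: bij_betw_def)
  next
    case False
    then show ?thesis using that by (intro init) (auto simp: K_def)
  qed
  have le_p: "card S \<le> p" if "S \<in> insert A C" for S
    unfolding p_def using that by (auto intro: card_mono)
  have sum_x: "(\<Sum>i\<in>S. ?x $ i) = f (card S)" if S: "S \<in> insert A C" for S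
  proof -
    have "\<pi> i < p" if "i \<in> S" for i
      using initU[OF S] le_p[OF S] that by (metis imageI lessThan_iff order_less_le_trans)
    then have "(\<Sum>i\<in>S. ?x $ i) = (\<Sum>i\<in>S. g (\<pi> i))" by (intro sum.cong) (auto simp: vtx_def)
    also have "\<dots> = sum g (\<pi> ` S)" by (simp add: sum.reindex[OF inj])
    finally show ?thesis using initU[OF S] by (simp add: top_sum_def)
  qed
  have A: "?x $ i = g 0" if "i \<in> A" for i
  proof -
    have "\<pi> i < card A" using initU[of A] that by auto
    then have "\<pi> i < p" "\<pi> i < q" using le_p[of A] v by (auto simp: valid_def)
    then show ?thesis using const[of "\<pi> i"] by (simp add: vtx_def)
  qed
  have N: "?x $ i = 0" if "i \<in> N" for i
  proof -
    have im: "\<pi> ` (- N) = {..<card (- N)}" by (rule init) (simp add: K_def)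
    have "\<pi> i \<notin> \<pi> ` (- N)" using inj[of UNIV] that by (auto dest: inj_onD)
    then have ge: "card (- N) \<le> \<pi> i" using im by simp
    show ?thesis
    proof (cases "UNIV \<in> C")
      case True
      then have "card N \<le> m0" using v by (simp add: valid_def)
      then have "q + r < \<pi> i" using ge n by (simp add: Compl_eq_Diff_UNIV card_Diff_subset)
      then show ?thesis by (simp add: vtx_def zero)
    next
      case False
      then have "A \<union> \<Union>C \<subseteq> - N" using v by (auto simp: valid_def)
      then have "card (A \<union> \<Union>C) \<le> card (- N)" by (intro card_mono) auto
      then show ?thesis using False ge by (simp add: p_def vtx_def)
    qed
  qed
  have "?x \<in> poly"
    using PF_bounds[OF sorted nonneg PF] g_mono[of 0] desc_nonneg[OF nonneg, of 0]
    by (auto simp: mem_poly_iff) (simp add: vtx_def)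
  then have "?x \<in> slab (N <+> A <+> C)"
    using sum_x A N by (simp add: mem_slab_iff)
  with \<pi> show ?thesis by blast
qed

text \<open>For the hard inclusion: an extreme point is the slab of its own tight set, and this slab
  contains a greedy point, which must be the extreme point itself.\<close>

lemma PF_eq_poly: "(PF u :: (real^'n) set) = poly"
proof
  have "x $ i \<le> g 0" if "x \<in> PF u" for x :: "real^'n" and i
    using PF_bounds(2)[OF sorted nonneg that, of "{i}"] by (simp add: top_sum_def)
  then show "(PF u :: (real^'n) set) \<subseteq> poly"
    using PF_bounds[OF sorted nonneg] by (auto simp: mem_poly_iff)
  have "poly \<subseteq> cbox 0 (\<chi> i. g 0)"
    by (auto simp: mem_box_cart mem_poly_iff)
  then have "compact poly"
    using closed_poly bounded_cbox bounded_subset compact_eq_bounded_closed by blast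
  then have "poly = convex hull {x. x extreme_point_of poly}"
    using convex_poly by (rule Krein_Milman_Minkowski)
  also have "\<dots> \<subseteq> PF u"
  proof (rule hull_minimal)
    show "convex (PF u :: (real^'n) set)" by (simp add: PF_def)
    show "{x. x extreme_point_of poly} \<subseteq> PF u"
    proof
      fix x assume "x \<in> {x. x extreme_point_of poly}"
      then have face: "{x} face_of poly" and x: "x \<in> poly"
        by (auto simp: face_of_singleton extreme_point_of_def)
      have "{x} = slab (tight x)" using face by (rule face_eq_slab) simp
      moreover have "\<exists>\<pi> p. bij_betw \<pi> UNIV {..<CARD('n)} \<and> vtx u \<pi> p \<in> slab (tight x)"
        unfolding tight_eq by (rule valid_nonempty[OF valid_tight[OF x]])
      ultimately show "x \<in> PF u" using vtx_in_PF[OF sorted nonneg len] by (metis singletonD)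
    qed
  qed
  finally show "poly \<subseteq> PF u" .
qed

text \<open>\<open>W\<close>, the union of A and the members below S, is A or the largest smaller
  member, hence proper in S. For proper S the set N is disjoint from S; for the full set, W and N
  together have at most q + r + m0 = n - 1 elements.\<close>

lemma valid_private_coordinate:
  assumes v: "valid N A C" and S: "S \<in> C"
  shows "\<exists>c\<in>S. c \<notin> N \<union> A \<and> (\<forall>T\<in>C. T \<subset> S \<longrightarrow> c \<notin> T)"
proof -
  define W where "W = A \<union> \<Union>{T\<in>C. T \<subset> S}"
  have "W = A \<or> W \<in> C \<and> W \<subset> S"
  proof (cases "{T\<in>C. T \<subset> S} = {}")
    case False
    then have "\<Union>{T\<in>C. T \<subset> S} \<in> {T\<in>C. T \<subset> S}"
      using v by (intro Union_chain_mem) (auto simp: valid_def)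
    moreover from this have "A \<subseteq> \<Union>{T\<in>C. T \<subset> S}" using v by (auto simp: valid_def)
    ultimately show ?thesis by (simp add: W_def sup_absorb2)
  qed (auto simp: W_def)
  then have W: "W \<inter> N = {}" "W \<subset> S" "card W \<le> q + r"
  proof -
    assume *: "W = A \<or> W \<in> C \<and> W \<subset> S"
    show "W \<inter> N = {}" using * v by (auto simp: valid_def)
    have "A \<subseteq> S" "card A < card S" using v S card_facet[of S] by (auto simp: valid_def)
    then show "W \<subset> S" using * by auto
    show "card W \<le> q + r" using * v card_proper_facet[of W] by (auto simp: valid_def)
  qed
  have "\<not> S \<subseteq> W \<union> N"
  proof (cases "S = UNIV")
    case True
    then have "card (W \<union> N) \<le> q + r + m0"
      using v S W(3) card_Un_le[of W N] by (simp add: valid_def)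
    then show ?thesis using True n by (auto simp: top.extremum_unique)
  next
    case False
    then have "S \<inter> N = {}" using v S by (auto simp: valid_def)
    then show ?thesis using W(2) by blast
  qed
  then show ?thesis by (auto simp: W_def)
qed

lemma valid_independent:
  assumes v: "valid N A C"
  shows "inj_on normal (N <+> A <+> C)" "independent (normal ` (N <+> A <+> C))"
proof -
  let ?a = "\<lambda>i. axis i 1 :: real^'n"
  have ax: "axis i (1::real) $ j = (if i = j then 1 else 0)" for i j :: 'n
    by (simp add: axis_def)
  have ne1: "- ?a i \<noteq> ?a j" for i j
  proof
    assume "- ?a i = ?a j"
    then have "(- ?a i) $ i = ?a j $ i" by simp
    then show False by (simp add: ax split: if_splits)
  qed
  have ne2: "- ?a i \<noteq> indvec S" for i S
  proof
    assume "- ?a i = indvec S"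
    then have "(- ?a i) $ i = indvec S $ i" by simp
    then show False by (simp add: ax indvec_def split: if_splits)
  qed
  \<comment> \<open>Chain members have more than q >= 1 elements, so none is a singleton with the
    normal of an upper bound.\<close>
  have ne3: "?a i \<noteq> indvec S" if "S \<in> C" for i S
  proof
    assume eq: "?a i = indvec S"
    have "S = {i}"
    proof (rule set_eqI)
      fix j
      have "?a i $ j = indvec S $ j" using eq by simp
      then show "j \<in> S \<longleftrightarrow> j \<in> {i}" by (auto simp: ax indvec_def split: if_splits)
    qed
    then show False using that v card_facet[of S] q by (auto simp: valid_def)
  qed
  have ia: "?a i = ?a j \<longleftrightarrow> i = j" for i j by (simp add: axis_eq_axis)
  show "inj_on normal (N <+> A <+> C)"
    by (auto simp: inj_on_def normal_def ia inj_eq[OF inj_indvec] ne1 ne1[symmetric] ne2 ne2[symmetric] ne3 ne3[symmetric])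
  let ?B = "(\<lambda>i. - ?a i) ` N \<union> ?a ` A"
  have "independent ?B"
  proof (rule pairwise_orthogonal_independent)
    show "pairwise orthogonal ?B"
      using v by (auto simp: pairwise_def orthogonal_def inner_axis_axis valid_def)
    show "0 \<notin> ?B" by (auto simp: axis_eq_0_iff)
  qed
  then have "independent (?B \<union> indvec ` C)"
  proof (rule independent_indvec_chain[where Z = "N \<union> A"])
    show "b $ c = 0" if "b \<in> ?B" "c \<notin> N \<union> A" for b c
      using that by (auto simp: ax)
    show "\<exists>c\<in>S. c \<notin> N \<union> A \<and> (\<forall>T\<in>C. T \<subset> S \<longrightarrow> c \<notin> T)" if "S \<in> C" for S
      by (rule valid_private_coordinate[OF v that])
  qed (use v in \<open>auto simp: valid_def\<close>)
  moreover have "?B \<union> indvec ` C = normal ` (N <+> A <+> C)"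
    by (simp add: Plus_def image_Un image_image normal_def Un_assoc)
  ultimately show "independent (normal ` (N <+> A <+> C))" by simp
qed

lemma f_polynomial_PF:
  assumes "aff_dim (PF u :: (real^'n) set) = int CARD('n)"
  shows "f_polynomial (PF u :: (real^'n) set) =
    (\<Sum>(N, A, C) | valid N A C. monom 1 (CARD('n) - (card N + card A + card C)))"
proof -
  let ?t = "\<lambda>(N, A, C). N <+> A <+> C"
  let ?V = "?t ` {(N, A, C). valid N A C}"
  have "f_polynomial poly = (\<Sum>D\<in>?V. monom 1 (DIM(real^'n) - card D))"
  proof (rule f_polynomial_eq_sum)
    show "tight x \<in> ?V" if "x \<in> poly" for x
    proof (rule image_eqI)
      let ?y = "({i. x $ i = 0}, {i. x $ i = g 0}, {S\<in>facet_sets. (\<Sum>i\<in>S. x $ i) = f (card S)})"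
      show "tight x = ?t ?y" by (simp add: tight_eq)
      show "?y \<in> {(N, A, C). valid N A C}" using valid_tight[OF that] by simp
    qed
    show "inj_on normal D \<and> independent (normal ` D)" if "D \<in> ?V" for D
      using that valid_independent by auto
    show "D \<subseteq> index \<and> slab D \<noteq> {}" if DV: "D \<in> ?V" for D
    proof -
      obtain N A C where D: "D = N <+> A <+> C" "valid N A C" using DV by auto
      then have "D \<subseteq> index" by (auto simp: index_def valid_def)
      moreover have "slab D \<noteq> {}" using valid_nonempty[OF D(2)] D(1) by blast
      ultimately show ?thesis by blast
    qed
    show "aff_dim poly = int DIM(real^'n)" using assms by (simp add: PF_eq_poly)
  qed
  also have "\<dots> = (\<Sum>x\<in>{(N, A, C). valid N A C}. monom 1 (DIM(real^'n) - card (?t x)))"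
  proof (subst sum.reindex)
    have Plus_inj: "X <+> Y = X' <+> Y' \<longleftrightarrow> X = X' \<and> Y = Y'" for X X' :: "'a set" and Y Y' :: "'b set"
    proof -
      have "Inl -` (X <+> Y) = X \<and> Inr -` (X <+> Y) = Y" for X :: "'a set" and Y :: "'b set" by auto
      then show ?thesis by metis
    qed
    show "inj_on ?t {(N, A, C). valid N A C}"
      by (auto simp: inj_on_def Plus_inj)
  qed simp
  also have "\<dots> = (\<Sum>(N, A, C) | valid N A C. monom 1 (CARD('n) - (card N + card A + card C)))"
  proof (rule sum.cong)
    have "card (N <+> A <+> C) = card N + card A + card C" for N A :: "'n set" and C :: "'n set set"
      by (simp add: card_Plus)
    then show "monom 1 (DIM(real^'n) - card (?t x)) =
        (case x of (N, A, C) \<Rightarrow> monom (1::int) (CARD('n) - (card N + card A + card C)))"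
      for x :: "'n set \<times> 'n set \<times> 'n set set"
      by (cases x) simp
  qed simp
  finally show ?thesis unfolding PF_eq_poly .
qed

end

section \<open>Summation over chains\<close>

lemma sum_Pow_card:
  fixes \<phi> :: "nat \<Rightarrow> 'a::comm_ring_1"
  assumes "finite U"
  shows "(\<Sum>B\<in>Pow U. \<phi> (card B)) = (\<Sum>j\<le>card U. of_nat (card U choose j) * \<phi> j)"
proof -
  have "(\<Sum>B\<in>Pow U. \<phi> (card B)) = (\<Sum>j\<le>card U. \<Sum>B\<in>{B\<in>Pow U. card B = j}. \<phi> (card B))"
    using assms by (intro sum.group[symmetric]) (auto simp: card_mono)
  also have "\<dots> = (\<Sum>j\<le>card U. \<Sum>B\<in>{B\<in>Pow U. card B = j}. \<phi> j)"
    by (intro sum.cong) auto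
  also have "\<dots> = (\<Sum>j\<le>card U. of_nat (card U choose j) * \<phi> j)"
    using n_subsets[OF assms] by (simp add: Pow_def)
  finally show ?thesis .
qed

lemma sum_triangle:
  fixes F :: "nat \<Rightarrow> nat \<Rightarrow> 'a::comm_monoid_add"
  shows "(\<Sum>j\<le>M. \<Sum>v\<in>{j..M}. F j v) = (\<Sum>v\<le>M. \<Sum>j\<le>v. F j v)"
  by (simp add: sum.Sigma)
    (rule sum.reindex_bij_witness[where i = "\<lambda>(v, j). (j, v)" and j = "\<lambda>(j, v). (v, j)"], auto)

text \<open>Meeting point of the two halves: by \<open>sum_chains\<close> these axioms identify w
  with the weighted count of chains, and by \<open>chain_weights_eulerian\<close> the tree
  polynomials satisfy them.\<close>

locale chain_weights =
  fixes s :: "'a::comm_ring_1" and q :: nat and w :: "nat \<Rightarrow> 'a"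
  assumes w_small: "j \<le> q \<Longrightarrow> w j = 1"
    and w_rec: "q < v \<Longrightarrow> w v = (\<Sum>j<v. of_nat (v choose j) * (w j * s ^ (v - j - 1)))"
begin

definition chains :: "'b set \<Rightarrow> ('b set \<times> 'b set set) set" where
  "chains U = {(A, C). card A \<le> q \<and> (\<forall>S\<in>C. q < card S \<and> A \<subseteq> S) \<and>
     (\<forall>S\<in>C. \<forall>T\<in>C. S \<subseteq> T \<or> T \<subseteq> S) \<and> A \<union> \<Union>C = U}"

lemma finite_chains: "finite U \<Longrightarrow> finite (chains U)"
  by (rule finite_subset[of _ "Pow U \<times> Pow (Pow U)"]) (auto simp: chains_def)

text \<open>Chain members have distinct sizes above q, so there are at most |U| - q of them. This
  keeps the natural subtraction in the exponents exact.\<close>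

lemma chains_card_le:
  assumes "finite U" and AC: "(A, C) \<in> chains U"
  shows "card A + card C \<le> card U"
proof (cases "C = {}")
  case True
  then show ?thesis using AC by (auto simp: chains_def)
next
  case False
  have fin: "finite S" if "S \<in> C" for S
    using that AC assms(1) by (auto simp: chains_def intro: finite_subset)
  have "inj_on card C"
  proof (rule inj_onI)
    fix S T assume ST: "S \<in> C" "T \<in> C" "card S = card T"
    then have "S \<subseteq> T \<or> T \<subseteq> S" using AC by (auto simp: chains_def)
    then show "S = T" using ST fin card_subset_eq by metis
  qed
  moreover have "card ` C \<subseteq> {q<..card U}"
    using AC assms(1) by (auto simp: chains_def intro!: card_mono)
  then have "card (card ` C) \<le> card {q<..card U}" by (intro card_mono) auto
  ultimately have "card C \<le> card U - q" by (simp add: card_image)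
  moreover have "card A \<le> q" "q \<le> card U"
    using AC False \<open>card ` C \<subseteq> {q<..card U}\<close> by (force simp: chains_def)+
  ultimately show ?thesis by linarith
qed

lemma chains_small: "finite U \<Longrightarrow> card U \<le> q \<Longrightarrow> chains U = {(U, {})}"
proof (intro equalityI subsetI)
  fix x assume U: "finite U" "card U \<le> q" and x: "x \<in> chains U"
  obtain A C where AC: "x = (A, C)" by fastforce
  have "C = {}"
  proof (rule ccontr)
    assume "C \<noteq> {}"
    then obtain S where "S \<in> C" "q < card S" "S \<subseteq> U" using x AC by (auto simp: chains_def)
    then show False using U card_mono[of U S] by simp
  qed
  then show "x \<in> {(U, {})}" using x AC by (auto simp: chains_def)
qed (auto simp: chains_def)

lemma chains_Diff:
  assumes U: "finite U" "q < card U" and AC: "(A, C) \<in> chains U"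
  shows "U \<in> C \<and> A \<union> \<Union>(C - {U}) \<subset> U"
proof
  have sub: "A \<union> \<Union>C = U" using AC by (simp add: chains_def)
  have "finite C" by (rule finite_subset[of _ "Pow U"]) (use sub U in auto)
  have "C \<noteq> {}" using AC U by (auto simp: chains_def)
  then have "\<Union>C \<in> C" using \<open>finite C\<close> AC by (intro Union_chain_mem) (auto simp: chains_def)
  moreover from this have "A \<subseteq> \<Union>C" using AC by (auto simp: chains_def)
  ultimately show "U \<in> C" using sub by (simp add: sup_absorb2)
  have "A \<subset> U" using AC U sub by (auto simp: chains_def)
  show "A \<union> \<Union>(C - {U}) \<subset> U"
  proof (cases "C - {U} = {}")
    case True
    then show ?thesis using \<open>A \<subset> U\<close> by (simp only: True) simp
  next
    case False
    then have *: "\<Union>(C - {U}) \<in> C - {U}" using \<open>finite C\<close> AC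
      by (intro Union_chain_mem) (auto simp: chains_def)
    then have "A \<subseteq> \<Union>(C - {U})" using AC by (auto simp: chains_def)
    then have "A \<union> \<Union>(C - {U}) = \<Union>(C - {U})" by blast
    then show ?thesis using * sub by auto
  qed
qed

text \<open>Group by V, the union of what remains after deleting U itself from C. The deleted set
  accounts for the -1 in the exponent of the recurrence.\<close>

lemma sum_chains:
  "finite U \<Longrightarrow> (\<Sum>(A, C)\<in>chains U. s ^ (card U - (card A + card C))) = w (card U)"
proof (induction U rule: finite_psubset_induct)
  case (psubset U)
  show ?case
  proof (cases "card U \<le> q")
    case True
    then show ?thesis using psubset.hyps by (simp add: chains_small w_small)
  next
    case False
    let ?P = "{V. V \<subset> U}"
    have finP: "finite ?P" using psubset.hyps by (auto intro: finite_subset[of _ "Pow U"])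
    have fin: "finite V" if "V \<in> ?P" for V using that psubset.hyps by (auto intro: finite_subset)
    have "(\<Sum>(A, C)\<in>chains U. s ^ (card U - (card A + card C))) =
        (\<Sum>(V, A, C)\<in>Sigma ?P chains. s ^ (card V - (card A + card C)) * s ^ (card U - card V - 1))"
    proof (rule sum.reindex_bij_witness[where i = "\<lambda>(V, A, C). (A, insert U C)"
          and j = "\<lambda>(A, C). (A \<union> \<Union>(C - {U}), A, C - {U})"])
      fix x assume x: "x \<in> chains U"
      obtain A C where AC: "x = (A, C)" by fastforce
      have d: "U \<in> C" "A \<union> \<Union>(C - {U}) \<subset> U"
        using chains_Diff[of U A C] psubset.hyps False x AC by auto
      have m: "(A, C - {U}) \<in> chains (A \<union> \<Union>(C - {U}))" using x AC by (auto simp: chains_def)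
      show "(case (case x of (A, C) \<Rightarrow> (A \<union> \<Union>(C - {U}), A, C - {U})) of (V, A, C) \<Rightarrow> (A, insert U C)) = x"
        using d AC by auto
      show "(case x of (A, C) \<Rightarrow> (A \<union> \<Union>(C - {U}), A, C - {U})) \<in> Sigma ?P chains"
        using d m AC by auto
      define V where "V = A \<union> \<Union>(C - {U})"
      have "finite C" by (rule finite_subset[of _ "Pow U"]) (use psubset.hyps x AC in \<open>auto simp: chains_def\<close>)
      then have "card C = Suc (card (C - {U}))" using d(1) by (rule card.remove)
      moreover have "card A + card (C - {U}) \<le> card V"
        using fin[of V] d m by (intro chains_card_le) (auto simp: V_def)
      moreover have "card V < card U" using d psubset.hyps unfolding V_def by (intro psubset_card_mono)
      ultimately have "card U - (card A + card C) =
          (card V - (card A + card (C - {U}))) + (card U - card V - 1)" by linarith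
      then show "(case case x of (A, C) \<Rightarrow> (A \<union> \<Union>(C - {U}), A, C - {U}) of
           (V, A, C) \<Rightarrow> s ^ (card V - (card A + card C)) * s ^ (card U - card V - 1)) =
          (case x of (A, C) \<Rightarrow> s ^ (card U - (card A + card C)))"
        unfolding AC V_def by (simp flip: power_add)
    next
      fix x assume x: "x \<in> Sigma ?P chains"
      obtain V A C where VAC: "x = (V, A, C)" by (metis prod_cases3)
      have V: "V \<subset> U" "(A, C) \<in> chains V" using x VAC by auto
      have "U \<notin> C" using V by (auto simp: chains_def)
      moreover have "A \<union> \<Union>C = V" using V by (auto simp: chains_def)
      ultimately show "(case (case x of (V, A, C) \<Rightarrow> (A, insert U C)) of
          (A, C) \<Rightarrow> (A \<union> \<Union>(C - {U}), A, C - {U})) = x"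
        using VAC by simp
      show "(case x of (V, A, C) \<Rightarrow> (A, insert U C)) \<in> chains U"
        using V False VAC by (auto simp: chains_def)
    qed
    also have "\<dots> = (\<Sum>V\<in>?P. \<Sum>(A, C)\<in>chains V. s ^ (card V - (card A + card C)) * s ^ (card U - card V - 1))"
      by (rule sum.Sigma[symmetric, OF finP]) (use fin finite_chains in blast)
    also have "\<dots> = (\<Sum>V\<in>?P. w (card V) * s ^ (card U - card V - 1))"
    proof (rule sum.cong[OF refl])
      fix V assume V: "V \<in> ?P"
      have "(\<Sum>(A, C)\<in>chains V. s ^ (card V - (card A + card C)) * s ^ (card U - card V - 1)) =
          (\<Sum>(A, C)\<in>chains V. s ^ (card V - (card A + card C))) * s ^ (card U - card V - 1)"
        by (simp add: sum_distrib_right case_prod_unfold)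
      also have "\<dots> = w (card V) * s ^ (card U - card V - 1)"
        using psubset.IH[of V] V by simp
      finally show "(\<Sum>(A, C)\<in>chains V. s ^ (card V - (card A + card C)) * s ^ (card U - card V - 1)) =
          w (card V) * s ^ (card U - card V - 1)" .
    qed
    also have "\<dots> = (\<Sum>V\<in>Pow U. if card V < card U then w (card V) * s ^ (card U - card V - 1) else 0)"
    proof (rule sum.mono_neutral_cong_left)
      show "\<forall>V\<in>Pow U - ?P. (if card V < card U then w (card V) * s ^ (card U - card V - 1) else 0) = 0" by auto
      show "w (card V) * s ^ (card U - card V - 1) =
          (if card V < card U then w (card V) * s ^ (card U - card V - 1) else 0)" if "V \<in> ?P" for V
        using that psubset.hyps psubset_card_mono[of U V] by auto
    qed (use psubset.hyps in auto)
    also have "\<dots> = (\<Sum>j\<le>card U. of_nat (card U choose j) *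
        (if j < card U then w j * s ^ (card U - j - 1) else 0))"
      by (rule sum_Pow_card[OF psubset.hyps])
    also have "\<dots> = (\<Sum>j<card U. of_nat (card U choose j) * (w j * s ^ (card U - j - 1)))"
      by (rule sum.mono_neutral_cong_right) auto
    also have "\<dots> = w (card U)" using False by (simp add: w_rec)
    finally show ?thesis .
  qed
qed

abbreviation "t \<equiv> 1 + s"

lemma power_t: "t ^ k = (\<Sum>j\<le>k. of_nat (k choose j) * s ^ (k - j))"
  using binomial_ring[of 1 s k] by simp

text \<open>For v > q the term j = v is w v and the others are s times the recurrence, together t *
  w v. For v <= q all weights are 1 and this is the binomial theorem.\<close>

lemma sum_w: "(\<Sum>j\<le>v. of_nat (v choose j) * (w j * s ^ (v - j))) = (if v \<le> q then t ^ v else t * w v)"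
proof (cases "v \<le> q")
  case True
  then show ?thesis by (simp add: power_t w_small)
next
  case False
  have "(\<Sum>j\<le>v. of_nat (v choose j) * (w j * s ^ (v - j))) =
      w v + (\<Sum>j<v. of_nat (v choose j) * (w j * s ^ (v - j)))"
    by (simp add: lessThan_Suc_atMost[symmetric])
  also have "(\<Sum>j<v. of_nat (v choose j) * (w j * s ^ (v - j))) =
      s * (\<Sum>j<v. of_nat (v choose j) * (w j * s ^ (v - j - 1)))"
    unfolding sum_distrib_left
  proof (rule sum.cong)
    fix j assume "j \<in> {..<v}"
    then have "s ^ (v - j) = s * s ^ (v - j - 1)"
      using power_minus_mult[of "v - j" s] by (simp add: mult.commute)
    then show "of_nat (v choose j) * (w j * s ^ (v - j)) =
        s * (of_nat (v choose j) * (w j * s ^ (v - j - 1)))" by (simp only: ac_simps)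
  qed simp
  also have "\<dots> = s * w v" using False by (simp add: w_rec)
  finally show ?thesis using False by (simp add: algebra_simps)
qed

text \<open>Choosing j of n and then v - j of the rest equals choosing v of n and then j of these;
  after the exchange the inner sum is \<open>sum_w\<close>.\<close>

lemma sum_triangle_w:
  assumes "M \<le> n"
  shows "(\<Sum>j\<le>M. of_nat (n choose j) * (w j * (\<Sum>v\<in>{j..M}. of_nat ((n - j) choose (v - j)) * s ^ (v - j)))) =
    (\<Sum>v\<le>M. of_nat (n choose v) * (if v \<le> q then t ^ v else t * w v))"
proof -
  have "(\<Sum>j\<le>M. of_nat (n choose j) * (w j * (\<Sum>v\<in>{j..M}. of_nat ((n - j) choose (v - j)) * s ^ (v - j)))) =
      (\<Sum>j\<le>M. \<Sum>v\<in>{j..M}. of_nat (n choose v) * (of_nat (v choose j) * (w j * s ^ (v - j))))"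
    unfolding sum_distrib_left
  proof (intro sum.cong refl)
    fix j v assume "j \<in> {..M}" "v \<in> {j..M}"
    then have "(n choose v) * (v choose j) = (n choose j) * ((n - j) choose (v - j))"
      using assms by (intro choose_mult) auto
    then have eq: "of_nat (n choose v) * of_nat (v choose j) =
        (of_nat (n choose j) * of_nat ((n - j) choose (v - j)) :: 'a)"
      by (metis of_nat_mult)
    have "of_nat (n choose j) * (w j * (of_nat ((n - j) choose (v - j)) * s ^ (v - j))) =
        (of_nat (n choose j) * of_nat ((n - j) choose (v - j))) * (w j * s ^ (v - j))"
      by (simp only: ac_simps)
    then show "of_nat (n choose j) * (w j * (of_nat ((n - j) choose (v - j)) * s ^ (v - j))) =
        of_nat (n choose v) * (of_nat (v choose j) * (w j * s ^ (v - j)))"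
      by (simp only: eq[symmetric] mult.assoc)
  qed
  then show ?thesis by (simp only: sum_triangle sum_distrib_left[symmetric] sum_w)
qed

text \<open>With M = q + r and n = M + 1 + m0, j is the size of the union of A and the proper chain
  members. The power of t sums over all N outside that union; the truncated sum has k = |N| and
  covers the chains that also contain the full set, at the cost of one in the exponent.\<close>

definition face_sum :: "nat \<Rightarrow> nat \<Rightarrow> 'a" where
  "face_sum M m0 = (\<Sum>j\<le>M. of_nat ((M + 1 + m0) choose j) * (w j *
     (t ^ (M + 1 + m0 - j) + (\<Sum>k\<le>m0. of_nat ((M + 1 + m0 - j) choose k) * s ^ (M + 1 + m0 - j - k - 1)))))"

text \<open>The binomial expansion cut at k = m0. The first piece is s times the truncated sum of
  \<open>face_sum\<close>; the second is reindexed by v = n - k, so that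
  \<open>sum_triangle_w\<close> applies.\<close>

lemma power_t_split:
  assumes "j \<le> M"
  shows "t ^ (M + 1 + m0 - j) = (\<Sum>k\<le>m0. of_nat ((M + 1 + m0 - j) choose k) * s ^ (M + 1 + m0 - j - k)) +
    (\<Sum>v\<in>{j..M}. of_nat ((M + 1 + m0 - j) choose (v - j)) * s ^ (v - j))"
proof -
  let ?n = "M + 1 + m0"
  let ?F = "\<lambda>k. of_nat ((?n - j) choose k) * s ^ (?n - j - k)"
  have "(\<Sum>v\<in>{j..M}. of_nat ((?n - j) choose (v - j)) * s ^ (v - j)) = sum ?F {m0<..?n - j}"
  proof (rule sum.reindex_bij_witness[where i = "\<lambda>k. ?n - k" and j = "\<lambda>v. ?n - v"])
    fix v assume v: "v \<in> {j..M}"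
    then have "v - j \<le> ?n - j" "?n - j - (v - j) = ?n - v" by auto
    then have "(?n - j) choose (?n - v) = (?n - j) choose (v - j)"
      using binomial_symmetric[of "v - j" "?n - j"] by metis
    moreover have "?n - j - (?n - v) = v - j" using v by auto
    ultimately show "?F (?n - v) = of_nat ((?n - j) choose (v - j)) * s ^ (v - j)" by simp
  qed (use assms in auto)
  moreover have "{..?n - j} = {..m0} \<union> {m0<..?n - j}" using assms by auto
  then have "t ^ (?n - j) = sum ?F {..m0} + sum ?F {m0<..?n - j}"
    unfolding power_t by (subst sum.union_disjoint[symmetric]) auto
  ultimately show ?thesis by simp
qed

text \<open>Multiplication by s removes the -1 in the exponent, and the truncated sum becomes
  t^(n-j) minus the second piece of \<open>power_t_split\<close>. Since s + 1 = t, the two powers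
  merge into t^(n-j+1).\<close>

lemma s_face_sum:
  defines "B M n \<equiv> \<Sum>v\<le>M. of_nat (n choose v) * (if v \<le> q then t ^ v else t * w v)"
  shows "s * face_sum M m0 = (\<Sum>j\<le>M. of_nat ((M + 1 + m0) choose j) * (w j * t ^ (M + 2 + m0 - j)))
    - B M (M + 1 + m0)"
proof -
  let ?n = "M + 1 + m0"
  let ?T = "\<lambda>j. \<Sum>v\<in>{j..M}. of_nat ((?n - j) choose (v - j)) * s ^ (v - j)"
  let ?X = "\<lambda>j. t ^ (?n - j) + (\<Sum>k\<le>m0. of_nat ((?n - j) choose k) * s ^ (?n - j - k - 1))"
  have inner: "s * ?X j = t ^ (M + 2 + m0 - j) - ?T j"
    if "j \<le> M" for j
  proof -
    have "s * (\<Sum>k\<le>m0. of_nat ((?n - j) choose k) * s ^ (?n - j - k - 1)) =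
        (\<Sum>k\<le>m0. of_nat ((?n - j) choose k) * s ^ (?n - j - k))"
      unfolding sum_distrib_left
    proof (rule sum.cong)
      fix k assume "k \<in> {..m0}"
      then have "0 < ?n - j - k" using that by auto
      then have "s ^ (?n - j - k) = s * s ^ (?n - j - k - 1)"
        using power_minus_mult[of "?n - j - k" s] by (simp only: mult.commute)
      then show "s * (of_nat ((?n - j) choose k) * s ^ (?n - j - k - 1)) =
          of_nat ((?n - j) choose k) * s ^ (?n - j - k)" by (simp only: ac_simps)
    qed simp
    also have "\<dots> = t ^ (?n - j) - ?T j" using power_t_split[OF that] by (simp only: add_diff_cancel_right')
    finally have "s * (\<Sum>k\<le>m0. of_nat ((?n - j) choose k) * s ^ (?n - j - k - 1)) = t ^ (?n - j) - ?T j" .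
    moreover have "M + 2 + m0 - j = Suc (?n - j)" using that by simp
    ultimately show ?thesis by (simp only: power_Suc distrib_left distrib_right) simp
  qed
  have "s * face_sum M m0 = (\<Sum>j\<le>M. of_nat (?n choose j) * (w j * (s * ?X j)))"
    unfolding face_sum_def
    by (subst sum_distrib_left, intro sum.cong refl) (simp only: mult.left_commute[of s])
  also have "\<dots> =
      (\<Sum>j\<le>M. of_nat (?n choose j) * (w j * t ^ (M + 2 + m0 - j)) - of_nat (?n choose j) * (w j * ?T j))"
    by (intro sum.cong refl) (simp only: inner right_diff_distrib atMost_iff)
  also have "\<dots> = (\<Sum>j\<le>M. of_nat (?n choose j) * (w j * t ^ (M + 2 + m0 - j))) - B M ?n"
    unfolding sum_subtractf B_def by (subst sum_triangle_w) simp_all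
  finally show ?thesis .
qed

text \<open>The truncated sum is the single term s^(n-j-1). Summed over j it is w n by the
  recurrence, and the missing piece s^(n-j) of the expansion gives s * w n; together they are the
  term v = n.\<close>

lemma face_sum_0:
  assumes "q \<le> M"
  shows "face_sum M 0 = (\<Sum>v\<le>M + 1. of_nat ((M + 1) choose v) * (if v \<le> q then t ^ v else t * w v))"
proof -
  let ?n = "M + 1"
  let ?T = "\<lambda>j. \<Sum>v\<in>{j..M}. of_nat ((?n - j) choose (v - j)) * s ^ (v - j)"
  let ?b = "\<lambda>v. of_nat (?n choose v) * (if v \<le> q then t ^ v else t * w v)"
  let ?c = "\<lambda>j. of_nat (?n choose j) :: 'a"
  have wn: "(\<Sum>j\<le>M. ?c j * (w j * s ^ (?n - j - 1))) = w ?n"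
  proof -
    have "w ?n = (\<Sum>j<?n. ?c j * (w j * s ^ (?n - j - 1)))" using assms by (intro w_rec) simp
    moreover have "{..<?n} = {..M}" by auto
    ultimately show ?thesis by (simp only:)
  qed
  have "t ^ (?n - j) = s * s ^ (?n - j - 1) + ?T j" if "j \<le> M" for j
    using power_t_split[OF that, of 0] that by (simp add: Suc_diff_le)
  then have "face_sum M 0 = (\<Sum>j\<le>M. ?c j * (w j * ?T j) + s * (?c j * (w j * s ^ (?n - j - 1)))
      + ?c j * (w j * s ^ (?n - j - 1)))"
    unfolding face_sum_def by (intro sum.cong refl) (simp add: algebra_simps)
  also have "\<dots> = (\<Sum>j\<le>M. ?c j * (w j * ?T j)) + s * w ?n + w ?n"
    by (simp only: sum.distrib sum_distrib_left[symmetric] wn)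
  also have "(\<Sum>j\<le>M. ?c j * (w j * ?T j)) = (\<Sum>v\<le>M. ?b v)" by (rule sum_triangle_w) simp
  finally show ?thesis using assms by (simp add: algebra_simps)
qed

end

section \<open>The face count as a weighted sum over chains\<close>

context parking_facets begin

text \<open>Triples are grouped by U, the union of A and the proper members of C. Given U, the pair
  (A, C without the full set) is an element of \<open>chains U\<close>, N is any subset of the
  complement, and the bit \<open>e\<close> records the full set, which is allowed only if
  \<open>card N \<le> m0\<close>.\<close>

lemma sum_valid:
  assumes "chain_weights s q w"
  shows "(\<Sum>(N, A, C) | valid N A C. s ^ (CARD('n) - (card N + card A + card C))) =
    chain_weights.face_sum s w (q + r) m0"
proof -
  interpret cw: chain_weights s q w by (rule assms)
  let ?n = "CARD('n)"
  let ?Us = "{U :: 'n set. card U \<le> q + r}"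
  let ?E = "\<lambda>N. if card N \<le> m0 then {False, True} else {False}"
  let ?S = "Sigma ?Us (\<lambda>U. Sigma (Pow (- U)) (\<lambda>N. cw.chains U \<times> ?E N))"
  let ?i = "\<lambda>(U :: 'n set, N, (A, C), e). (N, A, if e then insert UNIV C else C)"
  let ?j = "\<lambda>(N, A, C). (A \<union> \<Union>(C - {UNIV}), N, (A, C - {UNIV}), UNIV \<in> C)"
  let ?h = "\<lambda>(U :: 'n set, N :: 'n set, (A :: 'n set, C :: 'n set set), e).
    s ^ (card U - (card A + card C)) * s ^ (?n - card U - card N - (if e then 1 else 0))"
  have proper: "UNIV \<notin> C" if "card U \<le> q + r" "(A, C) \<in> cw.chains U" for A U :: "'n set" and C
  proof
    assume "UNIV \<in> C"
    then have "U = UNIV" using that by (auto simp: cw.chains_def)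
    then show False using that n by simp
  qed
  have "(\<Sum>(N, A, C) | valid N A C. s ^ (?n - (card N + card A + card C))) = sum ?h ?S"
  proof (rule sum.reindex_bij_witness[where i = ?i and j = ?j])
    fix x :: "'n set \<times> 'n set \<times> 'n set set" assume "x \<in> {(N, A, C). valid N A C}"
    then obtain N A C where x: "x = (N, A, C)" "valid N A C" by auto
    show "?i (?j x) = x" using x by (auto simp: insert_absorb)
    define U where "U = A \<union> \<Union>(C - {UNIV})"
    have "U = A \<or> U \<in> C - {UNIV}"
    proof (cases "C - {UNIV} = {}")
      case True
      then show ?thesis unfolding U_def True by simp
    next
      case False
      then have "\<Union>(C - {UNIV}) \<in> C - {UNIV}"
        using x(2) by (intro Union_chain_mem) (auto simp: valid_def)
      moreover from this have "A \<subseteq> \<Union>(C - {UNIV})" using x(2) by (auto simp: valid_def)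
      ultimately show ?thesis by (simp add: U_def sup_absorb2)
    qed
    then have U: "card U \<le> q + r" "U \<inter> N = {}"
      using x(2) card_proper_facet[of U] by (auto simp: valid_def)
    have ch: "(A, C - {UNIV}) \<in> cw.chains U"
      using x(2) card_facet by (auto simp: cw.chains_def valid_def U_def)
    show "?j x \<in> ?S" using U ch x unfolding U_def by (auto simp: valid_def)
    have c1: "card A + card (C - {UNIV}) \<le> card U" using ch by (intro cw.chains_card_le) auto
    have c2: "card C = card (C - {UNIV}) + (if UNIV \<in> C then 1 else 0)"
      using card.remove[of C UNIV] by (cases "UNIV \<in> C") auto
    have c3: "card U + card N + (if UNIV \<in> C then 1 else 0) \<le> ?n"
    proof (cases "UNIV \<in> C")
      case True
      then have "card N \<le> m0" using x(2) by (simp add: valid_def)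
      then show ?thesis using U n by simp
    next
      case False
      have "card U + card N = card (U \<union> N)" using U by (simp add: card_Un_disjoint)
      also have "\<dots> \<le> ?n" by (rule card_mono) auto
      finally show ?thesis using False by simp
    qed
    have "?n - (card N + card A + card C) = (card U - (card A + card (C - {UNIV}))) +
        (?n - card U - card N - (if UNIV \<in> C then 1 else 0))"
      using c1 c2 c3 by linarith
    then show "?h (?j x) = (case x of (N, A, C) \<Rightarrow> s ^ (?n - (card N + card A + card C)))"
      unfolding x U_def by (simp only: prod.case power_add)
  next
    fix y assume "y \<in> ?S"
    then obtain U N A C e where y: "y = (U, N, (A, C), e)" and U: "card U \<le> q + r" "N \<subseteq> - U"
        "(A, C) \<in> cw.chains U" "e \<in> ?E N" by auto
    note p = proper[OF U(1,3)]
    have AC: "A \<union> \<Union>C = U" using U(3) by (auto simp: cw.chains_def)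
    have "(if e then insert UNIV C else C) - {UNIV} = C" using p by auto
    then show "?j (?i y) = y" using p AC unfolding y by auto
    have "card S \<le> q + r" if "S \<in> C" for S
      using card_mono[of U S] AC U(1) that by fastforce
    then have "valid N A (if e then insert UNIV C else C)"
      using U p AC unfolding valid_def facet_sets_def by (auto simp: cw.chains_def split: if_splits)
    then show "?i y \<in> {(N, A, C). valid N A C}" unfolding y by simp
  qed
  also have "\<dots> = (\<Sum>U\<in>?Us. \<Sum>N\<in>Pow (- U). \<Sum>x\<in>cw.chains U \<times> ?E N. ?h (U, N, x))"
    by (simp add: sum.Sigma cw.finite_chains case_prod_unfold)
  also have "\<dots> = (\<Sum>U\<in>?Us. \<Sum>N\<in>Pow (- U). \<Sum>(A, C)\<in>cw.chains U. \<Sum>e\<in>?E N. ?h (U, N, (A, C), e))"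
    by (simp add: sum.cartesian_product case_prod_unfold)
  also have "\<dots> = (\<Sum>U\<in>?Us. \<Sum>N\<in>Pow (- U). w (card U) *
      (s ^ (?n - card U - card N) + (if card N \<le> m0 then s ^ (?n - card U - card N - 1) else 0)))"
  proof (intro sum.cong refl)
    fix U N :: "'n set"
    let ?R = "s ^ (?n - card U - card N) + (if card N \<le> m0 then s ^ (?n - card U - card N - 1) else 0)"
    have "(\<Sum>(A, C)\<in>cw.chains U. \<Sum>e\<in>?E N. ?h (U, N, (A, C), e)) =
        (\<Sum>(A, C)\<in>cw.chains U. s ^ (card U - (card A + card C)) * ?R)"
      by (intro sum.cong refl) (auto simp: distrib_left)
    also have "\<dots> = (\<Sum>(A, C)\<in>cw.chains U. s ^ (card U - (card A + card C))) * ?R"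
      by (simp add: sum_distrib_right case_prod_unfold)
    also have "\<dots> = w (card U) * ?R" by (simp only: cw.sum_chains[OF finite])
    finally show "(\<Sum>(A, C)\<in>cw.chains U. \<Sum>e\<in>?E N. ?h (U, N, (A, C), e)) = w (card U) * ?R" .
  qed
  also have "\<dots> = (\<Sum>U\<in>?Us. w (card U) * (cw.t ^ (?n - card U) +
      (\<Sum>k\<le>m0. of_nat ((?n - card U) choose k) * s ^ (?n - card U - k - 1))))"
  proof (intro sum.cong refl)
    fix U assume U: "U \<in> ?Us"
    define c where "c = ?n - card U"
    have c: "card (- U) = c" by (simp add: c_def Compl_eq_Diff_UNIV card_Diff_subset)
    have m0c: "m0 \<le> c" using U n by (simp add: c_def)
    have "(\<Sum>N\<in>Pow (- U). w (card U) *
        (s ^ (c - card N) + (if card N \<le> m0 then s ^ (c - card N - 1) else 0))) =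
      w (card U) * (\<Sum>N\<in>Pow (- U). s ^ (c - card N) + (if card N \<le> m0 then s ^ (c - card N - 1) else 0))"
      by (simp add: sum_distrib_left)
    also have "\<dots> = w (card U) * (\<Sum>k\<le>c. of_nat (c choose k) *
        (s ^ (c - k) + (if k \<le> m0 then s ^ (c - k - 1) else 0)))"
      by (subst sum_Pow_card[where \<phi> = "\<lambda>k. s ^ (c - k) + (if k \<le> m0 then s ^ (c - k - 1) else 0)"])
        (simp_all add: c)
    also have "(\<Sum>k\<le>c. of_nat (c choose k) *
        (s ^ (c - k) + (if k \<le> m0 then s ^ (c - k - 1) else 0))) =
        (\<Sum>k\<le>c. of_nat (c choose k) * s ^ (c - k)) +
        (\<Sum>k\<le>c. if k \<le> m0 then of_nat (c choose k) * s ^ (c - k - 1) else 0)"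
      unfolding sum.distrib[symmetric] by (intro sum.cong refl) (simp add: distrib_left)
    also have "(\<Sum>k\<le>c. of_nat (c choose k) * s ^ (c - k)) = cw.t ^ c" by (rule cw.power_t[symmetric])
    also have "(\<Sum>k\<le>c. if k \<le> m0 then of_nat (c choose k) * s ^ (c - k - 1) else 0) =
        (\<Sum>k\<le>m0. of_nat (c choose k) * s ^ (c - k - 1))"
      using m0c by (intro sum.mono_neutral_cong_right) auto
    finally show "(\<Sum>N\<in>Pow (- U). w (card U) *
        (s ^ (?n - card U - card N) + (if card N \<le> m0 then s ^ (?n - card U - card N - 1) else 0))) =
      w (card U) * (cw.t ^ (?n - card U) +
      (\<Sum>k\<le>m0. of_nat ((?n - card U) choose k) * s ^ (?n - card U - k - 1)))"
      by (simp only: c_def)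
  qed
  also have "\<dots> = (\<Sum>U\<in>Pow (UNIV :: 'n set). if card U \<le> q + r then w (card U) * (cw.t ^ (?n - card U) +
      (\<Sum>k\<le>m0. of_nat ((?n - card U) choose k) * s ^ (?n - card U - k - 1))) else 0)"
    by (rule sum.mono_neutral_cong_left) auto
  also have "\<dots> = (\<Sum>j\<le>?n. of_nat (?n choose j) * (if j \<le> q + r then w j * (cw.t ^ (?n - j) +
      (\<Sum>k\<le>m0. of_nat ((?n - j) choose k) * s ^ (?n - j - k - 1))) else 0))"
    by (rule sum_Pow_card) simp
  also have "\<dots> = (\<Sum>j\<le>q + r. of_nat (?n choose j) * (w j * (cw.t ^ (?n - j) +
      (\<Sum>k\<le>m0. of_nat ((?n - j) choose k) * s ^ (?n - j - k - 1)))))"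
    using n by (intro sum.mono_neutral_cong_right) auto
  also have "\<dots> = cw.face_sum (q + r) m0" unfolding cw.face_sum_def n ..
  finally show ?thesis .
qed

end

section \<open>Generalized Eulerian polynomials of the trees\<close>

text \<open>A relabelling of T(p, q) is given by the word on its trunk. U loses each label as it is
  passed, so at the last label a it holds a and the leaves; \<open>a < k\<close> excludes a
  itself.\<close>

fun tree_asc :: "nat set \<Rightarrow> nat list \<Rightarrow> nat" where
  "tree_asc U [] = 0"
| "tree_asc U [a] = card {k\<in>U. a < k}"
| "tree_asc U (a # b # w) = (if a < b then 1 else 0) + tree_asc (U - {a}) (b # w)"

definition trunks :: "nat \<Rightarrow> nat set \<Rightarrow> nat list set" where
  "trunks p U = {w. length w = p \<and> distinct w \<and> set w \<subseteq> U}"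

lemma finite_trunks: "finite U \<Longrightarrow> finite (trunks p U)"
  by (rule finite_subset[OF _ finite_lists_length_eq[of U p]]) (auto simp: trunks_def)

lemma tree_asc_eq:
  assumes "w \<noteq> []" "distinct w" "set w \<subseteq> U" "finite U"
  shows "tree_asc U w = card {i. Suc i < length w \<and> w ! i < w ! Suc i} + card {k \<in> U - set w. last w < k}"
  using assms
proof (induction U w rule: tree_asc.induct)
  case (2 U a)
  have "{k\<in>U. a < k} = {k \<in> U - set [a]. last [a] < k}" by auto
  then show ?case by simp
next
  case (3 U a b w)
  have "{i. Suc i < length (a # b # w) \<and> (a # b # w) ! i < (a # b # w) ! Suc i} =
      (if a < b then {0} else {}) \<union> Suc ` {i. Suc i < length (b # w) \<and> (b # w) ! i < (b # w) ! Suc i}"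
    (is "?I = ?Z \<union> Suc ` ?J")
  proof (rule set_eqI)
    fix i show "i \<in> ?I \<longleftrightarrow> i \<in> ?Z \<union> Suc ` ?J" by (cases i) (auto simp: image_iff)
  qed
  moreover have "finite ?J" by (rule finite_subset[of _ "{..length (b # w)}"]) auto
  ultimately have "card ?I = (if a < b then 1 else 0) + card ?J"
    by (subst \<open>?I = ?Z \<union> Suc ` ?J\<close>, subst card_Un_disjoint) (auto simp: card_image)
  moreover have "{k \<in> U - {a} - set (b # w). last (b # w) < k} = {k \<in> U - set (a # b # w). last (a # b # w) < k}"
    by auto
  moreover have "tree_asc (U - {a}) (b # w) =
      card {i. Suc i < length (b # w) \<and> (b # w) ! i < (b # w) ! Suc i} +
      card {k \<in> U - {a} - set (b # w). last (b # w) < k}"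
    using "3.prems" by (intro "3.IH") auto
  ultimately show ?case by simp
qed simp

context
  fixes s :: "'a::comm_ring_1" and q :: nat
begin

text \<open>The tree polynomial with q leaves and labels U, evaluated at 1 + s. The value 1 for
  small U is the convention \<open>w_small\<close>.\<close>

definition trunk_sum :: "nat set \<Rightarrow> 'a" where
  "trunk_sum U = (if card U \<le> q then 1 else (\<Sum>w\<in>trunks (card U - q) U. (1 + s) ^ tree_asc U w))"

text \<open>Each ascent has weight 1 + s, that is, it is marked or not. B consists of the first
  label and the marked ascents that directly continue it; after the first unmarked step the
  remaining trunk is arbitrary on U - B. If all trunk steps are marked, the marked leaves above the
  last label join B; then U - B has at most q labels and weight 1.\<close>

lemma trunk_sum_above:
  "finite U \<Longrightarrow> q < card U \<Longrightarrow>
    (\<Sum>w\<in>{w\<in>trunks (card U - q) U. a < hd w}. (1 + s) ^ tree_asc U w) =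
    (\<Sum>B\<in>Pow {k\<in>U. a < k} - {{}}. s ^ (card B - 1) * trunk_sum (U - B))"
proof (induction "card U" arbitrary: U a)
  case (Suc c)
  define p where "p = card U - q"
  have p: "0 < p" using Suc.prems by (simp add: p_def)
  have "(\<Sum>w\<in>{w\<in>trunks p U. a < hd w}. (1 + s) ^ tree_asc U w) =
      (\<Sum>(b, w)\<in>Sigma {k\<in>U. a < k} (\<lambda>b. trunks (p - 1) (U - {b})). (1 + s) ^ tree_asc U (b # w))"
  proof (rule sum.reindex_bij_witness[where i = "\<lambda>(b, w). b # w" and j = "\<lambda>w. (hd w, tl w)"])
    fix w assume "w \<in> {w\<in>trunks p U. a < hd w}"
    moreover from this p have "w \<noteq> []" by (auto simp: trunks_def)
    ultimately show "(case (hd w, tl w) of (b, w) \<Rightarrow> b # w) = w"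
      "(hd w, tl w) \<in> Sigma {k\<in>U. a < k} (\<lambda>b. trunks (p - 1) (U - {b}))"
      "(case (hd w, tl w) of (b, w) \<Rightarrow> (1 + s) ^ tree_asc U (b # w)) = (1 + s) ^ tree_asc U w"
      by (cases w; auto simp: trunks_def)+
  qed (use p in \<open>auto simp: trunks_def\<close>)
  also have "\<dots> = (\<Sum>b\<in>{k\<in>U. a < k}. \<Sum>w\<in>trunks (p - 1) (U - {b}). (1 + s) ^ tree_asc U (b # w))"
    using Suc.prems by (subst sum.Sigma) (auto intro: finite_trunks)
  also have "\<dots> = (\<Sum>b\<in>{k\<in>U. a < k}. \<Sum>B\<in>Pow {k\<in>U. b < k}. s ^ card B * trunk_sum (U - insert b B))"
  proof (rule sum.cong[OF refl])
    fix b assume b: "b \<in> {k\<in>U. a < k}"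
    let ?V = "U - {b}" and ?P = "Pow {k\<in>U. b < k}"
    have V: "finite ?V" "card ?V = c" using Suc b by auto
    have UV: "{k\<in>?V. b < k} = {k\<in>U. b < k}" by auto
    have diff: "U - insert b B = ?V - B" for B by blast
    have fP: "finite {k\<in>U. b < k}" using Suc.prems by simp
    show "(\<Sum>w\<in>trunks (p - 1) ?V. (1 + s) ^ tree_asc U (b # w)) =
        (\<Sum>B\<in>?P. s ^ card B * trunk_sum (U - insert b B))"
    proof (cases "c \<le> q")
      \<comment> \<open>The trunk ends at b, and the factor 1 + s of each leaf above b is expanded
        into subsets of marked leaves.\<close>
      case True
      then have "p = 1" using Suc by (simp add: p_def)
      then have "trunks (p - 1) ?V = {[]}" by (auto simp: trunks_def)
      then have "(\<Sum>w\<in>trunks (p - 1) ?V. (1 + s) ^ tree_asc U (b # w)) = (1 + s) ^ card {k\<in>U. b < k}" by simp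
      also have "\<dots> = (\<Sum>j\<le>card {k\<in>U. b < k}. of_nat (card {k\<in>U. b < k} choose j) * s ^ j)"
        using binomial_ring[of s 1 "card {k\<in>U. b < k}"] by (simp add: add.commute)
      also have "\<dots> = (\<Sum>B\<in>?P. s ^ card B)" 
        using sum_Pow_card[OF fP, of "\<lambda>j. s ^ j"] by simp
      also have "\<dots> = (\<Sum>B\<in>?P. s ^ card B * trunk_sum (U - insert b B))"
      proof (rule sum.cong[OF refl])
        fix B
        have "card (U - insert b B) \<le> c" unfolding diff[of B] using V card_mono[of ?V "?V - B"] by simp
        then show "s ^ card B = s ^ card B * trunk_sum (U - insert b B)"
          using True by (simp add: trunk_sum_def)
      qed
      finally show ?thesis .
    next
      case False
      then have p1: "p - 1 = card ?V - q" "0 < p - 1" using Suc V by (simp_all add: p_def)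
      let ?L = "trunks (p - 1) ?V"
      have fL: "finite ?L" using V by (intro finite_trunks)
      \<comment> \<open>The step after b is split into its unmarked part, which gives the empty B,
        and its marked part, which is the induction hypothesis with bound b.\<close>
      have "(\<Sum>w\<in>?L. (1 + s) ^ tree_asc U (b # w)) =
          (\<Sum>w\<in>?L. (1 + s) ^ tree_asc ?V w + s * (if b < hd w then (1 + s) ^ tree_asc ?V w else 0))"
      proof (rule sum.cong[OF refl])
        fix w assume "w \<in> ?L"
        then obtain x y where w: "w = x # y" using p1(2) by (cases w) (auto simp: trunks_def)
        show "(1 + s) ^ tree_asc U (b # w) =
            (1 + s) ^ tree_asc ?V w + s * (if b < hd w then (1 + s) ^ tree_asc ?V w else 0)"
          unfolding w by (simp add: distrib_right)
      qed
      also have "\<dots> = (\<Sum>w\<in>?L. (1 + s) ^ tree_asc ?V w) +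
          s * (\<Sum>w\<in>{w\<in>?L. b < hd w}. (1 + s) ^ tree_asc ?V w)"
        using fL by (simp add: sum.distrib sum.inter_filter sum_distrib_left)
      also have "(\<Sum>w\<in>?L. (1 + s) ^ tree_asc ?V w) = trunk_sum ?V"
        using False V p1 by (simp add: trunk_sum_def)
      also have "(\<Sum>w\<in>{w\<in>?L. b < hd w}. (1 + s) ^ tree_asc ?V w) =
          (\<Sum>B\<in>?P - {{}}. s ^ (card B - 1) * trunk_sum (?V - B))"
        unfolding p1(1) using Suc.hyps(1)[of ?V b] V False UV by simp
      also have "s * \<dots> = (\<Sum>B\<in>?P - {{}}. s ^ card B * trunk_sum (?V - B))"
        unfolding sum_distrib_left
      proof (rule sum.cong[OF refl])
        fix B assume "B \<in> ?P - {{}}"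
        then have "0 < card B" using fP by (auto simp: card_gt_0_iff intro: finite_subset)
        then have "s ^ card B = s * s ^ (card B - 1)"
          using power_minus_mult[of "card B" s] by (simp add: mult.commute)
        then show "s * (s ^ (card B - 1) * trunk_sum (?V - B)) = s ^ card B * trunk_sum (?V - B)"
          by (simp only: mult.assoc)
      qed
      also have "trunk_sum ?V + \<dots> = (\<Sum>B\<in>?P. s ^ card B * trunk_sum (?V - B))"
        using fP by (subst sum.remove[of ?P "{}"]) auto
      finally show ?thesis by (simp only: diff[symmetric])
    qed
  qed
  also have "\<dots> = (\<Sum>(b, B)\<in>Sigma {k\<in>U. a < k} (\<lambda>b. Pow {k\<in>U. b < k}). s ^ card B * trunk_sum (U - insert b B))"
    using Suc.prems by (intro sum.Sigma) auto
  also have "\<dots> = (\<Sum>B\<in>Pow {k\<in>U. a < k} - {{}}. s ^ (card B - 1) * trunk_sum (U - B))"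
  \<comment> \<open>A marked run increases, so its first label is recovered as the minimum.\<close>
  proof (rule sum.reindex_bij_witness[where i = "\<lambda>B. (Min B, B - {Min B})" and j = "\<lambda>(b, B). insert b B"])
    fix x assume "x \<in> Sigma {k\<in>U. a < k} (\<lambda>b. Pow {k\<in>U. b < k})"
    then obtain b B where x: "x = (b, B)" "b \<in> U" "a < b" "B \<subseteq> {k\<in>U. b < k}" by auto
    have fB: "finite B" using x(4) Suc.prems by (auto intro: finite_subset)
    have "b \<notin> B" using x(4) by auto
    have "Min (insert b B) = b" using x(4) fB by (intro Min_eqI) auto
    then show "(Min (case x of (b, B) \<Rightarrow> insert b B), (case x of (b, B) \<Rightarrow> insert b B) -
        {Min (case x of (b, B) \<Rightarrow> insert b B)}) = x"
      using x(1) \<open>b \<notin> B\<close> by simp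
    show "(case x of (b, B) \<Rightarrow> insert b B) \<in> Pow {k\<in>U. a < k} - {{}}" using x by auto
    show "s ^ (card (case x of (b, B) \<Rightarrow> insert b B) - 1) * trunk_sum (U - (case x of (b, B) \<Rightarrow> insert b B)) =
        (case x of (b, B) \<Rightarrow> s ^ card B * trunk_sum (U - insert b B))"
      using x(1) fB \<open>b \<notin> B\<close> by simp
  next
    fix B assume B: "B \<in> Pow {k\<in>U. a < k} - {{}}"
    then have fB: "finite B" "B \<noteq> {}" using Suc.prems by (auto intro: finite_subset)
    then have M: "Min B \<in> B" by simp
    then show "(case (Min B, B - {Min B}) of (b, B) \<Rightarrow> insert b B) = B" by auto
    have "Min B < k" if "k \<in> B - {Min B}" for k
      using that fB Min_le[OF fB(1), of k] by (auto simp: less_le)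
    then show "(Min B, B - {Min B}) \<in> Sigma {k\<in>U. a < k} (\<lambda>b. Pow {k\<in>U. b < k})"
      using B M by auto
  qed
  finally show ?case unfolding p_def .
qed simp

text \<open>The bound a = 0 lies below all labels, so \<open>trunk_sum_above\<close> covers every
  trunk; V is the complement of B.\<close>

lemma trunk_sum_rec:
  assumes U: "finite U" "0 \<notin> U" "q < card U"
  shows "trunk_sum U = (\<Sum>V\<in>Pow U. if card V < card U then trunk_sum V * s ^ (card U - card V - 1) else 0)"
proof -
  have "trunk_sum U = (\<Sum>w\<in>{w\<in>trunks (card U - q) U. 0 < hd w}. (1 + s) ^ tree_asc U w)"
  proof -
    have "{w\<in>trunks (card U - q) U. 0 < hd w} = trunks (card U - q) U"
    proof -
      have "0 < hd w" if "w \<in> trunks (card U - q) U" for w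
      proof -
        have "w \<noteq> []" using that U by (auto simp: trunks_def)
        then have "hd w \<in> U" using that by (auto simp: trunks_def)
        then show ?thesis using U(2) by (metis gr0I)
      qed
      then show ?thesis by blast
    qed
    then show ?thesis using U by (simp add: trunk_sum_def)
  qed
  also have "\<dots> = (\<Sum>B\<in>Pow {k\<in>U. 0 < k} - {{}}. s ^ (card B - 1) * trunk_sum (U - B))"
    by (rule trunk_sum_above[OF U(1,3)])
  also have "{k\<in>U. 0 < k} = U" using U(2) by (auto intro: gr0I)
  also have "(\<Sum>B\<in>Pow U - {{}}. s ^ (card B - 1) * trunk_sum (U - B)) =
      (\<Sum>V\<in>{V\<in>Pow U. card V < card U}. trunk_sum V * s ^ (card U - card V - 1))"
  proof (rule sum.reindex_bij_witness[where i = "\<lambda>V. U - V" and j = "\<lambda>B. U - B"])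
    fix B assume B: "B \<in> Pow U - {{}}"
    then have fB: "finite B" and c: "card (U - B) = card U - card B" "card B \<le> card U"
      using U(1) by (auto intro: finite_subset card_Diff_subset card_mono)
    then have "0 < card B" using B by (auto simp: card_gt_0_iff)
    then show "U - B \<in> {V\<in>Pow U. card V < card U}" using c by auto
    show "trunk_sum (U - B) * s ^ (card U - card (U - B) - 1) = s ^ (card B - 1) * trunk_sum (U - B)"
      using c by (simp add: mult.commute)
    show "U - (U - B) = B" using B by auto
  qed (use U in \<open>auto simp: double_diff\<close>)
  also have "\<dots> = (\<Sum>V\<in>Pow U. if card V < card U then trunk_sum V * s ^ (card U - card V - 1) else 0)"
    by (rule sum.inter_filter) (use U in simp)
  finally show ?thesis .
qed

text \<open>The recurrence sees only the sizes of subsets, so the labels themselves are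
  irrelevant.\<close>

lemma trunk_sum_card:
  assumes "finite U" "0 \<notin> U"
  shows "trunk_sum U = trunk_sum {1..card U}"
  using assms
proof (induction "card U" arbitrary: U rule: less_induct)
  case less
  show ?case
  proof (cases "q < card U")
    case True
    have step: "trunk_sum U' = (\<Sum>j\<le>card U. of_nat (card U choose j) *
        (if j < card U then trunk_sum {1..j} * s ^ (card U - j - 1) else 0))"
      if U': "finite U'" "0 \<notin> U'" "card U' = card U" for U'
    proof -
      have "trunk_sum U' = (\<Sum>V\<in>Pow U'. if card V < card U' then trunk_sum V * s ^ (card U' - card V - 1) else 0)"
        using U' True by (intro trunk_sum_rec) auto
      also have "\<dots> = (\<Sum>V\<in>Pow U'. if card V < card U' then trunk_sum {1..card V} * s ^ (card U' - card V - 1) else 0)"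
      proof (rule sum.cong[OF refl])
        fix V assume V: "V \<in> Pow U'"
        then have "finite V" "0 \<notin> V" using U' by (auto intro: finite_subset)
        then show "(if card V < card U' then trunk_sum V * s ^ (card U' - card V - 1) else 0) =
            (if card V < card U' then trunk_sum {1..card V} * s ^ (card U' - card V - 1) else 0)"
          using less.hyps[of V] U'(3) by auto
      qed
      also have "\<dots> = (\<Sum>j\<le>card U'. of_nat (card U' choose j) *
        (if j < card U' then trunk_sum {1..j} * s ^ (card U' - j - 1) else 0))"
        by (rule sum_Pow_card[OF U'(1)])
      finally show ?thesis by (simp only: U'(3))
    qed
    show ?thesis using step[of U] step[of "{1..card U}"] less.prems by simp
  next
    case False
    then show ?thesis by (simp add: trunk_sum_def)
  qed
qed

lemma chain_weights_trunk_sum: "chain_weights s q (\<lambda>j. trunk_sum {1..j})"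
proof
  show "trunk_sum {1..j} = 1" if "j \<le> q" for j using that by (simp add: trunk_sum_def)
  fix v assume v: "q < v"
  have "trunk_sum {1..v} = (\<Sum>V\<in>Pow {1..v}. if card V < v then trunk_sum V * s ^ (v - card V - 1) else 0)"
  proof -
    have c: "card {1..v} = v" by simp
    show ?thesis using v by (intro trunk_sum_rec[of "{1..v}", unfolded c]) auto
  qed
  also have "\<dots> = (\<Sum>V\<in>Pow {1..v}. if card V < v then trunk_sum {1..card V} * s ^ (v - card V - 1) else 0)"
  proof (rule sum.cong[OF refl])
    fix V assume "V \<in> Pow {1..v}"
    then have "trunk_sum V = trunk_sum {1..card V}"
      by (intro trunk_sum_card) (auto intro: finite_subset)
    then show "(if card V < v then trunk_sum V * s ^ (v - card V - 1) else 0) =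
      (if card V < v then trunk_sum {1..card V} * s ^ (v - card V - 1) else 0)" by simp
  qed
  also have "\<dots> = (\<Sum>j\<le>v. of_nat (v choose j) * (if j < v then trunk_sum {1..j} * s ^ (v - j - 1) else 0))"
    using sum_Pow_card[of "{1..v}" "\<lambda>j. if j < v then trunk_sum {1..j} * s ^ (v - j - 1) else 0"] by simp
  also have "\<dots> = (\<Sum>j<v. of_nat (v choose j) * (trunk_sum {1..j} * s ^ (v - j - 1)))"
    by (rule sum.mono_neutral_cong_right) auto
  finally show "trunk_sum {1..v} = (\<Sum>j<v. of_nat (v choose j) * (trunk_sum {1..j} * s ^ (v - j - 1)))" .
qed

end

section \<open>Relabelled tree posets encoded by their trunk words\<close>

definition tree_rel :: "nat \<Rightarrow> nat list \<Rightarrow> nat rel" where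
  "tree_rel N w = Id_on {1..N} \<union> {(w ! i, b) |i b. i < length w \<and> b \<in> {1..N} - set (take (Suc i) w)}"

lemma covers_image:
  assumes "inj \<sigma>"
  shows "covers (map_prod \<sigma> \<sigma> ` r) = map_prod \<sigma> \<sigma> ` covers r"
proof -
  define R where "R = map_prod \<sigma> \<sigma> ` r"
  have mem: "(\<sigma> i, \<sigma> j) \<in> R \<longleftrightarrow> (i, j) \<in> r" for i j
    using assms by (auto simp: R_def inj_eq)
  have range: "\<exists>i j. x = \<sigma> i \<and> y = \<sigma> j" if "(x, y) \<in> R" for x y
    using that by (auto simp: R_def)
  have key: "(\<sigma> i, \<sigma> j) \<in> covers R \<longleftrightarrow> (i, j) \<in> covers r" for i j
  proof -
    have eq: "(\<exists>k. k \<noteq> \<sigma> i \<and> k \<noteq> \<sigma> j \<and> (\<sigma> i, k) \<in> R \<and> (k, \<sigma> j) \<in> R) \<longleftrightarrow>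
        (\<exists>k. k \<noteq> i \<and> k \<noteq> j \<and> (i, k) \<in> r \<and> (k, j) \<in> r)"
      (is "?l \<longleftrightarrow> ?r")
    proof
      assume ?l
      then obtain k where k: "k \<noteq> \<sigma> i" "k \<noteq> \<sigma> j" "(\<sigma> i, k) \<in> R" "(k, \<sigma> j) \<in> R" by blast
      obtain k' where "k = \<sigma> k'" using range[OF k(3)] by blast
      then have "k' \<noteq> i \<and> k' \<noteq> j \<and> (i, k') \<in> r \<and> (k', j) \<in> r" using k mem by auto
      then show ?r by blast
    next
      assume ?r
      then obtain k where "k \<noteq> i" "k \<noteq> j" "(i, k) \<in> r" "(k, j) \<in> r" by blast
      then have "\<sigma> k \<noteq> \<sigma> i" "\<sigma> k \<noteq> \<sigma> j" "(\<sigma> i, \<sigma> k) \<in> R" "(\<sigma> k, \<sigma> j) \<in> R"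
        using mem assms by (simp_all add: inj_eq)
      then show ?l by blast
    qed
    show ?thesis
      unfolding covers_def by (simp only: mem_Collect_eq prod.case eq mem inj_eq[OF assms])
  qed
  have "covers R = map_prod \<sigma> \<sigma> ` covers r"
  proof (intro equalityI subsetI)
    fix z assume z: "z \<in> covers R"
    obtain x y where xy: "z = (x, y)" by fastforce
    have "(x, y) \<in> R" using z by (simp add: xy covers_def)
    then obtain i j where "x = \<sigma> i" "y = \<sigma> j" using range by blast
    then show "z \<in> map_prod \<sigma> \<sigma> ` covers r" using z key xy by force
  next
    fix z assume "z \<in> map_prod \<sigma> \<sigma> ` covers r"
    then show "z \<in> covers R" using key by auto
  qed
  then show ?thesis by (simp only: R_def)
qed

lemma tree_rel_relabel:
  assumes "1 \<le> p" and \<sigma>: "\<sigma> permutes {1..p + q}"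
  shows "map_prod \<sigma> \<sigma> ` T_poset p q = tree_rel (p + q) (map \<sigma> [1..<Suc p])"
proof -
  let ?w = "map \<sigma> [1..<Suc p]"
  have nth: "?w ! i = \<sigma> (Suc i)" if "i < p" for i using that by (simp del: upt_Suc)
  have im: "\<sigma> ` {1..p + q} = {1..p + q}" by (rule permutes_image[OF \<sigma>])
  have tk: "set (take (Suc i) ?w) = \<sigma> ` {1..Suc i}" if "i < p" for i
    using that by (simp add: take_map take_upt atLeastLessThanSuc_atLeastAtMost del: upt_Suc)
  have T: "T_poset p q = Id_on {1..p + q} \<union> {(Suc i, j) |i j. i < p \<and> j \<in> {1..p + q} - {1..Suc i}}"
  proof (rule set_eqI, clarify)
    fix i j
    show "(i, j) \<in> T_poset p q \<longleftrightarrow>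
        (i, j) \<in> Id_on {1..p + q} \<union> {(Suc i, j) |i j. i < p \<and> j \<in> {1..p + q} - {1..Suc i}}"
      unfolding T_poset_iff[OF assms(1)] by (cases i) auto
  qed
  have "map_prod \<sigma> \<sigma> ` Id_on {1..p + q} = Id_on {1..p + q}"
  proof -
    have "map_prod \<sigma> \<sigma> ` Id_on X = Id_on (\<sigma> ` X)" for X by (auto simp: Id_on_def)
    then show ?thesis by (simp only: im)
  qed
  moreover have "map_prod \<sigma> \<sigma> ` {(Suc i, j) |i j. i < p \<and> j \<in> {1..p + q} - {1..Suc i}} =
      {(?w ! i, b) |i b. i < length ?w \<and> b \<in> {1..p + q} - set (take (Suc i) ?w)}" (is "?L = ?R")
  proof -
    have d: "{1..p + q} - set (take (Suc i) ?w) = \<sigma> ` ({1..p + q} - {1..Suc i})" if "i < p" for i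
      unfolding tk[OF that] using image_set_diff[OF permutes_inj[OF \<sigma>]] im by metis
    have "?R = {(\<sigma> (Suc i), b) |i b. i < p \<and> b \<in> \<sigma> ` ({1..p + q} - {1..Suc i})}"
    proof (rule set_eqI, clarify)
      fix x y
      have "(\<exists>i b. (x, y) = (?w ! i, b) \<and> i < length ?w \<and> b \<in> {1..p + q} - set (take (Suc i) ?w)) \<longleftrightarrow>
          (\<exists>i<p. x = ?w ! i \<and> y \<in> {1..p + q} - set (take (Suc i) ?w))" by auto
      also have "\<dots> \<longleftrightarrow> (\<exists>i<p. x = \<sigma> (Suc i) \<and> y \<in> \<sigma> ` ({1..p + q} - {1..Suc i}))"
        using nth d by metis
      finally show "(x, y) \<in> ?R \<longleftrightarrow> (x, y) \<in> {(\<sigma> (Suc i), b) |i b. i < p \<and> b \<in> \<sigma> ` ({1..p + q} - {1..Suc i})}"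
        by blast
    qed
    also have "\<dots> = ?L" by force
    finally show ?thesis by simp
  qed
  ultimately show ?thesis unfolding T tree_rel_def image_Un by simp
qed

lemma asc_relabel:
  assumes "1 \<le> p" and \<sigma>: "\<sigma> permutes {1..p + q}"
  shows "asc (map_prod \<sigma> \<sigma> ` T_poset p q) = tree_asc {1..p + q} (map \<sigma> [1..<Suc p])"
proof -
  let ?w = "map \<sigma> [1..<Suc p]" and ?N = "p + q"
  have inj: "inj \<sigma>" by (rule permutes_inj[OF \<sigma>])
  have im: "\<sigma> ` {1..?N} = {1..?N}" by (rule permutes_image[OF \<sigma>])
  have nth: "?w ! i = \<sigma> (Suc i)" if "i < p" for i using that by (simp del: upt_Suc)
  have last: "last ?w = \<sigma> p" using assms(1) nth[of "p - 1"] by (simp add: last_conv_nth del: upt_Suc)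
  have set_w: "set ?w = \<sigma> ` {1..p}" by (simp add: atLeastLessThanSuc_atLeastAtMost del: upt_Suc)
  let ?A = "(\<lambda>i. (Suc i, Suc (Suc i))) ` {i. Suc i < length ?w \<and> ?w ! i < ?w ! Suc i}"
  let ?B = "(\<lambda>k. (p, k)) ` {k\<in>{p + 1..?N}. \<sigma> p < \<sigma> k}"
  have "{(i, j). (i, j) \<in> covers (map_prod \<sigma> \<sigma> ` T_poset p q) \<and> i < j} =
      map_prod \<sigma> \<sigma> ` {(i, j) \<in> T_covers p q. \<sigma> i < \<sigma> j}"
    unfolding covers_image[OF inj] covers_T_poset[OF assms(1)] by force
  then have "asc (map_prod \<sigma> \<sigma> ` T_poset p q) = card {(i, j) \<in> T_covers p q. \<sigma> i < \<sigma> j}"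
    unfolding asc_def by (simp add: card_image prod.inj_map inj inj_on_subset[of _ UNIV])
  also have "{(i, j) \<in> T_covers p q. \<sigma> i < \<sigma> j} = ?A \<union> ?B"
  proof (rule set_eqI, clarify)
    fix i j
    have A: "(i, j) \<in> ?A \<longleftrightarrow> 1 \<le> i \<and> i < p \<and> j = i + 1 \<and> \<sigma> i < \<sigma> j"
    proof
      assume "(i, j) \<in> ?A"
      then show "1 \<le> i \<and> i < p \<and> j = i + 1 \<and> \<sigma> i < \<sigma> j" using nth by (auto simp del: upt_Suc)
    next
      assume *: "1 \<le> i \<and> i < p \<and> j = i + 1 \<and> \<sigma> i < \<sigma> j"
      then show "(i, j) \<in> ?A"
        using nth[of "i - 1"] nth[of i] by (intro image_eqI[of _ _ "i - 1"]) (auto simp del: upt_Suc)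
    qed
    show "(i, j) \<in> {(i, j) \<in> T_covers p q. \<sigma> i < \<sigma> j} \<longleftrightarrow> (i, j) \<in> ?A \<union> ?B"
      unfolding Un_iff A by (auto simp: T_covers_def)
  qed
  also have "card (?A \<union> ?B) = card ?A + card ?B"
  proof (rule card_Un_disjoint)
    show "finite ?A"
      by (rule finite_imageI, rule finite_subset[of _ "{..length ?w}"]) auto
    show "finite ?B" by simp
    show "?A \<inter> ?B = {}" by (auto simp del: upt_Suc)
  qed
  also have "card ?A = card {i. Suc i < length ?w \<and> ?w ! i < ?w ! Suc i}"
    by (rule card_image) (auto simp: inj_on_def)
  also have "card ?B = card {k\<in>{p + 1..?N}. \<sigma> p < \<sigma> k}" by (rule card_image) (auto simp: inj_on_def)
  also have "\<dots> = card (\<sigma> ` {k\<in>{p + 1..?N}. \<sigma> p < \<sigma> k})"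
    by (rule card_image[symmetric]) (rule inj_on_subset[OF inj], simp)
  also have "\<sigma> ` {k\<in>{p + 1..?N}. \<sigma> p < \<sigma> k} = {k \<in> {1..?N} - set ?w. last ?w < k}"
  proof -
    have "{1..?N} - set ?w = \<sigma> ` {p + 1..?N}"
    proof -
      have "{p + 1..?N} = {1..?N} - {1..p}" by auto
      then show ?thesis unfolding set_w using image_set_diff[OF inj] im by metis
    qed
    then show ?thesis unfolding last by auto
  qed
  finally show ?thesis
    using assms(1) im by (subst tree_asc_eq) (auto simp: distinct_map inj_on_subset[OF inj] simp del: upt_Suc)
qed

lemma permutation_extending_list:
  assumes "w \<in> trunks p {1..p + q}"
  shows "\<exists>\<sigma>. \<sigma> permutes {1..p + q} \<and> map \<sigma> [1..<Suc p] = w"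
proof -
  let ?N = "{1..p + q}"
  have w: "length w = p" "distinct w" "set w \<subseteq> ?N" using assms by (auto simp: trunks_def)
  have bw: "bij_betw (\<lambda>i. w ! (i - 1)) {1..p} (set w)"
  proof -
    have "bij_betw (\<lambda>i. i - 1) {1..p} {..<p}"
      by (rule bij_betwI[where g = Suc]) auto
    moreover have "bij_betw ((!) w) {..<p} (set w)" by (rule bij_betw_nth) (use w in auto)
    ultimately show ?thesis using bij_betw_trans by (fastforce simp: comp_def)
  qed
  have "card (?N - set w) = q" using w by (simp add: card_Diff_subset distinct_card)
  then obtain h where h: "bij_betw h {p + 1..p + q} (?N - set w)"
    using finite_same_card_bij[of "{p + 1..p + q}" "?N - set w"] by auto
  define \<sigma> where "\<sigma> i = (if i \<in> {1..p} then w ! (i - 1) else if i \<in> {p + 1..p + q} then h i else i)" for i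
  have "bij_betw \<sigma> ({1..p} \<union> {p + 1..p + q}) (set w \<union> (?N - set w))"
  proof (rule bij_betw_combine)
    show "bij_betw \<sigma> {1..p} (set w)"
      using bw by (subst bij_betw_cong[where g = "\<lambda>i. w ! (i - 1)"]) (auto simp: \<sigma>_def)
    show "bij_betw \<sigma> {p + 1..p + q} (?N - set w)"
      using h by (subst bij_betw_cong[where g = h]) (auto simp: \<sigma>_def)
  qed auto
  moreover have "{1..p} \<union> {p + 1..p + q} = ?N" "set w \<union> (?N - set w) = ?N" using w by auto
  ultimately have "bij_betw \<sigma> ?N ?N" by simp
  then have "\<sigma> permutes ?N" by (rule bij_imp_permutes) (auto simp: \<sigma>_def)
  moreover have "map \<sigma> [1..<Suc p] = w"
    using w by (intro nth_equalityI) (auto simp: \<sigma>_def simp del: upt_Suc)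
  ultimately show ?thesis by blast
qed

text \<open>The trunk label at position i has N - i labels weakly above it, at least 2 because there
  is a leaf, while a leaf has only itself. So the order determines the word, and distinct posets
  correspond to trunk words rather than to permutations, which may also shuffle the leaves.\<close>

lemma inj_on_tree_rel:
  assumes "1 \<le> q"
  shows "inj_on (tree_rel (p + q)) (trunks p {1..p + q})"
proof (rule inj_onI)
  fix w w' assume w: "w \<in> trunks p {1..p + q}" and w': "w' \<in> trunks p {1..p + q}"
    and eq: "tree_rel (p + q) w = tree_rel (p + q) w'"
  let ?N = "p + q"
  have up: "card (tree_rel ?N v `` {v ! i}) = ?N - i" if v: "v \<in> trunks p {1..?N}" and i: "i < p" for v i
  proof -
    have v': "length v = p" "distinct v" "set v \<subseteq> {1..?N}" using v by (auto simp: trunks_def)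
    have "tree_rel ?N v `` {v ! i} = insert (v ! i) ({1..?N} - set (take (Suc i) v))"
    proof -
      have "v ! i \<in> {1..?N}" using v' i nth_mem by blast
      moreover have "k = i" if "v ! k = v ! i" "k < p" for k
        using that v' i nth_eq_iff_index_eq by blast
      ultimately show ?thesis using v' i unfolding tree_rel_def by (auto simp: Id_on_def)
    qed
    moreover have "v ! i \<in> set (take (Suc i) v)" using v' i by (simp add: take_Suc_conv_app_nth)
    moreover have "set (take (Suc i) v) \<subseteq> {1..?N}" by (rule order_trans[OF set_take_subset v'(3)])
    moreover have "card (set (take (Suc i) v)) = Suc i" using v' i by (simp add: distinct_card)
    ultimately show ?thesis using i by (simp add: card_Diff_subset)
  qed
  have leaf: "card (tree_rel ?N v `` {x}) \<le> 1" if v: "v \<in> trunks p {1..?N}" and x: "x \<notin> set v" for v x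
  proof -
    have "x \<noteq> v ! i" if "i < length v" for i using x that by auto
    then have "tree_rel ?N v `` {x} \<subseteq> {x}" unfolding tree_rel_def by (auto simp: Id_on_def)
    then show ?thesis using card_mono[of "{x}" "tree_rel ?N v `` {x}"] by simp
  qed
  have len: "length w = p" "length w' = p" using w w' by (auto simp: trunks_def)
  show "w = w'"
  proof (rule nth_equalityI)
    show "length w = length w'" using len by simp
    fix i assume "i < length w"
    then have i: "i < p" using len by simp
    have c: "card (tree_rel ?N w' `` {w ! i}) = ?N - i" using up[OF w i] eq by simp
    have "w ! i \<in> set w'" using leaf[OF w', of "w ! i"] c i assms by fastforce
    then obtain k where k: "k < p" "w ! i = w' ! k" using len by (auto simp: in_set_conv_nth)
    then have "?N - k = ?N - i" using up[OF w' k(1)] c by simp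
    then have "k = i" using k i by linarith
    then show "w ! i = w' ! i" using k by simp
  qed
qed

lemma eulerian_poly_eq_sum:
  assumes "1 \<le> p" "1 \<le> q"
  shows "eulerian_poly (p + q) (T_poset p q) = (\<Sum>w\<in>trunks p {1..p + q}. monom 1 (tree_asc {1..p + q} w))"
proof -
  have rel: "\<exists>\<sigma>. \<sigma> permutes {1..p + q} \<and> w = map \<sigma> [1..<Suc p] \<and> tree_rel (p + q) w = map_prod \<sigma> \<sigma> ` T_poset p q"
    if "w \<in> trunks p {1..p + q}" for w
    using permutation_extending_list[OF that] tree_rel_relabel[OF assms(1)] by metis
  have "relabelings (p + q) (T_poset p q) = tree_rel (p + q) ` trunks p {1..p + q}"
  proof (intro equalityI subsetI)
    fix T assume "T \<in> relabelings (p + q) (T_poset p q)"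
    then obtain \<sigma> where \<sigma>: "\<sigma> permutes {1..p + q}" "T = map_prod \<sigma> \<sigma> ` T_poset p q"
      by (auto simp: relabelings_def)
    have "\<sigma> ` {1..p} \<subseteq> \<sigma> ` {1..p + q}" by auto
    then have "map \<sigma> [1..<Suc p] \<in> trunks p {1..p + q}"
      using permutes_image[OF \<sigma>(1)] permutes_inj[OF \<sigma>(1)]
      by (auto simp: trunks_def distinct_map intro: inj_on_subset simp del: upt_Suc)
    then show "T \<in> tree_rel (p + q) ` trunks p {1..p + q}"
      using \<sigma> tree_rel_relabel[OF assms(1) \<sigma>(1)] by blast
  next
    fix T assume "T \<in> tree_rel (p + q) ` trunks p {1..p + q}"
    then show "T \<in> relabelings (p + q) (T_poset p q)"
      using rel unfolding relabelings_def by blast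
  qed
  then have "eulerian_poly (p + q) (T_poset p q) =
      (\<Sum>w\<in>trunks p {1..p + q}. monom 1 (asc (tree_rel (p + q) w)))"
    unfolding eulerian_poly_def using sum.reindex[OF inj_on_tree_rel[OF assms(2)], of "\<lambda>T. monom 1 (asc T)"]
    by (simp only: comp_def)
  also have "\<dots> = (\<Sum>w\<in>trunks p {1..p + q}. monom 1 (tree_asc {1..p + q} w))"
  proof (rule sum.cong[OF refl])
    fix w assume "w \<in> trunks p {1..p + q}"
    then show "monom (1::int) (asc (tree_rel (p + q) w)) = monom 1 (tree_asc {1..p + q} w)"
      using rel asc_relabel[OF assms(1)] by metis
  qed
  finally show ?thesis .
qed

lemma chain_weights_eulerian:
  assumes "1 \<le> q"
  shows "chain_weights [:-1, 1::int:] q (\<lambda>j. if j \<le> q then 1 else eulerian_poly j (T_poset (j - q) q))"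
proof -
  have "trunk_sum [:-1, 1::int:] q {1..j} = (if j \<le> q then 1 else eulerian_poly j (T_poset (j - q) q))" for j
  proof (cases "j \<le> q")
    case False
    then have "eulerian_poly j (T_poset (j - q) q) = (\<Sum>w\<in>trunks (j - q) {1..j}. monom 1 (tree_asc {1..j} w))"
      using eulerian_poly_eq_sum[of "j - q" q] assms by simp
    moreover have "1 + [:-1, 1::int:] = monom 1 1" by (simp add: monom_Suc one_pCons)
    ultimately show ?thesis using False by (simp add: trunk_sum_def monom_power)
  qed (simp add: trunk_sum_def)
  then show ?thesis using chain_weights_trunk_sum[of "[:-1, 1::int:]" q] by simp
qed

section \<open>The h-polynomial\<close>

lemma geometric_sum_mult:
  fixes s :: "'a::comm_ring_1"
  assumes "a \<le> Suc b"
  shows "s * (\<Sum>j=a..b. (1 + s) ^ j) = (1 + s) ^ Suc b - (1 + s) ^ a"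
  using assms
proof (induction b)
  case 0
  then consider "a = 0" | "a = 1" by linarith
  then show ?case by cases auto
next
  case (Suc b)
  show ?case
  proof (cases "a = Suc (Suc b)")
    case False
    then have "a \<le> Suc b" using Suc.prems by simp
    then have "s * (\<Sum>j=a..Suc b. (1 + s) ^ j) = s * (\<Sum>j=a..b. (1 + s) ^ j) + s * (1 + s) ^ Suc b"
      by (simp add: distrib_left)
    also have "\<dots> = (1 + s) ^ Suc b - (1 + s) ^ a + s * (1 + s) ^ Suc b"
      using Suc.IH \<open>a \<le> Suc b\<close> by simp
    finally show ?thesis by (simp add: algebra_simps)
  qed simp
qed

lemma sum_atMost_split_shift:
  fixes F :: "nat \<Rightarrow> 'a::comm_monoid_add"
  shows "(\<Sum>v\<le>q + k. F v) = (\<Sum>j=0..q. F j) + (\<Sum>i=1..k. F (i + q))"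
proof (induction k)
  case (Suc k)
  show ?case using Suc.IH by (simp add: add.assoc add.commute[of k q])
qed (simp add: atMost_atLeast0)

text \<open>The summand is antisymmetric under \<open>i \<mapsto> n - i\<close>, so the indices between
  \<open>n - q\<close> and \<open>q\<close> contribute nothing.\<close>

lemma antisymmetric_binomial_sum:
  fixes t :: "'a::{idom,ring_char_0}"
  assumes "q < n"
  shows "(\<Sum>i=0..q. of_nat (n choose i) * (t ^ Suc (n - i) - t ^ Suc i)) =
    (\<Sum>i=0..min q (n - q - 1). of_nat (n choose i) * (t ^ Suc (n - i) - t ^ Suc i))"
proof (cases "q \<le> n - q - 1")
  case False
  define z where "z = n - q - 1"
  let ?\<phi> = "\<lambda>i. of_nat (n choose i) * (t ^ Suc (n - i) - t ^ Suc i)"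
  have z: "z < q" "n = z + q + 1" using False assms by (auto simp: z_def)
  have "sum ?\<phi> {z + 1..q} = (\<Sum>i\<in>{z + 1..q}. - ?\<phi> i)"
  proof (rule sum.reindex_bij_witness[where i = "\<lambda>i. n - i" and j = "\<lambda>i. n - i"])
    fix i assume i: "i \<in> {z + 1..q}"
    then have "n choose (n - i) = n choose i" "n - (n - i) = i"
      using z binomial_symmetric[of i n] by auto
    then show "- ?\<phi> (n - i) = ?\<phi> i" by (simp add: algebra_simps)
  qed (use z in auto)
  then have "2 * sum ?\<phi> {z + 1..q} = 0" by (simp only: sum_negf) simp
  then have "sum ?\<phi> {z + 1..q} = 0" by (metis mult_eq_0_iff zero_neq_numeral)
  moreover have "{0..q} = {0..z} \<union> {z + 1..q}" using z by auto
  then have "sum ?\<phi> {0..q} = sum ?\<phi> {0..z} + sum ?\<phi> {z + 1..q}"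
    by (simp only:) (rule sum.union_disjoint, auto)
  moreover have "min q (n - q - 1) = z" unfolding z_def[symmetric] using z(1) by simp
  ultimately show ?thesis by (simp only: add_0_right)
qed (simp add: min_def)

lemma (in chain_weights) face_sum_0_eq:
  "face_sum (q + r) 0 = (\<Sum>j=0..q. of_nat ((q + r + 1) choose j) * t ^ j)
    + t * (\<Sum>i=1..r + 1. of_nat ((q + r + 1) choose (i + q)) * w (i + q))"
proof -
  have "face_sum (q + r) 0 = (\<Sum>v\<le>q + (r + 1). of_nat ((q + r + 1) choose v) * (if v \<le> q then t ^ v else t * w v))"
    by (simp only: face_sum_0[OF le_add1] add.assoc)
  also have "\<dots> = (\<Sum>j=0..q. of_nat ((q + r + 1) choose j) * t ^ j)
    + (\<Sum>i=1..r + 1. of_nat ((q + r + 1) choose (i + q)) * (t * w (i + q)))"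
    unfolding sum_atMost_split_shift by (intro arg_cong2[of _ _ _ _ "(+)"] sum.cong) auto
  finally show ?thesis unfolding sum_distrib_left by (simp only: mult.left_commute)
qed

text \<open>After multiplication by s the geometric sums become differences of powers, to be matched
  with \<open>s_face_sum\<close>. The limit z is where those sums stop being valid intervals; once
  they are differences, antisymmetry extends the range to q.\<close>

lemma face_sum_eq:
  fixes s :: "'a::{idom,ring_char_0}"
  assumes cw: "chain_weights s q w" and "s \<noteq> 0" and n: "n = q + r + 1 + m0"
  defines "t \<equiv> 1 + s"
  shows "chain_weights.face_sum s w (q + r) m0 =
    (\<Sum>i=0..min q (n - q - 1). of_nat (n choose i) * (\<Sum>j=i+1..n-i. t ^ j))
    + (\<Sum>i=1..r. of_nat (n choose (i + q)) * ((\<Sum>j=2..n-i-q. t ^ j) * w (i + q)))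
    + (\<Sum>j=0..q. of_nat (n choose j) * t ^ j)
    + t * (\<Sum>i=1..r. of_nat (n choose (i + q)) * w (i + q))"
proof -
  interpret chain_weights s q w by (rule cw)
  let ?c = "\<lambda>i. of_nat (n choose i) :: 'a"
  let ?z = "min q (n - q - 1)"
  define S1 where "S1 = (\<Sum>i=0..?z. ?c i * (\<Sum>j=i+1..n-i. t ^ j))"
  define S2 where "S2 = (\<Sum>i=1..r. ?c (i + q) * ((\<Sum>j=2..n-i-q. t ^ j) * w (i + q)))"
  define S3 where "S3 = (\<Sum>j=0..q. ?c j * t ^ j)"
  define S4 where "S4 = (\<Sum>i=1..r. ?c (i + q) * w (i + q))"
  have S1: "s * S1 = (\<Sum>i=0..q. ?c i * (t ^ Suc (n - i) - t ^ Suc i))"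
  proof -
    have "s * S1 = (\<Sum>i=0..?z. ?c i * (t ^ Suc (n - i) - t ^ Suc i))"
      unfolding S1_def sum_distrib_left[of s]
    proof (rule sum.cong[OF refl])
      fix i assume "i \<in> {0..?z}"
      then have "i + 1 \<le> Suc (n - i)" using n by (auto simp: min_def split: if_splits)
      from geometric_sum_mult[OF this, of s]
      have "s * (\<Sum>j=i+1..n-i. t ^ j) = t ^ Suc (n - i) - t ^ (i + 1)" unfolding t_def .
      then show "s * (?c i * (\<Sum>j=i+1..n-i. t ^ j)) = ?c i * (t ^ Suc (n - i) - t ^ Suc i)"
        by (simp only: mult.left_commute[of s] Suc_eq_plus1)
    qed
    also have "\<dots> = (\<Sum>i=0..q. ?c i * (t ^ Suc (n - i) - t ^ Suc i))"
      by (rule antisymmetric_binomial_sum[symmetric]) (use n in simp)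
    finally show ?thesis .
  qed
  have S24: "s * (S2 + t * S4) = (\<Sum>i=1..r. ?c (i + q) * (w (i + q) * (t ^ Suc (n - i - q) - t)))"
  proof -
    have "s * (S2 + t * S4) = (\<Sum>i=1..r. s * (?c (i + q) * ((\<Sum>j=2..n-i-q. t ^ j) * w (i + q))
        + t * (?c (i + q) * w (i + q))))"
      unfolding S2_def S4_def by (simp only: sum_distrib_left sum.distrib distrib_left)
    also have "\<dots> = (\<Sum>i=1..r. ?c (i + q) * (w (i + q) * (t ^ Suc (n - i - q) - t)))"
    proof (rule sum.cong[OF refl])
      fix i assume "i \<in> {1..r}"
      then have le: "1 \<le> n - i - q" using n by auto
      \<comment> \<open>The summand with factor t supplies the missing term j = 1 of the geometric
        sum.\<close>
      have "(\<Sum>j=1..n-i-q. t ^ j) = t + (\<Sum>j=2..n-i-q. t ^ j)"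
        using le by (subst sum.atLeast_Suc_atMost) (auto simp: numeral_2_eq_2)
      moreover have "s * (\<Sum>j=1..n-i-q. t ^ j) = t ^ Suc (n - i - q) - t"
        using geometric_sum_mult[of 1 "n - i - q" s] le by (simp add: t_def)
      ultimately have eq: "s * (t + (\<Sum>j=2..n-i-q. t ^ j)) = t ^ Suc (n - i - q) - t" by simp
      have "s * (?c (i + q) * ((\<Sum>j=2..n-i-q. t ^ j) * w (i + q)) + t * (?c (i + q) * w (i + q))) =
          ?c (i + q) * (w (i + q) * (s * (t + (\<Sum>j=2..n-i-q. t ^ j))))"
        by (simp only: distrib_left) (simp only: ac_simps)
      then show "s * (?c (i + q) * ((\<Sum>j=2..n-i-q. t ^ j) * w (i + q)) + t * (?c (i + q) * w (i + q))) =
          ?c (i + q) * (w (i + q) * (t ^ Suc (n - i - q) - t))" by (simp only: eq)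
    qed
    finally show ?thesis .
  qed
  have "s * (S1 + S2 + S3 + t * S4) =
      (\<Sum>i=0..q. ?c i * (t ^ Suc (n - i) - t ^ Suc i)) +
      (\<Sum>i=1..r. ?c (i + q) * (w (i + q) * (t ^ Suc (n - i - q) - t))) + s * S3"
    using S1 S24 by (simp add: algebra_simps)
  also have "s * S3 = (\<Sum>j=0..q. ?c j * (t ^ Suc j - t ^ j))"
    unfolding S3_def sum_distrib_left by (intro sum.cong refl) (simp add: t_def algebra_simps)
  also have "(\<Sum>i=0..q. ?c i * (t ^ Suc (n - i) - t ^ Suc i)) +
      (\<Sum>i=1..r. ?c (i + q) * (w (i + q) * (t ^ Suc (n - i - q) - t))) +
      (\<Sum>j=0..q. ?c j * (t ^ Suc j - t ^ j)) =
      ((\<Sum>j=0..q. ?c j * t ^ Suc (n - j)) + (\<Sum>i=1..r. ?c (i + q) * (w (i + q) * t ^ Suc (n - i - q))))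
      - ((\<Sum>j=0..q. ?c j * t ^ j) + (\<Sum>i=1..r. ?c (i + q) * (t * w (i + q))))"
    by (simp only: right_diff_distrib sum_subtractf mult.commute[of t]) (simp add: algebra_simps)
  also have "(\<Sum>j=0..q. ?c j * t ^ Suc (n - j)) + (\<Sum>i=1..r. ?c (i + q) * (w (i + q) * t ^ Suc (n - i - q))) =
      (\<Sum>j\<le>q + r. ?c j * (w j * t ^ (q + r + 2 + m0 - j)))"
    unfolding sum_atMost_split_shift
  proof (intro arg_cong2[of _ _ _ _ "(+)"] sum.cong refl)
    show "?c j * t ^ Suc (n - j) = ?c j * (w j * t ^ (q + r + 2 + m0 - j))" if "j \<in> {0..q}" for j
      using that n w_small[of j] by (simp add: Suc_diff_le)
    show "?c (i + q) * (w (i + q) * t ^ Suc (n - i - q)) =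
        ?c (i + q) * (w (i + q) * t ^ (q + r + 2 + m0 - (i + q)))" if "i \<in> {1..r}" for i
    proof -
      have "Suc (n - i - q) = q + r + 2 + m0 - (i + q)" using that n by auto
      then show ?thesis by (simp only:)
    qed
  qed
  also have "(\<Sum>j=0..q. ?c j * t ^ j) + (\<Sum>i=1..r. ?c (i + q) * (t * w (i + q))) =
      (\<Sum>v\<le>q + r. ?c v * (if v \<le> q then t ^ v else t * w v))"
    unfolding sum_atMost_split_shift by (intro arg_cong2[of _ _ _ _ "(+)"] sum.cong) auto
  also have "(\<Sum>j\<le>q + r. ?c j * (w j * t ^ (q + r + 2 + m0 - j))) -
      (\<Sum>v\<le>q + r. ?c v * (if v \<le> q then t ^ v else t * w v)) = s * face_sum (q + r) m0"
    unfolding s_face_sum n t_def ..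
  finally have "s * (S1 + S2 + S3 + t * S4) = s * face_sum (q + r) m0" .
  then show ?thesis using \<open>s \<noteq> 0\<close> unfolding S1_def S2_def S3_def S4_def by simp
qed

text \<open>With ties, the ranks of an upper set need not be an initial segment. They differ from it
  by equally many ranks on both sides, and those inside S carry values at least as large.\<close>

lemma top_sum_le_sum_upper:
  fixes \<pi> :: "'n::finite \<Rightarrow> nat"
  assumes \<pi>: "bij_betw \<pi> UNIV {..<CARD('n)}" and u: "sorted u" "\<forall>x\<in>set u. 0 \<le> x"
    and upper: "\<forall>i\<in>S. \<forall>j\<in>-S. desc u (\<pi> j) \<le> desc u (\<pi> i)"
  shows "top_sum u (card S) \<le> (\<Sum>i\<in>S. desc u (\<pi> i))"
proof -
  let ?K = "\<pi> ` S" and ?I = "{..<card S}"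
  have inj: "inj_on \<pi> X" for X using \<pi> by (auto simp: bij_betw_def intro: inj_on_subset)
  have cK: "card ?K = card S" by (rule card_image[OF inj])
  have K: "finite ?K" by simp
  have "card (?K - ?I) = card (?I - ?K)"
    using cK by (simp add: card_Diff_subset_Int Int_commute)
  moreover have "desc u i \<le> desc u k" if "i \<in> ?I - ?K" "k \<in> ?K - ?I" for i k
  proof -
    have "card S \<le> CARD('n)" by (rule card_mono) auto
    then have "i \<in> range \<pi>" using that \<pi> by (auto simp: bij_betw_def)
    then obtain j where j: "i = \<pi> j" by blast
    then have "j \<in> - S" using that by auto
    then show ?thesis using upper that j by auto
  qed
  ultimately have "sum (desc u) (?I - ?K) \<le> sum (desc u) (?K - ?I)"
  proof (cases "?I - ?K = {}")
    case True
    then show ?thesis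
      using desc_nonneg[OF u(2)] by (simp only: True sum.empty) (simp add: sum_nonneg)
  next
    case False
    define M where "M = Max (desc u ` (?I - ?K))"
    have fin: "finite (?I - ?K)" by simp
    have M: "desc u i \<le> M" if "i \<in> ?I - ?K" for i
      unfolding M_def using that fin by (intro Max_ge) auto
    have "M \<in> desc u ` (?I - ?K)" unfolding M_def using False fin by (intro Max_in) auto
    then have M': "M \<le> desc u k" if "k \<in> ?K - ?I" for k
      using that \<open>\<And>i k. i \<in> ?I - ?K \<Longrightarrow> k \<in> ?K - ?I \<Longrightarrow> desc u i \<le> desc u k\<close> by blast
    have "sum (desc u) (?I - ?K) \<le> of_nat (card (?I - ?K)) * M"
      using M by (intro sum_bounded_above) auto
    also have "\<dots> \<le> sum (desc u) (?K - ?I)"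
      unfolding \<open>card (?K - ?I) = card (?I - ?K)\<close>[symmetric] using M' by (intro sum_bounded_below) auto
    finally show ?thesis .
  qed
  then have "sum (desc u) ?I \<le> sum (desc u) ?K"
    using sum.Int_Diff[of ?I "desc u" ?K] sum.Int_Diff[of ?K "desc u" ?I] by (simp add: Int_commute)
  then show ?thesis by (simp add: top_sum_def sum.reindex[OF inj])
qed

text \<open>\<open>unique_of_simple\<close> is applied at u itself, its entries placed on the
  coordinates by an arbitrary enumeration. What remains is that swapping and dropping coordinates
  stay in \<open>PF u\<close>.\<close>

lemma simple_imp_count_le_1:
  assumes u: "sorted u" "\<forall>x\<in>set u. 0 \<le> x" "length u = CARD('n::finite)"
    and simple: "simple_polytope (PF u :: (real^'n) set)"
    and dim: "aff_dim (PF u :: (real^'n) set) = int CARD('n)"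
    and x: "0 < x" "y \<in> set u" "x < y"
  shows "count_list u x \<le> 1"
proof -
  let ?n = "CARD('n)"
  obtain \<pi> :: "'n \<Rightarrow> nat" where \<pi>: "bij_betw \<pi> UNIV {..<?n}"
    using ranking_exists[of "\<lambda>_. 0::nat"] by blast
  have lt: "\<pi> i < ?n" for i using \<pi> by (auto dest: bij_betwE)
  define v where "v = (vtx u \<pi> ?n :: real^'n)"
  have v: "v $ i = desc u (\<pi> i)" for i using lt by (simp add: v_def vtx_def)
  have surj: "\<exists>i. \<pi> i = k" if "k < ?n" for k
    using \<pi> that by (auto simp: bij_betw_def) (metis imageE lessThan_iff)
  interpret polymatroid_vertex v "PF u"
  proof
    show "convex (PF u :: (real^'n) set)" by (simp add: PF_def)
    show "v \<in> PF u" unfolding v_def by (rule vtx_in_PF[OF u \<pi>])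
    show "0 \<le> z $ i" if "z \<in> PF u" for z :: "real^'n" and i by (rule PF_bounds[OF u(1,2) that])
    fix z :: "real^'n" and S T :: "'n set"
    assume z: "z \<in> PF u" and S: "\<forall>i\<in>S. \<forall>j\<in>-S. v $ j \<le> v $ i" and T: "card T = card S"
    have "(\<Sum>i\<in>T. z $ i) \<le> top_sum u (card S)" using PF_bounds(2)[OF u(1,2) z, of T] T by simp
    also have "\<dots> \<le> (\<Sum>i\<in>S. v $ i)"
      using top_sum_le_sum_upper[OF \<pi> u(1,2), of S] S by (simp add: v)
    finally show "(\<Sum>i\<in>T. z $ i) \<le> (\<Sum>i\<in>S. v $ i)" .
  qed
  have swap_in: "swap i j \<in> PF u" for i j
  proof -
    let ?\<sigma> = "\<pi> \<circ> Transposition.transpose i j"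
    have "bij_betw ?\<sigma> UNIV {..<?n}"
      by (rule bij_betw_trans[OF _ \<pi>]) simp
    then have "vtx u ?\<sigma> ?n \<in> PF u" by (rule vtx_in_PF[OF u])
    moreover have "vtx u ?\<sigma> ?n = swap i j"
      using lt by (simp add: vec_eq_iff vtx_def swap_def v)
    ultimately show ?thesis by simp
  qed
  have drop_in: "drop_coord k \<in> PF u"
    if k: "0 < v $ k" and min: "\<And>c. 0 < v $ c \<Longrightarrow> v $ k \<le> v $ c" for k
  proof -
    \<comment> \<open>The number of positive entries of u.\<close>
    define p where "p = (LEAST k. desc u k = 0)"
    have p0: "desc u p = 0" unfolding p_def by (rule LeastI[of _ "length u"]) (simp add: desc_def)
    have anti: "antimono (desc u)" by (rule antimono_desc[OF u(1,2)])
    have below: "0 < desc u j" if "j < p" for j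
      using not_less_Least[of j "\<lambda>k. desc u k = 0"] that desc_nonneg[OF u(2), of j]
      by (auto simp: p_def)
    have above: "desc u j = 0" if "p \<le> j" for j
      using antimonoD[OF anti that] p0 desc_nonneg[OF u(2), of j] by simp
    have kp: "\<pi> k < p" using k above[of "\<pi> k"] by (force simp: v not_le[symmetric])
    have pn: "p \<le> ?n" unfolding p_def by (rule Least_le) (simp add: desc_def u(3))
    \<comment> \<open>Coordinate k receives the last positive rank p - 1, whose entry equals
      \<open>v $ k\<close> by minimality; cutting at p - 1 then zeroes just this coordinate.\<close>
    let ?\<sigma> = "Transposition.transpose (\<pi> k) (p - 1) \<circ> \<pi>"
    have "bij_betw (Transposition.transpose (\<pi> k) (p - 1)) {..<?n} {..<?n}"
      using kp pn by (intro bij_betwI[where g = "Transposition.transpose (\<pi> k) (p - 1)"])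
        (auto simp: Transposition.transpose_def)
    then have "bij_betw ?\<sigma> UNIV {..<?n}" by (rule bij_betw_trans[OF \<pi>])
    then have "vtx u ?\<sigma> (p - 1) \<in> PF u" by (rule vtx_in_PF[OF u])
    moreover have "vtx u ?\<sigma> (p - 1) = drop_coord k"
    proof (subst vec_eq_iff, intro allI)
      fix c
      have last: "desc u (p - 1) = desc u (\<pi> k)"
      proof -
        have "p - 1 < ?n" using kp pn by linarith
        then obtain c' where "\<pi> c' = p - 1" using surj by blast
        then have "desc u (\<pi> k) \<le> desc u (p - 1)"
          using min[of c'] below[of "p - 1"] kp by (simp add: v)
        moreover have "desc u (p - 1) \<le> desc u (\<pi> k)"
          using kp by (intro antimonoD[OF anti]) simp
        ultimately show ?thesis by simp
      qed
      consider "c = k" | "c \<noteq> k" "\<pi> c = p - 1" | "c \<noteq> k" "\<pi> c < p - 1" | "c \<noteq> k" "p \<le> \<pi> c"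
        by linarith
      then show "vtx u ?\<sigma> (p - 1) $ c = drop_coord k $ c"
      proof cases
        case 1
        then show ?thesis by (simp add: vtx_def drop_coord_def)
      next
        case 2
        have "\<pi> k \<noteq> \<pi> c" using \<pi> 2(1) by (auto simp: bij_betw_def inj_eq)
        then show ?thesis using 2 kp last by (simp add: vtx_def drop_coord_def v)
      next
        case 3
        have "\<pi> k \<noteq> \<pi> c" using \<pi> 3(1) by (auto simp: bij_betw_def inj_eq)
        then show ?thesis using 3 by (simp add: vtx_def drop_coord_def v transpose_apply_other)
      next
        case 4
        have "\<pi> k \<noteq> \<pi> c" using \<pi> 4(1) by (auto simp: bij_betw_def inj_eq)
        then show ?thesis using 4 kp above[of "\<pi> c"]
          by (auto simp: vtx_def drop_coord_def v Transposition.transpose_def)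
      qed
    qed
    ultimately show ?thesis by simp
  qed
  have ex: "\<exists>i. \<pi> i = k \<and> v $ i = rev u ! k" if "k < ?n" for k
    using surj[OF that] that u(3) by (auto simp: v desc_def)
  obtain k0 where k0: "k0 < ?n" "rev u ! k0 = y"
    using x(2) u(3) by (metis in_set_conv_nth length_rev set_rev)
  have eq: "a = b" if ab: "a < ?n" "b < ?n" "rev u ! a = x" "rev u ! b = x" for a b
  proof -
    obtain i j k where "\<pi> i = a" "v $ i = x" "\<pi> j = b" "v $ j = x" "v $ k = y"
      using ex[OF ab(1)] ex[OF ab(2)] ex[OF k0(1)] ab k0 by metis
    moreover from this have "i = j"
      using x by (intro unique_of_simple[OF simple dim, where k = k] swap_in drop_in) auto
    ultimately show ?thesis by simp
  qed
  have "count_list u x = count_list (rev u) x" by (simp add: count_list_rev)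
  also have "\<dots> = card {k. k < length (rev u) \<and> x = rev u ! k}"
    by (simp only: count_list_eq_length_filter length_filter_conv_card)
  finally have "count_list u x = card {k. k < length (rev u) \<and> x = rev u ! k}" .
  moreover have "card {k. k < length (rev u) \<and> x = rev u ! k} \<le> Suc 0"
    using eq u(3) by (subst card_le_Suc0_iff_eq) auto
  ultimately show ?thesis by simp
qed

lemma pcompose_monom_1: "pcompose (monom 1 k) (p :: 'a::comm_ring_1 poly) = p ^ k"
  by (induction k) (simp_all add: monom_Suc pcompose_pCons pcompose_1)

theorem theorem6p6:
  fixes m :: "nat list" and d :: "real list" and l n z :: nat
    and P :: "(real^'n) set" and g :: "int poly"
  assumes "MD_pair m d"
    and "length m = l + 1"
    and "l \<ge> 2"
    and "n = sum_list m"
    and "CARD('n) = n"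
    and "P = PF_MD m d"
    and "aff_dim P = int n"
    and "simple_polytope P"
    and "z = min (m ! l) (n - m ! l - 1)"
    and "g = (\<Sum>i=0..z. smult (int (n choose i)) (\<Sum>j=i+1..n-i. monom 1 j))
           + (\<Sum>i=1..l-2. smult (int (n choose (i + m ! l)))
                ((\<Sum>j=2..n-i-m!l. monom 1 j) * eulerian_poly (i + m ! l) (T_poset i (m ! l))))"
  shows "h_polynomial P =
    (if m ! 0 = 0 then
       (\<Sum>j=0..m!l. monom (int (n choose j)) j)
       + monom 1 1 * (\<Sum>i=1..l-1. smult (int (n choose (i + m ! l)))
                        (eulerian_poly (i + m ! l) (T_poset i (m ! l))))
     else
       g + (\<Sum>j=0..m!l. monom (int (n choose j)) j)
       + monom 1 1 * (\<Sum>i=1..l-2. smult (int (n choose (i + m ! l)))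
                        (eulerian_poly (i + m ! l) (T_poset i (m ! l)))))"
proof -
  obtain u where u: "admissible u" "m = multiplicity_vector u" "d = data_vector u"
    using assms(1) by (auto simp: MD_pair_def)
  have sorted: "sorted u" and nonneg: "\<forall>x\<in>set u. 0 \<le> x" using u(1) by (auto simp: admissible_def)
  have P: "P = PF u" using assms(6) u MD_vector_eq[OF u(1)] by (simp add: PF_MD_def)
  have ld: "length d = l" using assms(2) u by (simp add: multiplicity_vector_def)
  have m_eq: "m = count_list u 0 # map (count_list u) d" using u by (simp add: multiplicity_vector_def)
  have d: "sorted d" "distinct d" "set d = {x \<in> set u. 0 < x}" using u by (simp_all add: data_vector_def)
  have map2: "map2 replicate (map f xs) xs = map (\<lambda>x. replicate (f x) x) xs" for f and xs :: "real list"
    by (induction xs) auto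
  have u_eq: "u = replicate (m ! 0) 0 @ concat (map (\<lambda>x. replicate (count_list u x) x) d)"
    using MD_vector_eq[OF u(1)] unfolding u(2)[symmetric] u(3)[symmetric]
    by (simp add: MD_vector_def m_eq map2)
  have len_concat: "length (concat (map (\<lambda>x. replicate (f x) x) xs)) = sum_list (map f xs)" for f and xs :: "real list"
    by (induction xs) auto
  have "length u = sum_list m"
    by (subst u_eq) (simp add: len_concat m_eq)
  then have len: "length u = CARD('n)" using assms(4,5) by simp
  define q where "q = m ! l"
  \<comment> \<open>So d has r + 1 = l - 1 entries below its top, in accordance with
    \<open>parking_facets\<close>.\<close>
  define r where "r = l - 2"
  define m0 where "m0 = m ! 0"
  define D where "D = last d"
  define e where "e = rev (butlast d)"
  have "d \<noteq> []" using ld assms(3) by auto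
  then have d_eq: "d = butlast d @ [D]" by (simp add: D_def)
  have len_e: "length e = r + 1" using ld assms(3) by (simp add: e_def r_def)
  have q_eq: "q = count_list u D"
    using ld assms(3) \<open>d \<noteq> []\<close> by (simp add: q_def m_eq D_def last_conv_nth nth_Cons')
  have "D \<in> set d" using \<open>d \<noteq> []\<close> by (simp add: D_def)
  then have D: "D \<in> set u" "0 < D" unfolding d(3) by auto
  have e_lt: "x < D" "0 < x" "x \<in> set u" if "x \<in> set e" for x
  proof -
    have x: "x \<in> set (butlast d)" using that by (simp add: e_def)
    show "0 < x" "x \<in> set u" using in_set_butlastD[OF x] d(3) by auto
    have "sorted (butlast d @ [D])" "distinct (butlast d @ [D])" using d d_eq by metis+
    then show "x < D" using x by (fastforce simp: sorted_append less_le)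
  qed
  have cnt1: "count_list u x = 1" if "x \<in> set (butlast d)" for x
  proof -
    have x: "x < D" "0 < x" "x \<in> set u" using e_lt[of x] that by (simp_all add: e_def)
    have "count_list u x \<le> 1"
      using assms(5,7,8) x D unfolding P by (intro simple_imp_count_le_1[OF sorted nonneg len, where y = D]) auto
    moreover have "count_list u x \<noteq> 0" using x(3) by (simp add: count_list_0_iff)
    ultimately show ?thesis by simp
  qed
  have "concat (map (\<lambda>x. replicate (count_list u x) x) (butlast d)) = butlast d"
  proof -
    have "concat (map (\<lambda>x. replicate (f x) x) xs) = xs" if "\<And>x. x \<in> set xs \<Longrightarrow> f x = 1" for f and xs :: "real list"
      using that by (induction xs) auto
    then show ?thesis using cnt1 by blast
  qed
  then have "concat (map (\<lambda>x. replicate (count_list u x) x) d) = butlast d @ replicate q D"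
    by (subst d_eq) (simp add: q_eq del: append_butlast_last_id)
  then have u_eq': "u = replicate m0 0 @ butlast d @ replicate q D" using u_eq by (simp add: m0_def)
  then have rev_u: "rev u = replicate q D @ e @ replicate m0 0" by (simp add: e_def)
  have lenu: "length u = q + r + 1 + m0" using arg_cong[OF rev_u, of length] len_e by simp
  have desc_top: "desc u k = D" if "k < q" for k
    using that lenu by (simp add: desc_def rev_u nth_append)
  have desc_mid: "desc u k = e ! (k - q)" if "q \<le> k" "k \<le> q + r" for k
    using that lenu len_e by (simp add: desc_def rev_u nth_append)
  have desc_low: "desc u k = 0" if "q + r < k" for k
    using that lenu len_e by (simp add: desc_def rev_u nth_append) linarith
  have e_dec: "e ! b < e ! a" if "a < b" "b < r + 1" for a b
  proof -
    have "sorted_wrt (<) d" using d strict_sorted_iff by blast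
    then have "sorted_wrt (<) (butlast d)" by (metis d_eq sorted_wrt_append)
    then have "sorted_wrt (\<lambda>x y. y < x) e" by (simp add: e_def sorted_wrt_rev)
    then show ?thesis using that len_e by (simp add: sorted_wrt_iff_nth_less)
  qed
  have q1: "1 \<le> q" using D by (simp add: q_eq Suc_le_eq count_list_0_iff flip: neq0_conv)
  have n_eq: "n = q + r + 1 + m0" using lenu len assms(5) by simp
  interpret parking_facets u q r m0 "TYPE('n)"
  proof
    show "CARD('n) = q + r + 1 + m0" using lenu len by simp
    show "desc u k = desc u 0" if "k < q" for k using desc_top[of k] desc_top[of 0] that by simp
    show "desc u j < desc u k" if "q \<le> Suc k" "k < j" "k \<le> q + r" for j k
    proof -
      have e_in: "e ! i \<in> set e" if "i < r + 1" for i using that len_e by simp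
      consider "k < q" "q + r < j" | "k < q" "j \<le> q + r" | "q \<le> k" "q + r < j" | "q \<le> k" "j \<le> q + r"
        by linarith
      then show ?thesis
      proof cases
        case 1
        then show ?thesis using desc_top desc_low D by simp
      next
        case 2
        then have "q \<le> j" using that by linarith
        then show ?thesis using 2 desc_top[of k] desc_mid[of j] e_lt(1)[OF e_in[of "j - q"]] by simp
      next
        case 3
        then show ?thesis using that desc_low[of j] desc_mid[of k] e_lt(2)[OF e_in[of "k - q"]] by simp
      next
        case 4
        then show ?thesis using that desc_mid[of j] desc_mid[of k] e_dec[of "k - q" "j - q"] by simp
      qed
    qed
  qed (use sorted nonneg len q1 desc_low in auto)
  \<comment> \<open>The shift in \<open>h_polynomial_eq\<close>: s is t - 1, and 1 + s is the
    indeterminate.\<close>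
  define s where "s = [:-1, 1::int:]"
  define w where "w j = (if j \<le> q then 1 else eulerian_poly j (T_poset (j - q) q))" for j
  have cw: "chain_weights s q w" unfolding s_def w_def by (rule chain_weights_eulerian[OF q1])
  have w_shift: "(\<Sum>i=1..k. F i (w (i + q))) = (\<Sum>i=1..k. F i (eulerian_poly (i + q) (T_poset i q)))"
    for F :: "nat \<Rightarrow> int poly \<Rightarrow> int poly" and k
    by (intro sum.cong refl) (simp add: w_def)
  have t: "1 + s = monom 1 1" by (simp add: s_def monom_Suc one_pCons)
  have tk: "(1 + s) ^ k = monom 1 k" for k by (simp add: t monom_power)
  have smult: "of_nat c * p = smult (int c) p" for c and p :: "int poly"
    by (simp add: of_nat_poly)
  have "h_polynomial P = pcompose (f_polynomial P) s" by (simp add: h_polynomial_eq s_def)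
  also have "\<dots> = (\<Sum>(N, A, C) | valid N A C. s ^ (CARD('n) - (card N + card A + card C)))"
    using f_polynomial_PF assms(5,7) unfolding P
    by (simp add: pcompose_sum case_prod_unfold pcompose_monom_1)
  also have "\<dots> = chain_weights.face_sum s w (q + r) m0" by (rule sum_valid[OF cw])
  finally have h: "h_polynomial P = chain_weights.face_sum s w (q + r) m0" .
  show ?thesis
  proof (cases "m ! 0 = 0")
    case True
    \<comment> \<open>The upper limit exceeds r by one: i = r + 1 is the term v = n of
      \<open>face_sum_0\<close>.\<close>
    have l1: "l - 1 = r + 1" using assms(3) by (simp add: r_def)
    have n0: "n = q + r + 1" using True n_eq by (simp add: m0_def)
    have "h_polynomial P = (\<Sum>j=0..q. of_nat (n choose j) * (1 + s) ^ j)
        + (1 + s) * (\<Sum>i=1..r + 1. of_nat (n choose (i + q)) * w (i + q))"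
    proof -
      have "m0 = 0" using True by (simp add: m0_def)
      then show ?thesis unfolding h n0 using chain_weights.face_sum_0_eq[OF cw, of r] by (simp only:)
    qed
    also have "\<dots> = (\<Sum>j=0..q. monom (int (n choose j)) j)
       + monom 1 1 * (\<Sum>i=1..r + 1. smult (int (n choose (i + q))) (eulerian_poly (i + q) (T_poset i q)))"
      unfolding smult tk unfolding t w_shift[of "\<lambda>i p. smult (int (n choose (i + q))) p"] smult_monom mult_1_right ..
    finally show ?thesis unfolding if_P[OF True] l1 q_def .
  next
    case False
    have "s \<noteq> 0" by (simp add: s_def)
    have "h_polynomial P = (\<Sum>i=0..z. of_nat (n choose i) * (\<Sum>j=i+1..n-i. (1 + s) ^ j))
        + (\<Sum>i=1..r. of_nat (n choose (i + q)) * ((\<Sum>j=2..n-i-q. (1 + s) ^ j) * w (i + q)))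
        + (\<Sum>j=0..q. of_nat (n choose j) * (1 + s) ^ j)
        + (1 + s) * (\<Sum>i=1..r. of_nat (n choose (i + q)) * w (i + q))"
      unfolding h assms(9) q_def[symmetric] by (rule face_sum_eq[OF cw \<open>s \<noteq> 0\<close> n_eq])
    also have "\<dots> = g + (\<Sum>j=0..q. monom (int (n choose j)) j)
       + monom 1 1 * (\<Sum>i=1..r. smult (int (n choose (i + q))) (eulerian_poly (i + q) (T_poset i q)))"
      unfolding smult tk unfolding t assms(10) q_def[symmetric] r_def[symmetric] smult_monom mult_1_right
        w_shift[of "\<lambda>i p. smult (int (n choose (i + q))) p"]
        w_shift[of "\<lambda>i p. smult (int (n choose (i + q))) ((\<Sum>j=2..n-i-q. monom 1 j) * p)"] ..
    finally show ?thesis unfolding if_not_P[OF False] q_def r_def .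
  qed
qed

end
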